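(* If $\mathcal{A}$ is a masa in a type $II_1$ factor $\mathcal{M}$, then $$\delta(\mathcal{A})\ge\alpha(\mathcal{A})/\sqrt{5}.$$ In particular, $\delta(\mathcal{A})\ge 1/\sqrt{5}$ for all strongly singular masas $\mathcal{A}$.
   Context: Let $\mathcal{M}$ be a type $II_1$ factor with normalized trace $\mathrm{tr}$; $\|\cdot\|$ is the operator norm and $\|x\|_2=(\mathrm{tr}(x^*x))^{1/2}$. For a von Neumann subalgebra $\mathcal{N}\subseteq\mathcal{M}$ (containing the identity of $\mathcal M$), $\mathbb{E}_{\mathcal{N}}:\mathcal{M}\to\mathcal{N}$ is the unique trace preserving conditional expectation. For a linear map $\phi:\mathcal{M}\to\mathcal{M}$, $\|\phi\|_{\infty,2}=\sup\{\|\phi(x)\|_2: x\in\mathcal{M},\ \|x\|\le 1\}$. A masa is a maximal abelian self-adjoint subalgebra. For a masa $\mathcal{A}\subseteq\mathcal{M}$, $\alpha(\mathcal{A})$ is the supremum of all numbers $\alpha$ for which $\|\mathbb{E}_{u\mathcal{A}u^*}-\mathbb{E}_{\mathcal{A}}\|_{\infty,2}\ge\alpha\|u-\mathbb{E}_{\mathcal{A}}(u)\|_2$ holds for all unitaries $u\in\mathcal{M}$. The masa $\mathcal{A}$ is strongly singular if this inequality holds for all unitaries $u\in\mathcal{M}$ with $\alpha=1$. Popa invariant: for a masa $\mathcal{A}\subseteq\mathcal{M}$ and a non-zero partial isometry $v\in\mathcal{M}$ such that $vv^*$ and $v^*v$ are orthogonal projections in $\mathcal{A}$, put $\delta(v\mathcal{A}v^*,\mathcal{A})=\sup\{\|x-\mathbb{E}_{\mathcal{A}}(x)\|_2: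 x\in v\mathcal{A}v^*,\ \|x\|\le1\}$. Then $\delta(\mathcal{A})$ is the largest $\lambda$ for which $\delta(v\mathcal{A}v^*,\mathcal{A})\ge\lambda\|v^*v\|_2$ holds for all such $v$. *)

theory Defs
  imports "HOL-Analysis.Analysis"
begin

section \<open>Complex Hilbert spaces and their bounded operators\<close>

text \<open>
  The inner product is conjugate-linear in the first argument. Positive definiteness comes
  from \<open>inner_eq_Re_cinner\<close>, as \<open>cinner x x\<close> is real by conjugate symmetry
  and its real part is the squared norm of \<open>x\<close>.
\<close>

class chilbert_space = real_inner + complete_space +
  fixes scaleC :: "complex \<Rightarrow> 'a \<Rightarrow> 'a"  (infixr "*\<^sub>C" 75)
    and cinner :: "'a \<Rightarrow> 'a \<Rightarrow> complex"
  assumes scaleC_add_right: "c *\<^sub>C (x + y) = c *\<^sub>C x + c *\<^sub>C y"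
    and scaleC_add_left: "(c + d) *\<^sub>C x = c *\<^sub>C x + d *\<^sub>C x"
    and scaleC_scaleC: "c *\<^sub>C d *\<^sub>C x = (c * d) *\<^sub>C x"
    and scaleR_scaleC: "r *\<^sub>R x = complex_of_real r *\<^sub>C x"
    and cinner_commute: "cinner x y = cnj (cinner y x)"
    and cinner_add_right: "cinner x (y + z) = cinner x y + cinner x z"
    and cinner_scaleC_right: "cinner x (c *\<^sub>C y) = c * cinner x y"
    and inner_eq_Re_cinner: "inner x y = Re (cinner x y)"

lemma norm_scaleC: "norm (c *\<^sub>C x) = cmod c * norm (x :: 'a :: chilbert_space)"
proof -
  have "cinner (c *\<^sub>C x) (c *\<^sub>C x) = (c * cnj c) * cinner x x"
    by (metis cinner_commute cinner_scaleC_right complex_cnj_mult mult.assoc)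
  also have "c * cnj c = complex_of_real ((cmod c)\<^sup>2)"
    by (rule complex_norm_square [symmetric])
  finally have "inner (c *\<^sub>C x) (c *\<^sub>C x) = (cmod c)\<^sup>2 * inner x x"
    by (simp add: inner_eq_Re_cinner)
  then show ?thesis
    by (simp add: norm_eq_sqrt_inner real_sqrt_mult)
qed

lemma bounded_linear_scaleC: "bounded_linear ((*\<^sub>C) c :: 'a \<Rightarrow> 'a :: chilbert_space)"
  by (rule bounded_linear_intro [where K = "cmod c"])
    (simp_all add: scaleC_add_right scaleR_scaleC scaleC_scaleC norm_scaleC mult.commute)

text \<open>
  The library's type of bounded real-linear maps carries the operator norm. The elements of
  \<open>B(H)\<close> are its complex-linear members.
\<close>

type_synonym 'h operator = "'h \<Rightarrow>\<^sub>L 'h"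

definition bounded_ops :: "('h :: chilbert_space) operator set"  where
  "bounded_ops = {a. \<forall>c x. blinfun_apply a (c *\<^sub>C x) = c *\<^sub>C blinfun_apply a x}"

lift_definition scale_op :: "complex \<Rightarrow> ('h :: chilbert_space) operator \<Rightarrow> 'h operator"
  (infixr "*\<^sub>O" 75) is "\<lambda>c f x. c *\<^sub>C f x"
  using bounded_linear_compose [OF bounded_linear_scaleC] by blast

definition adj :: "('h :: chilbert_space) operator \<Rightarrow> 'h operator"  ("_\<^sup>\<star>" [1000] 999) where
  "a\<^sup>\<star> = (THE b. \<forall>x y. cinner (blinfun_apply b x) y = cinner x (blinfun_apply a y))"

definition pos_op :: "('h :: chilbert_space) operator \<Rightarrow> bool" where
  "pos_op a \<longleftrightarrow> (\<forall>x. cinner x (blinfun_apply a x) \<in> \<real>\<^sub>\<ge>\<^sub>0)"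

definition op_le :: "('h :: chilbert_space) operator \<Rightarrow> 'h operator \<Rightarrow> bool" where
  "op_le a b \<longleftrightarrow> pos_op (b - a)"


section \<open>Type II1 factors\<close>

definition commutant :: "('h :: chilbert_space) operator set \<Rightarrow> 'h operator set" where
  "commutant S = {b \<in> bounded_ops. \<forall>a\<in>S. a o\<^sub>L b = b o\<^sub>L a}"

definition von_neumann_algebra :: "('h :: chilbert_space) operator set \<Rightarrow> bool" where
  "von_neumann_algebra M \<longleftrightarrow>
     M \<subseteq> bounded_ops \<and> (\<forall>a\<in>M. a\<^sup>\<star> \<in> M) \<and> commutant (commutant M) = M"

definition factor :: "('h :: chilbert_space) operator set \<Rightarrow> bool" where
  "factor M \<longleftrightarrow> von_neumann_algebra M \<and> (id_blinfun :: 'h operator) \<noteq> 0 \<and>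
     M \<inter> commutant M = {c *\<^sub>O id_blinfun | c. True}"

definition projection :: "('h :: chilbert_space) operator \<Rightarrow> bool" where
  "projection e \<longleftrightarrow> e \<in> bounded_ops \<and> e\<^sup>\<star> = e \<and> e o\<^sub>L e = e"

text \<open>Every isometry in \<open>M\<close> is unitary.\<close>

definition finite_vna :: "('h :: chilbert_space) operator set \<Rightarrow> bool" where
  "finite_vna M \<longleftrightarrow> (\<forall>v\<in>M. v\<^sup>\<star> o\<^sub>L v = id_blinfun \<longrightarrow> v o\<^sub>L v\<^sup>\<star> = id_blinfun)"

definition abelian_projection :: "('h :: chilbert_space) operator set \<Rightarrow> 'h operator \<Rightarrow> bool" where
  "abelian_projection M e \<longleftrightarrow> e \<in> M \<and> projection e \<and>
     (\<forall>x\<in>M. \<forall>y\<in>M. (e o\<^sub>L x o\<^sub>L e) o\<^sub>L (e o\<^sub>L y o\<^sub>L e) = (e o\<^sub>L y o\<^sub>L e) o\<^sub>L (e o\<^sub>L x o\<^sub>L e))"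

definition type_II1_factor :: "('h :: chilbert_space) operator set \<Rightarrow> bool" where
  "type_II1_factor M \<longleftrightarrow> factor M \<and> finite_vna M \<and> (\<forall>e. abelian_projection M e \<longrightarrow> e = 0)"


section \<open>The trace and the 2-norm\<close>

definition linear_on_vna ::
  "('h :: chilbert_space) operator set \<Rightarrow> ('h operator \<Rightarrow> complex) \<Rightarrow> bool" where
  "linear_on_vna M f \<longleftrightarrow>
     (\<forall>x\<in>M. \<forall>y\<in>M. f (x + y) = f x + f y) \<and> (\<forall>c. \<forall>x\<in>M. f (c *\<^sub>O x) = c * f x)"

text \<open>
  Normality of a positive functional: it preserves least upper bounds of upward directed sets
  of positive elements that are bounded above in \<open>M\<close>.
\<close>

definition normal_on_vna ::
  "('h :: chilbert_space) operator set \<Rightarrow> ('h operator \<Rightarrow> complex) \<Rightarrow> bool" where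
  "normal_on_vna M f \<longleftrightarrow>
     (\<forall>D s. D \<noteq> {} \<and> D \<subseteq> {x \<in> M. pos_op x} \<and>
        (\<forall>a\<in>D. \<forall>b\<in>D. \<exists>c\<in>D. op_le a c \<and> op_le b c) \<and>
        s \<in> M \<and> (\<forall>a\<in>D. op_le a s) \<and> (\<forall>t\<in>M. (\<forall>a\<in>D. op_le a t) \<longrightarrow> op_le s t)
        \<longrightarrow> Re (f s) = (SUP a\<in>D. Re (f a)))"

text \<open>
  A faithful normal tracial state. On a type II1 factor there is exactly one, up to its
  irrelevant values outside \<open>M\<close>.
\<close>

definition normalized_trace ::
  "('h :: chilbert_space) operator set \<Rightarrow> ('h operator \<Rightarrow> complex) \<Rightarrow> bool" where
  "normalized_trace M tr \<longleftrightarrow>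
     linear_on_vna M tr \<and> tr id_blinfun = 1 \<and>
     (\<forall>x\<in>M. tr (x\<^sup>\<star> o\<^sub>L x) \<in> \<real>\<^sub>\<ge>\<^sub>0) \<and>
     (\<forall>x\<in>M. tr (x\<^sup>\<star> o\<^sub>L x) = 0 \<longrightarrow> x = 0) \<and>
     (\<forall>x\<in>M. \<forall>y\<in>M. tr (x o\<^sub>L y) = tr (y o\<^sub>L x)) \<and>
     normal_on_vna M tr"

definition norm2 :: "(('h :: chilbert_space) operator \<Rightarrow> complex) \<Rightarrow> 'h operator \<Rightarrow> real" where
  "norm2 tr x = sqrt (Re (tr (x\<^sup>\<star> o\<^sub>L x)))"

text \<open>
  The supremum is taken in the reals, which is meaningful for maps bounded from the operator
  norm to the 2-norm, such as differences of conditional expectations.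
\<close>

definition norm_inf_2 :: "('h :: chilbert_space) operator set \<Rightarrow> ('h operator \<Rightarrow> complex) \<Rightarrow>
    ('h operator \<Rightarrow> 'h operator) \<Rightarrow> real" where
  "norm_inf_2 M tr \<phi> = (SUP x\<in>{x \<in> M. norm x \<le> 1}. norm2 tr (\<phi> x))"


section \<open>Conditional expectations and masas\<close>

definition is_cond_exp :: "('h :: chilbert_space) operator set \<Rightarrow> ('h operator \<Rightarrow> complex) \<Rightarrow>
    'h operator set \<Rightarrow> ('h operator \<Rightarrow> 'h operator) \<Rightarrow> bool" where
  "is_cond_exp M tr N E \<longleftrightarrow>
     (\<forall>x\<in>M. E x \<in> N) \<and>
     (\<forall>x\<in>M. \<forall>y\<in>M. E (x + y) = E x + E y) \<and> (\<forall>c. \<forall>x\<in>M. E (c *\<^sub>O x) = c *\<^sub>O E x) \<and>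
     (\<forall>x\<in>M. pos_op x \<longrightarrow> pos_op (E x)) \<and>
     (\<forall>a\<in>N. E a = a) \<and>
     (\<forall>a\<in>N. \<forall>x\<in>M. \<forall>b\<in>N. E (a o\<^sub>L x o\<^sub>L b) = a o\<^sub>L E x o\<^sub>L b) \<and>
     (\<forall>x\<in>M. tr (E x) = tr x)"

text \<open>
  For a von Neumann subalgebra \<open>N\<close> of \<open>M\<close> such a map exists and its restriction to
  \<open>M\<close> is unique; its values outside \<open>M\<close> are never used.
\<close>

definition cond_exp :: "('h :: chilbert_space) operator set \<Rightarrow> ('h operator \<Rightarrow> complex) \<Rightarrow>
    'h operator set \<Rightarrow> 'h operator \<Rightarrow> 'h operator" where
  "cond_exp M tr N = (SOME E. is_cond_exp M tr N E)"

definition star_subalgebra ::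
  "('h :: chilbert_space) operator set \<Rightarrow> 'h operator set \<Rightarrow> bool" where
  "star_subalgebra A M \<longleftrightarrow>
     A \<subseteq> M \<and> 0 \<in> A \<and> (\<forall>x\<in>A. \<forall>y\<in>A. x + y \<in> A \<and> x o\<^sub>L y \<in> A) \<and>
     (\<forall>c. \<forall>x\<in>A. c *\<^sub>O x \<in> A) \<and> (\<forall>x\<in>A. x\<^sup>\<star> \<in> A)"

definition abelian :: "('h :: chilbert_space) operator set \<Rightarrow> bool" where
  "abelian A \<longleftrightarrow> (\<forall>x\<in>A. \<forall>y\<in>A. x o\<^sub>L y = y o\<^sub>L x)"

text \<open>
  No closedness or unitality is required: a maximal abelian self-adjoint subalgebra of a
  von Neumann algebra automatically contains the identity and is a von Neumann subalgebra.
\<close>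

definition masa :: "('h :: chilbert_space) operator set \<Rightarrow> 'h operator set \<Rightarrow> bool" where
  "masa A M \<longleftrightarrow> star_subalgebra A M \<and> abelian A \<and>
     (\<forall>B. star_subalgebra B M \<and> abelian B \<and> A \<subseteq> B \<longrightarrow> B = A)"


section \<open>The invariants\<close>

definition unitary :: "('h :: chilbert_space) operator \<Rightarrow> bool" where
  "unitary u \<longleftrightarrow> u\<^sup>\<star> o\<^sub>L u = id_blinfun \<and> u o\<^sub>L u\<^sup>\<star> = id_blinfun"

definition conj_set ::
  "('h :: chilbert_space) operator \<Rightarrow> 'h operator set \<Rightarrow> 'h operator set" where
  "conj_set v A = (\<lambda>a. v o\<^sub>L a o\<^sub>L v\<^sup>\<star>) ` A"

definition sing_ineq :: "('h :: chilbert_space) operator set \<Rightarrow> ('h operator \<Rightarrow> complex) \<Rightarrow>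
    'h operator set \<Rightarrow> real \<Rightarrow> bool" where
  "sing_ineq M tr A \<alpha> \<longleftrightarrow> (\<forall>u\<in>M. unitary u \<longrightarrow>
     norm_inf_2 M tr (\<lambda>x. cond_exp M tr (conj_set u A) x - cond_exp M tr A x)
       \<ge> \<alpha> * norm2 tr (u - cond_exp M tr A u))"

definition alpha_inv :: "('h :: chilbert_space) operator set \<Rightarrow> ('h operator \<Rightarrow> complex) \<Rightarrow>
    'h operator set \<Rightarrow> real" where
  "alpha_inv M tr A = Sup {\<alpha>. sing_ineq M tr A \<alpha>}"

definition strongly_singular :: "('h :: chilbert_space) operator set \<Rightarrow>
    ('h operator \<Rightarrow> complex) \<Rightarrow> 'h operator set \<Rightarrow> bool" where
  "strongly_singular M tr A \<longleftrightarrow> sing_ineq M tr A 1"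

definition partial_isometry :: "('h :: chilbert_space) operator \<Rightarrow> bool" where
  "partial_isometry v \<longleftrightarrow> v o\<^sub>L v\<^sup>\<star> o\<^sub>L v = v"

definition delta_dist :: "('h :: chilbert_space) operator set \<Rightarrow> ('h operator \<Rightarrow> complex) \<Rightarrow>
    'h operator set \<Rightarrow> 'h operator set \<Rightarrow> real" where
  "delta_dist M tr B A = (SUP x\<in>{x \<in> B. norm x \<le> 1}. norm2 tr (x - cond_exp M tr A x))"

text \<open>The last condition on \<open>v\<close> says that its range and source projections are mutually orthogonal.\<close>

definition popa_ineq :: "('h :: chilbert_space) operator set \<Rightarrow> ('h operator \<Rightarrow> complex) \<Rightarrow>
    'h operator set \<Rightarrow> real \<Rightarrow> bool" where
  "popa_ineq M tr A c \<longleftrightarrow> (\<forall>v\<in>M. v \<noteq> 0 \<and> partial_isometry v \<and>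
       v o\<^sub>L v\<^sup>\<star> \<in> A \<and> v\<^sup>\<star> o\<^sub>L v \<in> A \<and> (v o\<^sub>L v\<^sup>\<star>) o\<^sub>L (v\<^sup>\<star> o\<^sub>L v) = 0 \<longrightarrow>
     delta_dist M tr (conj_set v A) A \<ge> c * norm2 tr (v\<^sup>\<star> o\<^sub>L v))"

definition delta_inv :: "('h :: chilbert_space) operator set \<Rightarrow> ('h operator \<Rightarrow> complex) \<Rightarrow>
    'h operator set \<Rightarrow> real" where
  "delta_inv M tr A = (GREATEST c. popa_ineq M tr A c)"

end

theory Submission
  imports Defs
begin

text \<open>
  Let \<open>v\<close> be a partial isometry in \<open>M\<close> with orthogonal source and range projections
  \<open>p = v\<^sup>\<star>v\<close> and \<open>q = vv\<^sup>\<star>\<close> in the masa \<open>A\<close>, and let \<open>d\<close> be the distance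
  \<open>\<delta>(vAv\<^sup>\<star>, A)\<close>. The operator \<open>u = v + v\<^sup>\<star> + (1 - p - q)\<close> is a unitary
  that exchanges \<open>p\<close> and \<open>q\<close>; as \<open>E(v) = E(qvp) = 0\<close> for the conditional expectation
  \<open>E\<close> onto \<open>A\<close>, one has \<open>\<parallel>u - E(u)\<parallel>\<^sub>2 = \<surd>2 \<parallel>p\<parallel>\<^sub>2\<close>. Let \<open>F\<close> be the
  conditional expectation onto \<open>B = uAu\<^sup>\<star>\<close> and let \<open>x\<close> be a contraction. The difference
  \<open>F(x) - E(x)\<close> vanishes under \<open>1 - p - q\<close>, and its parts under \<open>p\<close> and \<open>q\<close> are
  orthogonal; conjugation by \<open>u\<close> turns the part under \<open>p\<close>, up to sign, into the part under
  \<open>q\<close> of the same difference at \<open>uxu\<close>. The part under \<open>q\<close> splits by the theorem of Pythagoras: the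
  distance of \<open>qF(x)\<close>, an element of the unit ball of \<open>vAv\<^sup>\<star>\<close>, from \<open>A\<close> is at most
  \<open>d\<close>, while \<open>\<parallel>qE(x - F(x))\<parallel>\<^sub>2 \<le> 2d\<close>, since \<open>F(x)\<close> is a limit of convex
  combinations of \<open>wxw\<^sup>\<star>\<close> with \<open>w\<close> a unitary of \<open>B\<close>, and \<open>b = qw\<close> satisfies
  \<open>\<parallel>b - E(b)\<parallel>\<^sub>2 \<le> d\<close> and
  \<open>qE(wxw\<^sup>\<star> - x) = E((b - E(b))xw\<^sup>\<star>) - E(xw\<^sup>\<star>(b - E(b)))\<close>. Hence
  \<open>\<parallel>F(x) - E(x)\<parallel>\<^sub>2\<^sup>2 \<le> 2(1 + 4)d\<^sup>2\<close>, so that an inequality with constant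
  \<open>\<alpha>\<close> for all unitaries gives \<open>\<alpha>\<surd>2 \<parallel>p\<parallel>\<^sub>2 \<le> \<surd>10 d\<close>
  (\<open>delta_ge\<close>, \<open>popa_ineq_of_sing_ineq\<close>).

  The conditional expectation onto a masa is constructed by averaging: the element of minimal 2-norm
  in the closed convex hull of all \<open>wxw\<^sup>\<star>\<close> commutes with the unitaries of the masa
  (\<open>orbit_hull_average\<close>). This uses that norm balls of \<open>M\<close> are complete for the 2-norm
  (\<open>bounded_cauchy_limit\<close>), which is deduced from normality of the trace by a Chebyshev
  inequality with resolvents as cut-offs (\<open>resolvent_cutoff\<close>).

  The invariant of Popa is a greatest element, which is meaningful only if some \<open>v\<close> as above
  exists (\<open>popa_isometry_exists\<close>). A masa of a type II1 factor has no minimal projections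
  (\<open>masa_diffuse\<close>), hence contains a projection of trace one half (\<open>half_projection\<close>), and
  this one is equivalent to its complement, because projections of equal trace in a factor are
  equivalent (\<open>equivalent_projections\<close>).
\<close>


section \<open>Orthogonal projections and the representation of functionals\<close>

lemma cinner_scaleC_left: "cinner (c *\<^sub>C x) (z::'h::chilbert_space) = cnj c * cinner x z"
  by (metis cinner_commute cinner_scaleC_right complex_cnj_mult)

lemma Re_cinner_ii: "Re (cinner (\<i> *\<^sub>C x) y) = Im (cinner (x::'h::chilbert_space) y)"
  by (simp add: cinner_scaleC_left)

text \<open>The complex inner product is determined by the real one, which carries most of what follows.\<close>

lemma cinner_eq_inner:
  "cinner (x::'h::chilbert_space) y = Complex (inner x y) (inner (\<i> *\<^sub>C x) y)"
  by (simp add: complex_eq_iff inner_eq_Re_cinner Re_cinner_ii del: Re_cinner_ii)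
     (simp add: cinner_scaleC_left)

lemma vec_eqI: assumes "\<And>z::'h::real_inner. inner z x = inner z y" shows "x = y"
  using assms[of "x - y"] by (metis eq_iff_diff_eq_0 inner_diff_right inner_eq_zero_iff)

lemma scaleC_zero_right [simp]: "c *\<^sub>C (0::'h::chilbert_space) = 0"
  using norm_scaleC[of c "0::'h"] by simp

lemma scaleC_one [simp]: "1 *\<^sub>C (x::'h::chilbert_space) = x"
  using scaleR_scaleC[of 1 x] by simp

lemma scaleC_minus_right: "c *\<^sub>C (- x) = - (c *\<^sub>C (x::'h::chilbert_space))"
  using bounded_linear.linear[OF bounded_linear_scaleC[of c]] by (rule linear_neg)

lemma scaleC_diff_right: "c *\<^sub>C (x - y) = c *\<^sub>C x - c *\<^sub>C (y::'h::chilbert_space)"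
  using bounded_linear.linear[OF bounded_linear_scaleC[of c]] by (rule linear_diff)

lemma scaleC_scaleR: "c *\<^sub>C (r *\<^sub>R x) = r *\<^sub>R (c *\<^sub>C (x::'h::chilbert_space))"
  by (simp add: scaleR_scaleC scaleC_scaleC mult.commute)

lemma inner_scaleC_left: "inner (c *\<^sub>C x) (y::'h::chilbert_space) = inner x (cnj c *\<^sub>C y)"
  by (simp add: inner_eq_Re_cinner cinner_scaleC_left cinner_scaleC_right)

text \<open>A minimizing sequence for a quadratic functional on a convex set is Cauchy: the
  parallelogram law bounds its increments. This serves both for vectors of the Hilbert space and
  for operators with the 2-norm.\<close>

lemma minimizing_increment:
  fixes Q :: "'v::real_vector \<Rightarrow> real"
  assumes "Q (x - y) + Q (x + y) = 2 * Q x + 2 * Q y" and "Q (x + y) = 4 * Q ((1/2) *\<^sub>R (x + y))"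
    and "d \<le> Q ((1/2) *\<^sub>R (x + y))" and "Q x \<le> d + e" and "Q y \<le> d + e'"
  shows "Q (x - y) \<le> 2 * e + 2 * e'"
  using assms by linarith

lemma closed_subspace_projection:
  fixes S :: "'h::{real_inner,complete_space} set"
  assumes cl: "closed S" and sub: "subspace S"
  shows "\<exists>y\<in>S. \<forall>z\<in>S. inner (x - y) z = 0"
proof -
  define d where "d = (INF y\<in>S. (norm (x - y))\<^sup>2)"
  have S0: "0 \<in> S" using sub by (rule subspace_0)
  have bdd: "bdd_below ((\<lambda>y. (norm (x - y))\<^sup>2) ` S)" by (rule bdd_belowI[of _ 0]) auto
  have dle: "d \<le> (norm (x - y))\<^sup>2" if "y \<in> S" for y
    unfolding d_def using bdd that by (rule cINF_lower)
  have "\<exists>y\<in>S. (norm (x - y))\<^sup>2 < d + inverse (real (Suc n))" for n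
    unfolding d_def using cINF_less_iff[OF _ bdd] S0 d_def
    by (metis empty_iff less_add_same_cancel1 inverse_positive_iff_positive of_nat_0_less_iff zero_less_Suc)
  then obtain y where yS: "\<And>n. y n \<in> S" and yd: "\<And>n. (norm (x - y n))\<^sup>2 < d + inverse (real (Suc n))"
    by metis
  have inc: "(norm (y m - y n))\<^sup>2 \<le> 2 * inverse (real (Suc m)) + 2 * inverse (real (Suc n))" for m n
  proof -
    have "(norm ((x - y m) - (x - y n)))\<^sup>2 \<le> 2 * inverse (real (Suc m)) + 2 * inverse (real (Suc n))"
    proof (rule minimizing_increment[where Q = "\<lambda>v. (norm v)\<^sup>2" and d = d])
      show "(norm ((x - y m) - (x - y n)))\<^sup>2 + (norm ((x - y m) + (x - y n)))\<^sup>2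
        = 2 * (norm (x - y m))\<^sup>2 + 2 * (norm (x - y n))\<^sup>2"
        unfolding power2_norm_eq_inner by (simp add: inner_diff inner_add inner_commute algebra_simps)
      show "(norm (x - y m + (x - y n)))\<^sup>2 = 4 * (norm ((1 / 2) *\<^sub>R (x - y m + (x - y n))))\<^sup>2"
        by (simp only: norm_scaleR power_mult_distrib) (simp add: power2_eq_square)
      have "(1 / 2) *\<^sub>R (x - y m + (x - y n)) = x - (1/2) *\<^sub>R (y m + y n)"
        using scaleR_half_double[of x] by (simp add: algebra_simps)
      moreover have "(1/2) *\<^sub>R (y m + y n) \<in> S"
        using sub yS by (simp add: subspace_add subspace_scale)
      ultimately show "d \<le> (norm ((1 / 2) *\<^sub>R (x - y m + (x - y n))))\<^sup>2" using dle by metis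
    qed (use yd less_imp_le in auto)
    then show ?thesis by (simp add: norm_minus_commute)
  qed
  have "Cauchy y"
  proof (rule metric_CauchyI)
    fix e :: real assume e: "e > 0"
    obtain N where N: "inverse (real (Suc N)) < e\<^sup>2 / 4"
      using reals_Archimedean[of "e\<^sup>2/4"] e by auto
    have "dist (y m) (y n) < e" if "m \<ge> N" "n \<ge> N" for m n
    proof -
      have "inverse (real (Suc m)) \<le> inverse (real (Suc N))" "inverse (real (Suc n)) \<le> inverse (real (Suc N))"
        using that by (auto intro!: le_imp_inverse_le)
      then have "(norm (y m - y n))\<^sup>2 < e\<^sup>2" using inc[of m n] N by linarith
      then show ?thesis using e by (simp add: dist_norm power_less_imp_less_base)
    qed
    then show "\<exists>N. \<forall>m\<ge>N. \<forall>n\<ge>N. dist (y m) (y n) < e" by blast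
  qed
  then obtain l where l: "y \<longlonglongrightarrow> l" using Cauchy_convergent convergent_def by blast
  have lS: "l \<in> S" using closed_sequentially[OF cl] yS l by blast
  have "(\<lambda>n. (norm (x - y n))\<^sup>2) \<longlonglongrightarrow> (norm (x - l))\<^sup>2" by (intro tendsto_intros l)
  moreover have "(\<lambda>n. d + inverse (real (Suc n))) \<longlonglongrightarrow> d + 0"
    by (intro tendsto_intros LIMSEQ_inverse_real_of_nat)
  ultimately have "(norm (x - l))\<^sup>2 \<le> d + 0"
    by (rule LIMSEQ_le) (use yd less_imp_le in blast)
  then have ld: "(norm (x - l))\<^sup>2 \<le> d" by simp
  have "inner (x - l) z = 0" if z: "z \<in> S" for z
  proof (cases "z = 0")
    case False
    define t where "t = inner (x - l) z / (norm z)\<^sup>2"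
    have "l + t *\<^sub>R z \<in> S" using lS z sub by (simp add: subspace_add subspace_scale)
    then have "(norm (x - l))\<^sup>2 \<le> (norm (x - (l + t *\<^sub>R z)))\<^sup>2" using ld dle[of "l + t *\<^sub>R z"] by linarith
    also have "(norm (x - (l + t *\<^sub>R z)))\<^sup>2 = (norm ((x - l) - t *\<^sub>R z))\<^sup>2" by (simp add: algebra_simps)
    also have "\<dots> = (norm (x - l))\<^sup>2 - 2 * t * inner (x - l) z + t * t * (norm z)\<^sup>2"
      unfolding power2_norm_eq_inner by (simp add: inner_diff inner_commute algebra_simps)
    finally have "2 * t * inner (x - l) z \<le> t * t * (norm z)\<^sup>2" by linarith
    moreover have "t * (norm z)\<^sup>2 = inner (x - l) z" using False by (simp add: t_def)
    then have "t * t * (norm z)\<^sup>2 = t * inner (x - l) z" by (simp add: mult.assoc)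
    ultimately have "t * inner (x - l) z \<le> 0" by linarith
    moreover have "t * inner (x - l) z = (inner (x - l) z)\<^sup>2 / (norm z)\<^sup>2"
      by (simp add: t_def power2_eq_square)
    ultimately have "(inner (x - l) z)\<^sup>2 \<le> 0" using False by (simp add: divide_le_0_iff)
    then show ?thesis by simp
  qed simp
  then show ?thesis using lS by blast
qed

text \<open>The representation theorem of Riesz and Frechet.\<close>

lemma riesz:
  fixes f :: "'h::{real_inner,complete_space} \<Rightarrow> real"
  assumes f: "bounded_linear f"
  shows "\<exists>z. \<forall>x. f x = inner z x"
proof (cases "\<forall>x. f x = 0")
  case True then show ?thesis by (intro exI[of _ 0]) simp
next
  case False
  then obtain x where x: "f x \<noteq> 0" by blast
  interpret f: bounded_linear f by fact
  let ?S = "{y. f y = 0}"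
  have "closed ?S" by (intro closed_Collect_eq continuous_intros f.continuous_on continuous_on_id)
  moreover have "subspace ?S" by (simp add: subspace_def f.add f.scaleR f.zero)
  ultimately obtain y where y: "f y = 0" "\<And>z. f z = 0 \<Longrightarrow> inner (x - y) z = 0"
    using closed_subspace_projection[of ?S x] by auto
  define w where "w = x - y"
  have fw: "f w \<noteq> 0" using x y by (simp add: w_def f.diff)
  then have w0: "w \<noteq> 0" using f.zero by auto
  have "f v = inner ((f w / (norm w)\<^sup>2) *\<^sub>R w) v" for v
  proof -
    have "f (v - (f v / f w) *\<^sub>R w) = 0" using fw by (simp add: f.diff f.scaleR)
    then have "inner w (v - (f v / f w) *\<^sub>R w) = 0" using y(2) w_def by blast
    then have "inner w v = f v / f w * (norm w)\<^sup>2" by (simp add: inner_diff_right power2_norm_eq_inner)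
    then show ?thesis using w0 fw by simp
  qed
  then show ?thesis by blast
qed


section \<open>Bounded operators and adjoints\<close>

lemma scale_op_apply [simp]: "blinfun_apply (c *\<^sub>O a) x = c *\<^sub>C blinfun_apply a x"
  by (simp add: scale_op.rep_eq)

notation blinfun_compose (infixl "\<odot>" 70)

lemma comp_assoc: "(a \<odot> b) \<odot> c = a \<odot> (b \<odot> c)"
  by (rule blinfun_eqI) simp

lemma comp_distribs:
  fixes a b c :: "'h::real_normed_vector \<Rightarrow>\<^sub>L 'h"
  shows "a \<odot> (b + c) = a \<odot> b + a \<odot> c" "(a + b) \<odot> c = a \<odot> c + b \<odot> c"
    "a \<odot> (b - c) = a \<odot> b - a \<odot> c" "(a - b) \<odot> c = a \<odot> c - b \<odot> c"
    "(- a) \<odot> b = - (a \<odot> b)" "a \<odot> (- b) = - (a \<odot> b)"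
    "(r *\<^sub>R a) \<odot> b = r *\<^sub>R (a \<odot> b)" "a \<odot> (r *\<^sub>R b) = r *\<^sub>R (a \<odot> b)"
    "id_blinfun \<odot> a = a" "a \<odot> id_blinfun = a" "0 \<odot> a = 0" "a \<odot> 0 = 0"
  by (auto intro!: blinfun_eqI simp: blinfun.bilinear_simps)

named_theorems opsimps "rewrite rules for sums and products of bounded operators"

lemmas [opsimps] = comp_assoc comp_distribs

lemma scale_op_comp [opsimps]:
  "(c *\<^sub>O a) \<odot> b = c *\<^sub>O (a \<odot> (b::'h::chilbert_space operator))"
  by (rule blinfun_eqI) simp

lemma scale_op_scaleR: "complex_of_real r *\<^sub>O a = r *\<^sub>R (a::'h::chilbert_space operator)"
  by (rule blinfun_eqI) (simp add: scaleR_scaleC blinfun.scaleR_left)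

lemma scale_op_one [simp]: "1 *\<^sub>O a = (a::'h::chilbert_space operator)"
  by (rule blinfun_eqI) simp

lemma scale_op_scale_op: "c *\<^sub>O d *\<^sub>O a = (c * d) *\<^sub>O (a::'h::chilbert_space operator)"
  by (rule blinfun_eqI) (simp add: scaleC_scaleC)

lemma scaleC_minus_left: "(- c) *\<^sub>C x = - (c *\<^sub>C (x::'h::chilbert_space))"
  by (metis scaleC_minus_right scaleC_scaleC scaleR_scaleC scaleR_minus1_left mult_minus1 mult.commute of_real_1 of_real_minus)

lemma scale_op_linear:
  fixes a b :: "'h::chilbert_space operator"
  shows "c *\<^sub>O (a + b) = c *\<^sub>O a + c *\<^sub>O b" "c *\<^sub>O (a - b) = c *\<^sub>O a - c *\<^sub>O b"
    "c *\<^sub>O (- a) = - (c *\<^sub>O a)" "(- c) *\<^sub>O a = - (c *\<^sub>O a)"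
  by (auto intro!: blinfun_eqI simp: blinfun.bilinear_simps scaleC_add_right scaleC_diff_right
      scaleC_minus_right scaleC_minus_left)

lemma norm_comp_le: "norm a \<le> r \<Longrightarrow> norm b \<le> s \<Longrightarrow> norm (a \<odot> b) \<le> r * s"
  by (meson norm_blinfun_compose mult_mono norm_ge_zero order_trans)

lemma bounded_opsD: "a \<in> bounded_ops \<Longrightarrow> blinfun_apply a (c *\<^sub>C x) = c *\<^sub>C blinfun_apply a x"
  by (simp add: bounded_ops_def)

lemma bounded_ops_comp [simp]: "a \<in> bounded_ops \<Longrightarrow> b \<in> bounded_ops \<Longrightarrow> a \<odot> b \<in> bounded_ops"
  and bounded_ops_add [simp]: "a \<in> bounded_ops \<Longrightarrow> b \<in> bounded_ops \<Longrightarrow> a + b \<in> bounded_ops"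
  and bounded_ops_diff [simp]: "a \<in> bounded_ops \<Longrightarrow> b \<in> bounded_ops \<Longrightarrow> a - b \<in> bounded_ops"
  and bounded_ops_uminus [simp]: "a \<in> bounded_ops \<Longrightarrow> - a \<in> bounded_ops"
  and bounded_ops_scaleR [simp]: "a \<in> bounded_ops \<Longrightarrow> r *\<^sub>R a \<in> bounded_ops"
  and bounded_ops_scale [simp]: "a \<in> bounded_ops \<Longrightarrow> c *\<^sub>O a \<in> bounded_ops"
  and bounded_ops_id [simp]: "id_blinfun \<in> bounded_ops"
  and bounded_ops_zero [simp]: "0 \<in> bounded_ops"
  by (auto simp: bounded_ops_def blinfun.bilinear_simps scaleC_add_right scaleC_diff_right
      scaleC_minus_right scaleC_scaleR scaleC_scaleC mult.commute)

lemma comp_scale_op [opsimps]: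
  assumes "a \<in> bounded_ops"
  shows "a \<odot> (c *\<^sub>O b) = c *\<^sub>O (a \<odot> (b::'h::chilbert_space operator))"
  by (rule blinfun_eqI) (simp add: bounded_opsD[OF assms])

lemma adj_exists:
  fixes a :: "'h::chilbert_space operator"
  assumes a: "a \<in> bounded_ops"
  shows "\<exists>b\<in>bounded_ops. \<forall>x y. cinner (blinfun_apply b x) y = cinner x (blinfun_apply a y)"
proof -
  have "bounded_linear (\<lambda>y. inner x (a y))" for x
    by (intro bounded_linear_inner_right_comp blinfun.bounded_linear_right)
  then have "\<exists>z. \<forall>y. inner x (a y) = inner z y" for x by (rule riesz)
  then obtain B where B: "\<And>x y. inner x (a y) = inner (B x) y" by metis
  have B': "inner y (B x) = inner (a y) x" for x y by (metis B inner_commute)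
  have lin: "bounded_linear B"
  proof (rule bounded_linear_intro)
    fix x y show "B (x + y) = B x + B y"
      by (rule vec_eqI) (simp add: B' inner_add_right)
  next
    fix r x show "B (r *\<^sub>R x) = r *\<^sub>R B x" by (rule vec_eqI) (simp add: B')
  next
    fix x
    have "norm (B x) * norm (B x) = inner x (a (B x))" by (simp add: B flip: power2_norm_eq_inner power2_eq_square)
    also have "\<dots> \<le> norm x * norm (a (B x))" by (rule norm_cauchy_schwarz)
    also have "\<dots> \<le> norm x * (norm a * norm (B x))" by (intro mult_left_mono norm_blinfun) simp
    finally have "norm (B x) * norm (B x) \<le> (norm x * norm a) * norm (B x)" by (simp add: mult.assoc)
    then show "norm (B x) \<le> norm x * norm a"
      by (metis mult_le_cancel_right mult_nonneg_nonneg norm_ge_zero not_le order_le_less)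
  qed
  define b where "b = Blinfun B"
  have b: "blinfun_apply b x = B x" for x using lin by (simp add: b_def bounded_linear_Blinfun_apply)
  have Bc: "B (c *\<^sub>C x) = c *\<^sub>C B x" for c x
  proof (rule vec_eqI)
    fix z
    have "inner z (B (c *\<^sub>C x)) = inner (cnj c *\<^sub>C a z) x"
      by (simp add: B' inner_scaleC_left)
    also have "\<dots> = inner (a (cnj c *\<^sub>C z)) x" by (simp add: bounded_opsD[OF a])
    also have "\<dots> = inner (cnj c *\<^sub>C z) (B x)" by (simp add: B')
    also have "\<dots> = inner z (c *\<^sub>C B x)" by (simp add: inner_scaleC_left)
    finally show "inner z (B (c *\<^sub>C x)) = inner z (c *\<^sub>C B x)" .
  qed
  have "b \<in> bounded_ops" by (simp add: bounded_ops_def b Bc)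
  moreover have "cinner (blinfun_apply b x) y = cinner x (blinfun_apply a y)" for x y
    by (simp add: cinner_eq_inner b flip: Bc B)
  ultimately show ?thesis by blast
qed

lemma adj_unique_aux:
  fixes b b' :: "'h::chilbert_space operator"
  assumes "\<And>x y. inner (blinfun_apply b x) y = inner (blinfun_apply b' x) y"
  shows "b = b'"
  by (rule blinfun_eqI, rule vec_eqI) (metis assms inner_commute)

lemma adj_properties:
  assumes a: "a \<in> bounded_ops"
  shows "a\<^sup>\<star> \<in> bounded_ops \<and> (\<forall>x y. cinner (blinfun_apply (a\<^sup>\<star>) x) y = cinner x (blinfun_apply a y))"
proof -
  obtain b where b: "b \<in> bounded_ops" "\<forall>x y. cinner (blinfun_apply b x) y = cinner x (blinfun_apply a y)"
    using adj_exists[OF a] by blast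
  have "a\<^sup>\<star> = b" unfolding adj_def
  proof (rule the_equality)
    fix b' :: "'a operator"
    assume "\<forall>x y. cinner (blinfun_apply b' x) y = cinner x (blinfun_apply a y)"
    then show "b' = b" using b(2) by (intro adj_unique_aux) (simp add: inner_eq_Re_cinner)
  qed (rule b(2))
  then show ?thesis using b by simp
qed

lemma adj_bounded_ops [simp]: "a \<in> bounded_ops \<Longrightarrow> a\<^sup>\<star> \<in> bounded_ops"
  using adj_properties by blast

lemma adj_cinner: "a \<in> bounded_ops \<Longrightarrow> cinner (blinfun_apply (a\<^sup>\<star>) x) y = cinner x (blinfun_apply a y)"
  using adj_properties by blast

lemma adj_inner: "a \<in> bounded_ops \<Longrightarrow> inner (blinfun_apply (a\<^sup>\<star>) x) y = inner x (blinfun_apply a y)"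
  by (simp add: inner_eq_Re_cinner adj_cinner)

lemma adj_inner': "a \<in> bounded_ops \<Longrightarrow> inner x (blinfun_apply (a\<^sup>\<star>) y) = inner (blinfun_apply a x) y"
  by (metis adj_inner inner_commute)

lemma adj_eqI:
  fixes b :: "'h::chilbert_space operator"
  assumes "a \<in> bounded_ops" "\<And>x y. inner (blinfun_apply b x) y = inner x (blinfun_apply a y)"
  shows "a\<^sup>\<star> = b"
  by (rule adj_unique_aux) (simp add: assms adj_inner)

lemma adj_adj [simp]: "a \<in> bounded_ops \<Longrightarrow> (a\<^sup>\<star>)\<^sup>\<star> = a"
  by (rule adj_eqI) (simp_all add: adj_inner')

lemma adj_comp [simp]: "a \<in> bounded_ops \<Longrightarrow> b \<in> bounded_ops \<Longrightarrow> (a \<odot> b)\<^sup>\<star> = b\<^sup>\<star> \<odot> a\<^sup>\<star>"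
  and adj_add [simp]: "a \<in> bounded_ops \<Longrightarrow> b \<in> bounded_ops \<Longrightarrow> (a + b)\<^sup>\<star> = a\<^sup>\<star> + b\<^sup>\<star>"
  and adj_diff [simp]: "a \<in> bounded_ops \<Longrightarrow> b \<in> bounded_ops \<Longrightarrow> (a - b)\<^sup>\<star> = a\<^sup>\<star> - b\<^sup>\<star>"
  and adj_uminus [simp]: "a \<in> bounded_ops \<Longrightarrow> (- a)\<^sup>\<star> = - a\<^sup>\<star>"
  and adj_scaleR [simp]: "a \<in> bounded_ops \<Longrightarrow> (r *\<^sub>R a)\<^sup>\<star> = r *\<^sub>R a\<^sup>\<star>"
  and adj_scale [simp]: "a \<in> bounded_ops \<Longrightarrow> (c *\<^sub>O a)\<^sup>\<star> = cnj c *\<^sub>O a\<^sup>\<star>"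
  and adj_id [simp]: "id_blinfun\<^sup>\<star> = id_blinfun"
  and adj_zero [simp]: "0\<^sup>\<star> = 0"
  by (rule adj_eqI; simp add: adj_inner inner_scaleC_left blinfun.bilinear_simps inner_add_left
      inner_add_right inner_diff_left inner_diff_right bounded_opsD)+

lemma norm_adj_le: assumes "a \<in> bounded_ops" shows "norm (a\<^sup>\<star>) \<le> norm a"
proof (rule norm_blinfun_bound)
  fix x
  have "norm ((a\<^sup>\<star>) x) * norm ((a\<^sup>\<star>) x) = inner x (a ((a\<^sup>\<star>) x))"
    by (simp add: adj_inner[OF assms, symmetric] flip: power2_norm_eq_inner power2_eq_square)
  also have "\<dots> \<le> norm x * norm (a ((a\<^sup>\<star>) x))" by (rule norm_cauchy_schwarz)
  also have "\<dots> \<le> norm x * (norm a * norm ((a\<^sup>\<star>) x))" by (intro mult_left_mono norm_blinfun) simp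
  finally have "norm ((a\<^sup>\<star>) x) * norm ((a\<^sup>\<star>) x) \<le> (norm a * norm x) * norm ((a\<^sup>\<star>) x)" by (simp add: ac_simps)
  then show "norm ((a\<^sup>\<star>) x) \<le> norm a * norm x"
    by (metis mult_le_cancel_right mult_nonneg_nonneg norm_ge_zero not_le order_le_less)
qed simp

lemma norm_adj [simp]: "a \<in> bounded_ops \<Longrightarrow> norm (a\<^sup>\<star>) = norm a"
  by (metis adj_adj adj_bounded_ops norm_adj_le order_antisym)


section \<open>Positive operators\<close>

text \<open>Membership in \<open>B(H)\<close> is included. Over the complex numbers positivity implies
  self-adjointness; the characterization by the real inner product needs it as a separate
  condition.\<close>

definition positive :: "'h::chilbert_space operator \<Rightarrow> bool" where
  "positive a \<longleftrightarrow> a \<in> bounded_ops \<and> pos_op a"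

lemma positive_iff:
  "positive a \<longleftrightarrow> a \<in> bounded_ops \<and> a\<^sup>\<star> = a \<and> (\<forall>x. 0 \<le> inner x (blinfun_apply a x))"
proof (intro iffI conjI allI)
  assume p: "positive a"
  then show a: "a \<in> bounded_ops" by (simp add: positive_def)
  have nn: "cinner x (a x) \<in> \<real>\<^sub>\<ge>\<^sub>0" for x using p by (simp add: positive_def pos_op_def)
  then show "0 \<le> inner x (a x)" for x
    by (metis inner_eq_Re_cinner complex_nonneg_Reals_iff)
  have im: "inner (\<i> *\<^sub>C x) (a x) = 0" for x
    using nn[of x] by (simp add: complex_nonneg_Reals_iff cinner_eq_inner)
  have pol: "inner (\<i> *\<^sub>C x) (a y) + inner (\<i> *\<^sub>C y) (a x) = 0" for x y
    using im[of "x + y"] im[of x] im[of y]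
    by (simp add: scaleC_add_right blinfun.bilinear_simps inner_add_left inner_add_right)
  show "a\<^sup>\<star> = a"
  proof (rule adj_eqI[OF a])
    fix w y
    have "inner (\<i> *\<^sub>C \<i> *\<^sub>C w) (a y) + inner (\<i> *\<^sub>C y) (\<i> *\<^sub>C a w) = 0"
      using pol[of "\<i> *\<^sub>C w" y] by (simp add: bounded_opsD[OF a])
    moreover have "\<i> *\<^sub>C \<i> *\<^sub>C w = - w"
      using scaleR_scaleC[of "-1" w] by (simp add: scaleC_scaleC)
    moreover have "inner (\<i> *\<^sub>C y) (\<i> *\<^sub>C a w) = inner y (a w)"
      by (simp add: inner_scaleC_left scaleC_scaleC)
    ultimately show "inner (a w) y = inner w (a y)" by (simp add: inner_commute)
  qed
next
  assume *: "a \<in> bounded_ops \<and> a\<^sup>\<star> = a \<and> (\<forall>x. 0 \<le> inner x (a x))"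
  then have a: "a \<in> bounded_ops" by blast
  have "Im (cinner x (a x)) = 0" for x
  proof -
    have "cinner x (a x) = cnj (cinner x (a x))" using * adj_cinner[OF a, of x x] cinner_commute by metis
    then have "Im (cinner x (a x)) = Im (cnj (cinner x (a x)))" by simp
    then show ?thesis by simp
  qed
  then show "positive a" using * by (simp add: positive_def pos_op_def complex_nonneg_Reals_iff inner_eq_Re_cinner)
qed

lemma positiveD:
  assumes "positive a"
  shows "a \<in> bounded_ops" "a\<^sup>\<star> = a" "0 \<le> inner x (blinfun_apply a x)" "inner (blinfun_apply a x) y = inner x (blinfun_apply a y)"
  using assms adj_inner[of a x y] by (auto simp: positive_iff)

lemma op_le_iff: "a \<in> bounded_ops \<Longrightarrow> b \<in> bounded_ops \<Longrightarrow> op_le a b \<longleftrightarrow> positive (b - a)"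
  by (simp add: op_le_def positive_def)

lemma positive_add: "positive a \<Longrightarrow> positive b \<Longrightarrow> positive (a + b)"
  by (auto simp: positive_iff blinfun.bilinear_simps inner_add_right)

lemma positive_scaleR: "positive a \<Longrightarrow> 0 \<le> r \<Longrightarrow> positive (r *\<^sub>R a)"
  by (auto simp: positive_iff blinfun.bilinear_simps)

lemma positive_zero [simp]: "positive 0" and positive_id [simp]: "positive id_blinfun"
  by (auto simp: positive_iff)

lemma positive_sandwich:
  assumes "positive a" "b \<in> bounded_ops" shows "positive (b\<^sup>\<star> \<odot> a \<odot> b)"
  using assms by (auto simp: positive_iff adj_inner' opsimps)

lemma positive_adj_comp: "b \<in> bounded_ops \<Longrightarrow> positive (b\<^sup>\<star> \<odot> b)"
  using positive_sandwich[OF positive_id] by (simp add: opsimps)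

lemma positive_cauchy_schwarz:
  assumes a: "positive a"
  shows "(inner x (blinfun_apply a y))\<^sup>2 \<le> inner x (blinfun_apply a x) * inner y (blinfun_apply a y)"
proof -
  let ?p = "inner x (a x)" and ?q = "inner x (a y)" and ?r = "inner y (a y)"
  have *: "0 \<le> ?p + 2 * t * ?q + t\<^sup>2 * ?r" for t
  proof -
    have "0 \<le> inner (x + t *\<^sub>R y) (a (x + t *\<^sub>R y))" using positiveD[OF a] by blast
    also have "inner y (a x) = ?q" using positiveD(4)[OF a, of y x] by (simp add: inner_commute)
    then have "inner (x + t *\<^sub>R y) (a (x + t *\<^sub>R y)) = ?p + 2 * t * ?q + t\<^sup>2 * ?r"
      by (simp add: blinfun.bilinear_simps inner_add_left inner_add_right power2_eq_square algebra_simps)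
    finally show ?thesis .
  qed
  have r0: "0 \<le> ?r" using positiveD[OF a] by blast
  show ?thesis
  proof (cases "?r = 0")
    case True
    have p0: "0 \<le> ?p" using positiveD[OF a] by blast
    have "?q = 0"
    proof (rule ccontr)
      assume "?q \<noteq> 0"
      then have "2 * (- (?p + 1) / (2 * ?q)) * ?q = - (?p + 1)" by (simp add: field_simps)
      then show False using *[of "- (?p + 1) / (2 * ?q)"] True by simp
    qed
    then show ?thesis using True by simp
  next
    case False
    then have "0 \<le> ?p - ?q\<^sup>2 / ?r" using *[of "- ?q / ?r"] by (simp add: power2_eq_square field_simps)
    then show ?thesis using False r0 by (simp add: field_simps)
  qed
qed

text \<open>For a positive operator with upper bound \<open>C\<close>, the Cauchy-Schwarz inequality for its form gives
  \<open>a\<^sup>2 \<le> C a\<close>.\<close>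

lemma positive_norm_sq:
  assumes a: "positive a" and C: "\<And>x. inner x (blinfun_apply a x) \<le> C * (norm x)\<^sup>2"
  shows "(norm (blinfun_apply a x))\<^sup>2 \<le> C * inner x (blinfun_apply a x)"
proof -
  let ?n = "(norm (a x))\<^sup>2"
  have "?n\<^sup>2 = (inner x (a (a x)))\<^sup>2" using positiveD(4)[OF a, of x "a x"] by (simp add: power2_norm_eq_inner)
  also have "\<dots> \<le> inner x (a x) * inner (a x) (a (a x))" by (rule positive_cauchy_schwarz[OF a])
  also have "\<dots> \<le> inner x (a x) * (C * ?n)" by (intro mult_left_mono C positiveD[OF a])
  finally have "?n * ?n \<le> (C * inner x (a x)) * ?n" by (simp add: power2_eq_square ac_simps)
  moreover have "?n = 0 \<Longrightarrow> 0 \<le> C * inner x (a x)" by (simp add: blinfun.bilinear_simps)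
  ultimately show ?thesis
    by (metis mult_right_le_imp_le order_le_less zero_le_power2)
qed

lemma positive_norm_le:
  assumes a: "positive a" and C: "\<And>x. inner x (blinfun_apply a x) \<le> C * (norm x)\<^sup>2" "0 \<le> C"
  shows "norm a \<le> C"
proof (rule norm_blinfun_bound[OF C(2)])
  fix x
  have "(norm (a x))\<^sup>2 \<le> C * (C * (norm x)\<^sup>2)"
    using positive_norm_sq[OF a C(1), of x] C mult_left_mono[OF C(1), of C x] by linarith
  also have "\<dots> = (C * norm x)\<^sup>2" by (simp add: power2_eq_square)
  finally show "norm (a x) \<le> C * norm x" by (rule power2_le_imp_le) (use C(2) in simp)
qed

lemma inner_le_norm:
  fixes a :: "'h::real_inner \<Rightarrow>\<^sub>L 'h"
  shows "inner x (blinfun_apply a x) \<le> norm a * (norm x)\<^sup>2"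
proof -
  have "inner x (a x) \<le> norm x * norm (a x)" by (rule norm_cauchy_schwarz)
  also have "\<dots> \<le> norm x * (norm a * norm x)" by (intro mult_left_mono norm_blinfun) simp
  finally show ?thesis by (simp add: power2_eq_square ac_simps)
qed

lemma positive_norm_minus:
  assumes "a \<in> bounded_ops" "a\<^sup>\<star> = a" "norm a \<le> r"
  shows "positive (r *\<^sub>R id_blinfun - a)"
  unfolding positive_iff
proof (intro conjI allI)
  fix x :: 'a
  have "norm a * (norm x)\<^sup>2 \<le> r * (norm x)\<^sup>2" using assms(3) by (intro mult_right_mono) auto
  then show "0 \<le> inner x (blinfun_apply (r *\<^sub>R id_blinfun - a) x)"
    using inner_le_norm[of x a] assms(3) 
    by (simp add: blinfun.bilinear_simps inner_diff_right flip: power2_norm_eq_inner)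
qed (use assms in auto)

lemma positive_le_id_norm:
  assumes "positive a" "positive (id_blinfun - a)" shows "norm a \<le> 1"
proof (rule positive_norm_le[OF assms(1)])
  fix x show "inner x (a x) \<le> 1 * (norm x)\<^sup>2"
    using positiveD(3)[OF assms(2), of x]
    by (simp add: blinfun.bilinear_simps inner_diff_right power2_norm_eq_inner)
qed simp


section \<open>Strong limits\<close>

lemma pointwise_limit:
  fixes a :: "nat \<Rightarrow> 'h::{real_normed_vector} \<Rightarrow>\<^sub>L 'h"
  assumes C: "\<And>n. norm (a n) \<le> C" and conv: "\<And>x. convergent (\<lambda>n. blinfun_apply (a n) x)"
  shows "\<exists>b. (\<forall>x. (\<lambda>n. blinfun_apply (a n) x) \<longlonglongrightarrow> blinfun_apply b x) \<and> norm b \<le> C"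
proof -
  define B where "B x = lim (\<lambda>n. a n x)" for x
  have B: "(\<lambda>n. a n x) \<longlonglongrightarrow> B x" for x using conv[of x] by (simp add: B_def convergent_LIMSEQ_iff)
  have C0: "0 \<le> C" using C[of 0] norm_ge_zero order_trans by blast
  have Bn: "norm (B x) \<le> C * norm x" for x
  proof (rule LIMSEQ_le_const2[OF tendsto_norm[OF B]])
    show "\<exists>N. \<forall>n\<ge>N. norm (a n x) \<le> C * norm x"
      by (meson C norm_blinfun mult_right_mono norm_ge_zero order_trans)
  qed
  have "bounded_linear B"
  proof (rule bounded_linear_intro)
    fix x y
    have "(\<lambda>n. a n (x + y)) \<longlonglongrightarrow> B x + B y" using tendsto_add[OF B[of x] B[of y]] by (simp add: blinfun.bilinear_simps)
    then show "B (x + y) = B x + B y" using B LIMSEQ_unique by blast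
  next
    fix r x
    have "(\<lambda>n. a n (r *\<^sub>R x)) \<longlonglongrightarrow> r *\<^sub>R B x" using tendsto_scaleR[OF tendsto_const B[of x]] by (simp add: blinfun.bilinear_simps)
    then show "B (r *\<^sub>R x) = r *\<^sub>R B x" using B LIMSEQ_unique by blast
  qed (use Bn in \<open>simp add: mult.commute\<close>)
  then have "blinfun_apply (Blinfun B) = B" by (rule bounded_linear_Blinfun_apply)
  then show ?thesis using B Bn C0 by (intro exI[of _ "Blinfun B"]) (auto intro: norm_blinfun_bound)
qed

lemma strong_limit_bounded_ops:
  assumes "\<And>n. a n \<in> bounded_ops" "\<And>x. (\<lambda>n. blinfun_apply (a n) x) \<longlonglongrightarrow> blinfun_apply b x"
  shows "b \<in> bounded_ops"
proof -
  have "blinfun_apply b (c *\<^sub>C x) = c *\<^sub>C blinfun_apply b x" for c x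
  proof (rule LIMSEQ_unique[OF assms(2)])
    show "(\<lambda>n. a n (c *\<^sub>C x)) \<longlonglongrightarrow> c *\<^sub>C b x"
      using bounded_linear.tendsto[OF bounded_linear_scaleC assms(2)] by (simp add: bounded_opsD[OF assms(1)])
  qed
  then show ?thesis by (simp add: bounded_ops_def)
qed

lemma strong_limit_commutant:
  assumes "\<And>n. a n \<in> commutant S" "\<And>x. (\<lambda>n. blinfun_apply (a n) x) \<longlonglongrightarrow> blinfun_apply b x"
  shows "b \<in> commutant S"
proof -
  have "b \<in> bounded_ops" by (rule strong_limit_bounded_ops[OF _ assms(2)]) (use assms(1) in \<open>simp add: commutant_def\<close>)
  moreover have "s \<odot> b = b \<odot> s" if s: "s \<in> S" for s
  proof (rule blinfun_eqI)
    fix x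
    have "(\<lambda>n. s (a n x)) \<longlonglongrightarrow> s (b x)" by (intro tendsto_intros assms)
    moreover have "s (a n x) = a n (s x)" for n
      using assms(1)[of n] s by (auto simp: commutant_def simp flip: blinfun_apply_blinfun_compose)
    ultimately show "(s \<odot> b) x = (b \<odot> s) x" using LIMSEQ_unique[OF assms(2)[of "s x"]] by simp
  qed
  ultimately show ?thesis by (simp add: commutant_def)
qed

lemma strong_limit_positive:
  assumes "\<And>n. positive (a n)" "\<And>x. (\<lambda>n. blinfun_apply (a n) x) \<longlonglongrightarrow> blinfun_apply b x"
  shows "positive b"
  unfolding positive_iff
proof (intro conjI allI)
  show b: "b \<in> bounded_ops" by (rule strong_limit_bounded_ops[OF _ assms(2)]) (rule positiveD[OF assms(1)])
  show "b\<^sup>\<star> = b"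
  proof (rule adj_eqI[OF b])
    fix x y
    have "(\<lambda>n. inner (a n x) y) \<longlonglongrightarrow> inner (b x) y" "(\<lambda>n. inner x (a n y)) \<longlonglongrightarrow> inner x (b y)"
      by (intro tendsto_intros assms)+
    then show "inner (b x) y = inner x (b y)"
      using positiveD(4)[OF assms(1)] LIMSEQ_unique by fastforce
  qed
  fix x
  have "(\<lambda>n. inner x (a n x)) \<longlonglongrightarrow> inner x (b x)" by (intro tendsto_intros assms)
  then show "0 \<le> inner x (b x)" by (rule LIMSEQ_le_const) (use positiveD(3)[OF assms(1)] in blast)
qed

lemma strong_limit_comp:
  fixes a b :: "nat \<Rightarrow> 'h::real_normed_vector \<Rightarrow>\<^sub>L 'h"
  assumes C: "\<And>n. norm (a n) \<le> C"
    and a: "\<And>x. (\<lambda>n. blinfun_apply (a n) x) \<longlonglongrightarrow> blinfun_apply a' x"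
    and b: "(\<lambda>n. blinfun_apply (b n) x) \<longlonglongrightarrow> y"
  shows "(\<lambda>n. blinfun_apply (a n) (blinfun_apply (b n) x)) \<longlonglongrightarrow> blinfun_apply a' y"
proof -
  have "(\<lambda>n. norm (a n (b n x - y))) \<longlonglongrightarrow> 0"
  proof (rule tendsto_sandwich[of "\<lambda>_. 0"])
    have "(\<lambda>n. C * norm (b n x - y)) \<longlonglongrightarrow> C * norm (y - y)" by (intro tendsto_intros b)
    then show "(\<lambda>n. C * norm (b n x - y)) \<longlonglongrightarrow> 0" by simp
    show "\<forall>\<^sub>F n in sequentially. norm (a n (b n x - y)) \<le> C * norm (b n x - y)"
      by (intro always_eventually allI) (meson C norm_blinfun mult_right_mono norm_ge_zero order_trans)
  qed auto
  then have "(\<lambda>n. a n (b n x - y) + a n y) \<longlonglongrightarrow> 0 + a' y"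
    by (intro tendsto_add a) (simp add: tendsto_norm_zero_iff)
  then show ?thesis by (simp add: blinfun.bilinear_simps)
qed

text \<open>Bounded increasing sequences of positive operators converge strongly. Membership in a commutant
  is carried along, since every von Neumann algebra is one.\<close>

lemma monotone_convergence:
  assumes S: "\<And>n. a n \<in> commutant S" and pos: "\<And>n. positive (a n)"
    and mono: "\<And>n. positive (a (Suc n) - a n)"
    and C: "\<And>n. norm (a n) \<le> C"
  shows "\<exists>b\<in>commutant S. positive b \<and> norm b \<le> C \<and> (\<forall>n. positive (b - a n)) \<and>
    (\<forall>x. (\<lambda>n. blinfun_apply (a n) x) \<longlonglongrightarrow> blinfun_apply b x)"
proof -
  have mono': "positive (a n - a m)" if "m \<le> n" for m n
    using that
  proof (induction n rule: dec_induct)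
    case (step n)
    then show ?case using positive_add[OF mono[of n] step.IH] by (simp add: algebra_simps)
  qed simp
  have C0: "0 \<le> C" using C[of 0] norm_ge_zero order_trans by blast
  have up: "inner x (a n x) \<le> C * (norm x)\<^sup>2" for n x
    using inner_le_norm[of x "a n"] mult_right_mono[OF C[of n], of "(norm x)\<^sup>2"] by fastforce
  have conv: "convergent (\<lambda>n. a n x)" for x
  proof -
    let ?q = "\<lambda>n. inner x (a n x)"
    have inc: "(norm (a n x - a m x))\<^sup>2 \<le> C * (?q n - ?q m)" if "m \<le> n" for m n
    proof -
      have "(norm ((a n - a m) x))\<^sup>2 \<le> C * inner x ((a n - a m) x)"
      proof (rule positive_norm_sq[OF mono'[OF that]])
        fix y show "inner y ((a n - a m) y) \<le> C * (norm y)\<^sup>2"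
          using up[of y n] positiveD(3)[OF pos[of m], of y] by (simp add: blinfun.bilinear_simps inner_diff_right)
      qed
      then show ?thesis by (simp add: blinfun.bilinear_simps inner_diff_right)
    qed
    have "incseq ?q"
    proof (rule incseq_SucI)
      fix n show "?q n \<le> ?q (Suc n)"
        using positiveD(3)[OF mono[of n], of x] by (simp add: blinfun.bilinear_simps inner_diff_right)
    qed
    then obtain L where L: "?q \<longlonglongrightarrow> L"
      using incseq_convergent[of ?q "C * (norm x)\<^sup>2"] up by blast
    then have cq: "Cauchy ?q" by (rule LIMSEQ_imp_Cauchy)
    have "Cauchy (\<lambda>n. a n x)"
    proof (rule CauchyI')
      fix e :: real assume e: "0 < e"
      obtain N where N: "\<And>m n. m \<ge> N \<Longrightarrow> n \<ge> N \<Longrightarrow> \<bar>?q m - ?q n\<bar> < e\<^sup>2 / (C + 1)"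
        using cq[unfolded Cauchy_iff, rule_format, of "e\<^sup>2 / (C + 1)"] e C0 by auto
      have "norm (a m x - a n x) < e" if mn: "N \<le> m" "m < n" for m n
      proof -
        have "(norm (a m x - a n x))\<^sup>2 \<le> C * (?q n - ?q m)" using inc[of m n] mn by (simp add: norm_minus_commute)
        also have "\<dots> \<le> C * (e\<^sup>2 / (C + 1))" using N[of n m] mn C0 by (intro mult_left_mono) auto
        also have "\<dots> < e\<^sup>2" using e C0 by (simp add: field_simps)
        finally show ?thesis using e by (simp add: power_less_imp_less_base)
      qed
      then show "\<exists>M. \<forall>m\<ge>M. \<forall>n>m. dist (a m x) (a n x) < e" unfolding dist_norm by blast
    qed
    then show ?thesis by (rule Cauchy_convergent)
  qed
  obtain b where b: "\<And>x. (\<lambda>n. a n x) \<longlonglongrightarrow> blinfun_apply b x" "norm b \<le> C" using pointwise_limit[OF C conv] by blast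
  have "positive (b - a n)" for n
  proof (rule strong_limit_positive[where a = "\<lambda>k. a (k + n) - a n"])
    show "positive (a (k + n) - a n)" for k by (rule mono') simp
    show "(\<lambda>k. (a (k + n) - a n) x) \<longlonglongrightarrow> (b - a n) x" for x
      using tendsto_diff[OF LIMSEQ_ignore_initial_segment[OF b(1)] tendsto_const] by (simp add: blinfun.bilinear_simps)
  qed
  moreover have "b \<in> commutant S" using strong_limit_commutant[OF S b(1)] .
  moreover have "positive b" using strong_limit_positive[OF pos b(1)] .
  ultimately show ?thesis using b by blast
qed


section \<open>Square roots and inverses\<close>

text \<open>The operators obtained from \<open>c\<close> by polynomials with nonnegative coefficients. For
  positive \<open>c\<close> they are positive, which makes iterations inside this cone monotone.\<close>

inductive_set cone :: "'h::chilbert_space operator \<Rightarrow> 'h operator set" for c where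
  cone_zero: "0 \<in> cone c"
| cone_id: "id_blinfun \<in> cone c"
| cone_step: "x \<in> cone c \<Longrightarrow> c \<odot> x \<in> cone c"
| cone_add: "x \<in> cone c \<Longrightarrow> y \<in> cone c \<Longrightarrow> x + y \<in> cone c"
| cone_scale: "x \<in> cone c \<Longrightarrow> 0 \<le> r \<Longrightarrow> r *\<^sub>R x \<in> cone c"

lemma cone_commutes: "x \<in> cone c \<Longrightarrow> b \<odot> c = c \<odot> b \<Longrightarrow> b \<odot> x = x \<odot> b"
proof (induction rule: cone.induct)
  case (cone_step x)
  then show ?case by (metis comp_assoc)
qed (auto simp: opsimps)

lemma cone_comp: "x \<in> cone c \<Longrightarrow> y \<in> cone c \<Longrightarrow> x \<odot> y \<in> cone c"
  by (induction rule: cone.induct) (auto simp: opsimps intro: cone.intros)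

lemma cone_positive:
  assumes c: "positive c" and x: "x \<in> cone c" shows "positive x"
proof -
  have "positive x \<and> positive (c \<odot> x)" using x
  proof (induction rule: cone.induct)
    case (cone_step x)
    have "c \<odot> (c \<odot> x) = c\<^sup>\<star> \<odot> x \<odot> c"
      using cone_commutes[OF cone_step.hyps, of c] positiveD(2)[OF c] by (metis comp_assoc)
    then show ?case using cone_step positive_sandwich[of x c] positiveD(1)[OF c] by simp
  next
    case (cone_add x y) then show ?case by (simp add: opsimps positive_add)
  next
    case (cone_scale x r) then show ?case by (simp add: opsimps positive_scaleR)
  qed (use c in \<open>auto simp: opsimps\<close>)
  then show ?thesis by blast
qed

lemma bicommutant_commutes:
  "x \<in> commutant (commutant {c}) \<Longrightarrow> b \<in> bounded_ops \<Longrightarrow> b \<odot> c = c \<odot> b \<Longrightarrow> b \<odot> x = x \<odot> b"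
  by (auto simp: commutant_def)

lemma bicommutantI:
  "x \<in> bounded_ops \<Longrightarrow> (\<And>b. b \<in> bounded_ops \<Longrightarrow> b \<odot> c = c \<odot> b \<Longrightarrow> b \<odot> x = x \<odot> b) \<Longrightarrow>
    x \<in> commutant (commutant {c})"
  by (auto simp: commutant_def)

text \<open>The square root of \<open>1 - c\<close> is \<open>1 - y\<close>, where \<open>y\<close> is the increasing limit of the
  iteration \<open>y \<mapsto> (c + y\<^sup>2) / 2\<close>.\<close>

lemma positive_sqrt:
  fixes k :: "'h::chilbert_space operator"
  assumes k: "positive k"
  shows "\<exists>h\<in>commutant (commutant {k}). positive h \<and> h \<odot> h = k"
proof -
  define K where "K = norm k + 1"
  have K: "0 < K" "norm k \<le> K" by (auto simp: K_def add_nonneg_pos)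
  define c where "c = id_blinfun - (1 / K) *\<^sub>R k"
  have "norm ((1 / K) *\<^sub>R k) \<le> 1" using K by (simp add: field_simps)
  then have c: "positive c"
    using positive_norm_minus[of "(1 / K) *\<^sub>R k" 1] positiveD[OF k] by (simp add: c_def)
  have c1: "norm c \<le> 1"
    using positive_le_id_norm[OF c] positive_scaleR[OF k, of "1/K"] K by (simp add: c_def)
  define y where "y = rec_nat 0 (\<lambda>_ z. (1/2) *\<^sub>R (c + z \<odot> z))"
  have y0: "y 0 = 0" and yS: "y (Suc n) = (1/2) *\<^sub>R (c + y n \<odot> y n)" for n
    by (simp_all add: y_def)
  have cc: "c \<in> cone c" using cone_step[OF cone_id] by (simp add: opsimps)
  have yc: "y n \<in> cone c" for n
    by (induction n) (auto simp: y0 yS intro!: cone.intros cc cone_comp)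
  have comm: "b \<odot> y n = y n \<odot> b" if "b \<odot> c = c \<odot> b" for b n using cone_commutes[OF yc that] .
  have dc: "y (Suc n) - y n \<in> cone c" for n
  proof (induction n)
    case 0 then show ?case by (simp add: y0 yS opsimps cone_scale cc)
  next
    case (Suc n)
    have "y n \<odot> y (Suc n) = y (Suc n) \<odot> y n"
      by (intro comm) (simp add: comm)
    then have "y (Suc (Suc n)) - y (Suc n) = (1/2) *\<^sub>R ((y (Suc n) - y n) \<odot> (y (Suc n) + y n))"
      by (simp only: yS[of "Suc n"] yS[of n]) (simp add: opsimps algebra_simps flip: yS)
    also have "\<dots> \<in> cone c" by (intro cone_scale cone_comp cone_add Suc yc) simp
    finally show ?case .
  qed
  have yn: "norm (y n) \<le> 1" for n
  proof (induction n)
    case (Suc n)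
    have "norm (c + y n \<odot> y n) \<le> 1 + 1 * 1"
      using c1 norm_comp_le[OF Suc Suc] by (intro norm_triangle_le) linarith
    then show ?case by (simp add: yS)
  qed (simp add: y0)
  have yb: "y n \<in> commutant (commutant {c})" for n
    by (rule bicommutantI) (use positiveD(1)[OF cone_positive[OF c yc]] comm in auto)
  \<comment> \<open>The sequence increases, since \<open>dc\<close> puts its increments into the cone.\<close>
  obtain z where z: "z \<in> commutant (commutant {c})" "positive z" "norm z \<le> 1"
    and lim: "\<And>x. (\<lambda>n. y n x) \<longlonglongrightarrow> blinfun_apply z x"
    using monotone_convergence[of y, OF yb cone_positive[OF c yc] cone_positive[OF c dc] yn] by blast
  have zz: "2 *\<^sub>R z = c + z \<odot> z"
  proof (rule blinfun_eqI)
    fix x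
    have "(\<lambda>n. c x + y n (y n x)) \<longlonglongrightarrow> c x + z (z x)"
      by (intro tendsto_intros strong_limit_comp[where C = 1] yn lim)
    moreover have "(\<lambda>n. c x + y n (y n x)) = (\<lambda>n. 2 *\<^sub>R y (Suc n) x)"
      by (simp add: yS blinfun.bilinear_simps)
    ultimately have "(\<lambda>n. 2 *\<^sub>R y (Suc n) x) \<longlonglongrightarrow> c x + z (z x)" by simp
    moreover have "(\<lambda>n. 2 *\<^sub>R y (Suc n) x) \<longlonglongrightarrow> 2 *\<^sub>R z x" by (rule tendsto_scaleR[OF tendsto_const LIMSEQ_Suc[OF lim]])
    ultimately have "c x + z (z x) = 2 *\<^sub>R z x" by (rule LIMSEQ_unique)
    then show "(2 *\<^sub>R z) x = (c + z \<odot> z) x" by (simp add: blinfun.bilinear_simps)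
  qed
  define h where "h = sqrt K *\<^sub>R (id_blinfun - z)"
  have h: "positive h" unfolding h_def
    using positive_norm_minus[of z 1] positiveD[OF z(2)] z(3) K by (intro positive_scaleR) auto
  have "h \<odot> h = K *\<^sub>R (id_blinfun - 2 *\<^sub>R z + z \<odot> z)"
    using K by (simp add: h_def opsimps algebra_simps scaleR_2)
  also have "\<dots> = k" using K by (simp add: zz c_def algebra_simps)
  finally have hh: "h \<odot> h = k" .
  have "h \<in> commutant (commutant {k})"
  proof (rule bicommutantI)
    fix b :: "'h operator" assume b: "b \<in> bounded_ops" "b \<odot> k = k \<odot> b"
    then have "b \<odot> c = c \<odot> b" by (simp add: c_def opsimps)
    then have "b \<odot> z = z \<odot> b" using bicommutant_commutes[OF z(1) b(1)] by blast
    then show "b \<odot> h = h \<odot> b" by (simp add: h_def opsimps)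
  qed (rule positiveD(1)[OF h])
  then show ?thesis using h hh by blast
qed

text \<open>After scaling, \<open>1 + s\<close> has the form \<open>1 - c\<close>, and the partial sums of its Neumann series form an
  increasing iteration in the cone of \<open>c\<close>.\<close>

lemma positive_inverse:
  fixes s :: "'h::chilbert_space operator"
  assumes s: "positive s"
  shows "\<exists>r\<in>commutant (commutant {s}). positive r \<and> (id_blinfun + s) \<odot> r = id_blinfun \<and>
    r \<odot> (id_blinfun + s) = id_blinfun"
proof -
  define K where "K = 1 + norm s"
  have K: "0 < K" "1 \<le> K" by (auto simp: K_def add_pos_nonneg)
  define c where "c = (1 / K) *\<^sub>R (norm s *\<^sub>R id_blinfun - s)"
  have ps: "positive (norm s *\<^sub>R id_blinfun - s)"
    using positive_norm_minus[of s "norm s"] positiveD[OF s] by simp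
  have c: "positive c" using ps K unfolding c_def by (intro positive_scaleR) auto
  have "norm (norm s *\<^sub>R id_blinfun - s) \<le> norm s"
  proof (rule positive_norm_le[OF ps])
    fix x show "inner x ((norm s *\<^sub>R id_blinfun - s) x) \<le> norm s * (norm x)\<^sup>2"
      using positiveD(3)[OF s, of x] by (simp add: blinfun.bilinear_simps inner_diff_right power2_norm_eq_inner)
  qed simp
  then have cn: "norm c \<le> norm s / K" using K by (simp add: c_def divide_right_mono)
  have Tc: "id_blinfun + s = K *\<^sub>R (id_blinfun - c)"
    using K by (simp add: c_def algebra_simps) (simp add: K_def algebra_simps)
  define y where "y = rec_nat 0 (\<lambda>_ z. id_blinfun + c \<odot> z)"
  have y0: "y 0 = 0" and yS: "y (Suc n) = id_blinfun + c \<odot> y n" for n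
    by (simp_all add: y_def)
  have yc: "y n \<in> cone c" for n by (induction n) (auto simp: y0 yS intro!: cone.intros)
  have dc: "y (Suc n) - y n \<in> cone c" for n
  proof (induction n)
    case 0 then show ?case by (simp add: y0 yS opsimps cone_id)
  next
    case (Suc n)
    have "y (Suc (Suc n)) - y (Suc n) = c \<odot> (y (Suc n) - y n)"
      using yS[of "Suc n"] yS[of n] by (simp add: opsimps algebra_simps)
    then show ?case using Suc by (auto intro: cone.intros)
  qed
  have yn: "norm (y n) \<le> K" for n
  proof (induction n)
    case (Suc n)
    have "norm (c \<odot> y n) \<le> norm s / K * K" by (rule norm_comp_le[OF cn Suc])
    then have "norm (c \<odot> y n) \<le> norm s" using K by simp
    then have "norm (id_blinfun + c \<odot> y n) \<le> 1 + norm s"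
      by (intro norm_triangle_le add_mono norm_blinfun_id_le)
    then show ?case by (simp add: yS K_def)
  qed (use K in \<open>simp add: y0\<close>)
  have yb: "y n \<in> commutant (commutant {c})" for n
    by (rule bicommutantI) (use positiveD(1)[OF cone_positive[OF c yc]] cone_commutes[OF yc] in auto)
  obtain z where z: "z \<in> commutant (commutant {c})" "positive z"
    and lim: "\<And>x. (\<lambda>n. y n x) \<longlonglongrightarrow> blinfun_apply z x"
    using monotone_convergence[of y, OF yb cone_positive[OF c yc] cone_positive[OF c dc] yn] by blast
  have zz: "z = id_blinfun + c \<odot> z"
  proof (rule blinfun_eqI)
    fix x
    have "(\<lambda>n. x + c (y n x)) \<longlonglongrightarrow> x + c (z x)" by (intro tendsto_intros lim)
    moreover have "(\<lambda>n. x + c (y n x)) = (\<lambda>n. y (Suc n) x)" by (simp add: yS blinfun.bilinear_simps)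
    ultimately have "(\<lambda>n. y (Suc n) x) \<longlonglongrightarrow> x + c (z x)" by simp
    then have "z x = x + c (z x)" using LIMSEQ_Suc[OF lim[of x]] by (intro LIMSEQ_unique)
    then show "z x = (id_blinfun + c \<odot> z) x" by (simp add: blinfun.bilinear_simps)
  qed
  have zc: "c \<odot> z = z \<odot> c" using bicommutant_commutes[OF z(1) positiveD(1)[OF c]] by simp
  define r where "r = (1/K) *\<^sub>R z"
  have r: "positive r" unfolding r_def using K z by (intro positive_scaleR) auto
  have one: "(id_blinfun - c) \<odot> z = id_blinfun" using zz by (simp add: opsimps algebra_simps)
  have "(id_blinfun + s) \<odot> r = id_blinfun" "r \<odot> (id_blinfun + s) = id_blinfun"
    using one zc K by (auto simp: Tc r_def opsimps algebra_simps)
  moreover have "r \<in> commutant (commutant {s})"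
  proof (rule bicommutantI)
    fix b :: "'h operator" assume b: "b \<in> bounded_ops" "b \<odot> s = s \<odot> b"
    then have "b \<odot> c = c \<odot> b" by (simp add: c_def opsimps)
    then have "b \<odot> z = z \<odot> b" using bicommutant_commutes[OF z(1) b(1)] by blast
    then show "b \<odot> r = r \<odot> b" by (simp add: r_def opsimps)
  qed (rule positiveD(1)[OF r])
  ultimately show ?thesis using r by blast
qed


section \<open>Projections and von Neumann algebras\<close>

text \<open>The projection onto a closed complex subspace. It commutes with the operators that leave the
  subspace invariant together with their adjoints.\<close>

lemma projection_onto:
  fixes S :: "'h::chilbert_space set"
  assumes cl: "closed S" and sub: "subspace S" and sc: "\<And>c x. x \<in> S \<Longrightarrow> c *\<^sub>C x \<in> S"
  shows "\<exists>p. projection p \<and> (\<forall>x. blinfun_apply p x \<in> S) \<and> (\<forall>x\<in>S. blinfun_apply p x = x) \<and>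
    (\<forall>b\<in>bounded_ops. (\<forall>x\<in>S. blinfun_apply b x \<in> S) \<longrightarrow> (\<forall>x\<in>S. blinfun_apply (b\<^sup>\<star>) x \<in> S) \<longrightarrow> b \<odot> p = p \<odot> b)"
proof -
  obtain P where P: "\<And>x. P x \<in> S" "\<And>x z. z \<in> S \<Longrightarrow> inner (x - P x) z = 0"
    using closed_subspace_projection[OF cl sub] by metis
  have uniq: "P x = y" if "y \<in> S" "\<And>z. z \<in> S \<Longrightarrow> inner (x - y) z = 0" for x y
  proof -
    have "P x - y \<in> S" using P(1) that(1) sub by (simp add: subspace_diff)
    then have "inner (x - y) (P x - y) - inner (x - P x) (P x - y) = 0" using that(2) P(2) by simp
    then have "inner (P x - y) (P x - y) = 0" by (simp flip: inner_diff_left)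
    then show ?thesis by simp
  qed
  have fixP: "P x = x" if "x \<in> S" for x by (rule uniq) (use that in auto)
  have scal: "P (c *\<^sub>C x) = c *\<^sub>C P x" for c x
    by (rule uniq) (auto simp: P sc inner_scaleC_left simp flip: scaleC_diff_right)
  have lin: "bounded_linear P"
  proof (rule bounded_linear_intro)
    show "P (x + y) = P x + P y" for x y
    proof (rule uniq)
      show "P x + P y \<in> S" using P(1) sub by (simp add: subspace_add)
      show "inner (x + y - (P x + P y)) z = 0" if "z \<in> S" for z
        using P(2)[OF that, of x] P(2)[OF that, of y] by (simp add: inner_diff_left inner_add_left)
    qed
    show "P (r *\<^sub>R x) = r *\<^sub>R P x" for r x using scal[of "complex_of_real r" x] by (simp add: scaleR_scaleC)
    fix x
    have "inner (x - P x) (P x) = 0" using P by blast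
    then have "norm (P x) * norm (P x) = inner x (P x)"
      by (simp add: inner_diff_left flip: power2_norm_eq_inner power2_eq_square)
    also have "\<dots> \<le> norm x * norm (P x)" by (rule norm_cauchy_schwarz)
    finally show "norm (P x) \<le> norm x * 1"
      by (metis mult.right_neutral mult_le_cancel_right norm_ge_zero not_le order_le_less)
  qed
  define p where "p = Blinfun P"
  have p: "blinfun_apply p x = P x" for x using lin by (simp add: p_def bounded_linear_Blinfun_apply)
  have pb: "p \<in> bounded_ops" by (simp add: bounded_ops_def p scal)
  have adjp: "p\<^sup>\<star> = p"
  proof (rule adj_eqI[OF pb])
    fix x y
    have "inner (x - P x) (P y) = 0" "inner (y - P y) (P x) = 0" using P by blast+
    then have "inner x (P y) = inner (P x) (P y)" "inner y (P x) = inner (P y) (P x)"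
      by (simp_all add: inner_diff_left)
    then show "inner (p x) y = inner x (p y)" by (simp add: p inner_commute)
  qed
  have pp: "p \<odot> p = p" by (rule blinfun_eqI) (simp add: p fixP P)
  have comm: "b \<odot> p = p \<odot> b"
    if b: "b \<in> bounded_ops" "\<forall>x\<in>S. b x \<in> S" "\<forall>x\<in>S. (b\<^sup>\<star>) x \<in> S" for b
  proof (rule blinfun_eqI)
    fix x
    have "P (b x) = b (P x)"
    proof (rule uniq)
      show "inner (b x - b (P x)) z = 0" if "z \<in> S" for z
        using P(2)[of "(b\<^sup>\<star>) z" x] b that by (simp add: adj_inner' blinfun.bilinear_simps)
    qed (use P b in auto)
    then show "(b \<odot> p) x = (p \<odot> b) x" by (simp add: p)
  qed
  show ?thesis
  proof (intro exI[of _ p] conjI ballI allI impI)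
    show "projection p" using pb adjp pp by (simp add: projection_def)
    show "p x \<in> S" for x by (simp add: p P)
    show "p x = x" if "x \<in> S" for x using fixP[OF that] by (simp add: p)
  qed (rule comm)
qed

lemma projectionD:
  assumes "projection p"
  shows "p \<in> bounded_ops" "p\<^sup>\<star> = p" "p \<odot> p = p" "positive p"
  using assms positive_adj_comp[of p] by (auto simp: projection_def)

lemma commutant_closed:
  fixes a b :: "'h::chilbert_space operator"
  assumes "S \<subseteq> bounded_ops"
  shows "a \<in> commutant S \<Longrightarrow> b \<in> commutant S \<Longrightarrow> a + b \<in> commutant S"
    "a \<in> commutant S \<Longrightarrow> b \<in> commutant S \<Longrightarrow> a - b \<in> commutant S"
    "a \<in> commutant S \<Longrightarrow> b \<in> commutant S \<Longrightarrow> a \<odot> b \<in> commutant S"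
    "a \<in> commutant S \<Longrightarrow> r *\<^sub>R a \<in> commutant S"
    "a \<in> commutant S \<Longrightarrow> c *\<^sub>O a \<in> commutant S"
    "id_blinfun \<in> commutant S" "0 \<in> commutant S"
proof -
  show "a \<in> commutant S \<Longrightarrow> b \<in> commutant S \<Longrightarrow> a \<odot> b \<in> commutant S"
    by (auto simp: commutant_def) (metis comp_assoc)
qed (use assms in \<open>auto simp: commutant_def opsimps subset_iff\<close>)

lemma commutant_antimono: "S \<subseteq> T \<Longrightarrow> commutant T \<subseteq> commutant S"
  by (auto simp: commutant_def)

lemma commutant_adj:
  assumes S: "S \<subseteq> bounded_ops" "\<And>s. s \<in> S \<Longrightarrow> s\<^sup>\<star> \<in> S" and b: "b \<in> commutant S"
  shows "b\<^sup>\<star> \<in> commutant S"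
proof -
  have "s \<odot> b\<^sup>\<star> = b\<^sup>\<star> \<odot> s" if s: "s \<in> S" for s
  proof -
    have "b \<in> bounded_ops" "s\<^sup>\<star> \<odot> b = b \<odot> s\<^sup>\<star>" using b S(2)[OF s] by (auto simp: commutant_def)
    then have "(s\<^sup>\<star> \<odot> b)\<^sup>\<star> = (b \<odot> s\<^sup>\<star>)\<^sup>\<star>" by simp
    then show ?thesis using \<open>b \<in> bounded_ops\<close> S s by (simp add: subset_iff)
  qed
  then show ?thesis using b by (simp add: commutant_def)
qed

locale vna =
  fixes M :: "'h::chilbert_space operator set"
  assumes vna: "von_neumann_algebra M"
begin

lemma M_bounded [simp]: "x \<in> M \<Longrightarrow> x \<in> bounded_ops"
  using vna by (auto simp: von_neumann_algebra_def)

lemma M_adj [simp]: "x \<in> M \<Longrightarrow> x\<^sup>\<star> \<in> M"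
  using vna by (auto simp: von_neumann_algebra_def)

lemma M_bicommutant: "M = commutant (commutant M)"
  using vna by (auto simp: von_neumann_algebra_def)

lemma comm_bounded: "commutant S \<subseteq> bounded_ops" by (auto simp: commutant_def)

lemma M_closed [simp]:
  "a \<in> M \<Longrightarrow> b \<in> M \<Longrightarrow> a + b \<in> M" "a \<in> M \<Longrightarrow> b \<in> M \<Longrightarrow> a - b \<in> M" "a \<in> M \<Longrightarrow> b \<in> M \<Longrightarrow> a \<odot> b \<in> M"
  "a \<in> M \<Longrightarrow> r *\<^sub>R a \<in> M" "a \<in> M \<Longrightarrow> c *\<^sub>O a \<in> M" "id_blinfun \<in> M" "0 \<in> M"
  using commutant_closed[OF comm_bounded[of M]] M_bicommutant by auto

lemma M_uminus [simp]: "a \<in> M \<Longrightarrow> - a \<in> M"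
  using M_closed(2)[OF M_closed(7)] by simp

lemma M_sum [simp]: "(\<And>i. i \<in> I \<Longrightarrow> f i \<in> M) \<Longrightarrow> sum f I \<in> M"
  by (induction I rule: infinite_finite_induct) auto

lemma M_bicommutant_subset: "k \<in> M \<Longrightarrow> commutant (commutant {k}) \<subseteq> M"
  using commutant_antimono[OF commutant_antimono[of "{k}" M]] M_bicommutant by auto

lemma M_sqrt:
  assumes "k \<in> M" "positive k"
  obtains h where "h \<in> M" "positive h" "h \<odot> h = k"
  using positive_sqrt[OF assms(2)] M_bicommutant_subset[OF assms(1)] by blast

lemma M_strong_limit:
  assumes "\<And>n. a n \<in> M" "\<And>x. (\<lambda>n. blinfun_apply (a n) x) \<longlonglongrightarrow> blinfun_apply b x"
  shows "b \<in> M"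
  using strong_limit_commutant[OF _ assms(2), of "commutant M"] assms(1) M_bicommutant by auto

text \<open>The projection onto the common kernel of a family of operators. For a family in \<open>M\<close> it lies
  in \<open>M\<close>, because the commutant of \<open>M\<close> leaves the kernel invariant.\<close>

lemma kernel_projection_aux:
  assumes X: "X \<subseteq> bounded_ops"
  obtains p where "projection p" "\<And>x. blinfun_apply p x = x \<longleftrightarrow> (\<forall>a\<in>X. blinfun_apply a x = 0)"
    "\<And>a. a \<in> X \<Longrightarrow> a \<odot> p = 0"
    "\<And>b. b \<in> bounded_ops \<Longrightarrow> \<forall>x. (\<forall>a\<in>X. a x = 0) \<longrightarrow> (\<forall>a\<in>X. a (b x) = 0 \<and> a ((b\<^sup>\<star>) x) = 0) \<Longrightarrow>
      b \<odot> p = p \<odot> b"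
proof -
  let ?S = "{x. \<forall>a\<in>X. blinfun_apply a x = 0}"
  have "?S = (\<Inter>a\<in>X. {x. blinfun_apply a x = 0})" by auto
  moreover have "closed \<dots>" by (intro closed_INT ballI closed_Collect_eq continuous_intros)
  ultimately have cl: "closed ?S" by simp
  have sub: "subspace ?S" by (auto simp: subspace_def blinfun.bilinear_simps)
  have sc: "c *\<^sub>C x \<in> ?S" if "x \<in> ?S" for c x using that X by (auto simp: bounded_opsD subset_iff)
  obtain p where p: "projection p" "\<And>x. p x \<in> ?S" "\<And>x. x \<in> ?S \<Longrightarrow> p x = x"
    "\<And>b. b\<in>bounded_ops \<Longrightarrow> (\<forall>x\<in>?S. b x \<in> ?S) \<Longrightarrow> (\<forall>x\<in>?S. (b\<^sup>\<star>) x \<in> ?S) \<Longrightarrow> b \<odot> p = p \<odot> b"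
    using projection_onto[OF cl sub sc] by blast
  show ?thesis
  proof (rule that[OF p(1)])
    show "(p x = x) = (\<forall>a\<in>X. a x = 0)" for x using p(2)[of x] p(3)[of x] by auto
    show "a \<odot> p = 0" if "a \<in> X" for a using p(2) that by (auto intro: blinfun_eqI)
    show "b \<odot> p = p \<odot> b" if "b \<in> bounded_ops"
      "\<forall>x. (\<forall>a\<in>X. a x = 0) \<longrightarrow> (\<forall>a\<in>X. a (b x) = 0 \<and> a ((b\<^sup>\<star>) x) = 0)" for b
      by (rule p(4)) (use that in auto)
  qed
qed

lemma commutant_M_adj: "b \<in> commutant M \<Longrightarrow> b\<^sup>\<star> \<in> commutant M"
  by (rule commutant_adj) auto

lemma kernel_projection_commuting:
  assumes X: "X \<subseteq> M"
  obtains p where "p \<in> M" "projection p" "\<And>x. blinfun_apply p x = x \<longleftrightarrow> (\<forall>a\<in>X. blinfun_apply a x = 0)"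
    "\<And>a. a \<in> X \<Longrightarrow> a \<odot> p = 0"
    "\<And>b. b \<in> bounded_ops \<Longrightarrow> \<forall>x. (\<forall>a\<in>X. a x = 0) \<longrightarrow> (\<forall>a\<in>X. a (b x) = 0 \<and> a ((b\<^sup>\<star>) x) = 0) \<Longrightarrow>
      b \<odot> p = p \<odot> b"
proof -
  have XB: "X \<subseteq> bounded_ops" using X by auto
  obtain p where p: "projection p" "\<And>x. blinfun_apply p x = x \<longleftrightarrow> (\<forall>a\<in>X. blinfun_apply a x = 0)"
    "\<And>a. a \<in> X \<Longrightarrow> a \<odot> p = 0"
    "\<And>b. b \<in> bounded_ops \<Longrightarrow> \<forall>x. (\<forall>a\<in>X. a x = 0) \<longrightarrow> (\<forall>a\<in>X. a (b x) = 0 \<and> a ((b\<^sup>\<star>) x) = 0) \<Longrightarrow>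
      b \<odot> p = p \<odot> b"
    by (rule kernel_projection_aux[OF XB]) (rule that)
  have inv: "\<forall>a\<in>X. a (b x) = 0" if "b \<in> commutant M" "\<forall>a\<in>X. a x = 0" for b x
  proof
    fix a assume a: "a \<in> X"
    then have "a \<odot> b = b \<odot> a" using that(1) X by (auto simp: commutant_def)
    then have "a (b x) = b (a x)" by (simp flip: blinfun_apply_blinfun_compose)
    then show "a (b x) = 0" using that(2) a by simp
  qed
  have "p \<in> commutant (commutant M)"
  proof -
    have "b \<odot> p = p \<odot> b" if b: "b \<in> commutant M" for b
      using b comm_bounded inv inv[OF commutant_M_adj[OF b]] by (intro p(4)) auto
    then show ?thesis using projectionD(1)[OF p(1)] by (simp add: commutant_def)
  qed
  then have "p \<in> M" using M_bicommutant by simp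
  then show ?thesis using that p by blast
qed

lemma kernel_projection:
  assumes X: "X \<subseteq> M"
  obtains p where "p \<in> M" "projection p" "\<And>x. blinfun_apply p x = x \<longleftrightarrow> (\<forall>a\<in>X. blinfun_apply a x = 0)"
    "\<And>a. a \<in> X \<Longrightarrow> a \<odot> p = 0"
  by (rule kernel_projection_commuting[OF X]) (rule that)

text \<open>A bounded sequence that converges on a family of ranges with trivial common orthogonal
  complement converges everywhere.\<close>

lemma strong_limit_exists:
  assumes a: "\<And>n. a n \<in> M" and C: "\<And>n. norm (a n) \<le> C" and R: "R \<subseteq> M"
    and conv: "\<And>r x. r \<in> R \<Longrightarrow> convergent (\<lambda>n. blinfun_apply (a n) (blinfun_apply r x))"
    and triv: "\<And>x. (\<And>r. r \<in> R \<Longrightarrow> blinfun_apply (r\<^sup>\<star>) x = 0) \<Longrightarrow> x = 0"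
  obtains b where "b \<in> M" "norm b \<le> C" "\<And>x. (\<lambda>n. blinfun_apply (a n) x) \<longlonglongrightarrow> blinfun_apply b x"
proof -
  let ?S = "{x. convergent (\<lambda>n. a n x)}"
  have sub: "subspace ?S"
  proof (rule subspaceI)
    fix x y assume "x \<in> ?S" "y \<in> ?S"
    then show "x + y \<in> ?S" using convergent_add[of "\<lambda>n. a n x" "\<lambda>n. a n y"] by (simp add: blinfun.add_right)
  next
    fix r x assume "x \<in> ?S"
    then obtain L where "(\<lambda>n. a n x) \<longlonglongrightarrow> L" by (auto simp: convergent_def)
    then have "(\<lambda>n. a n (r *\<^sub>R x)) \<longlonglongrightarrow> r *\<^sub>R L"
      using tendsto_scaleR[OF tendsto_const] by (simp add: blinfun.scaleR_right)
    then show "r *\<^sub>R x \<in> ?S" by (auto simp: convergent_def)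
  qed (simp add: convergent_const)
  have C0: "0 \<le> C" using C[of 0] norm_ge_zero order_trans by blast
  have cl: "closed ?S"
  proof (rule closed_sequential_limits[THEN iffD2], intro allI impI, elim conjE)
    fix y l assume y: "\<forall>n. y n \<in> ?S" and l: "y \<longlonglongrightarrow> l"
    have "Cauchy (\<lambda>n. a n l)"
    proof (rule metric_CauchyI)
      fix e :: real assume e: "0 < e"
      define e' where "e' = e / (3 * (C + 1))"
      have e': "0 < e'" using e C0 by (simp add: e'_def)
      have Ce: "C * e' \<le> e / 3" using e C0 by (simp add: e'_def field_simps)
      obtain k where k: "norm (l - y k) < e'"
        using LIMSEQ_D[OF l e'] by (auto simp: norm_minus_commute)
      have "Cauchy (\<lambda>n. a n (y k))" using y convergent_Cauchy by blast
      then obtain N where N: "\<And>m n. m \<ge> N \<Longrightarrow> n \<ge> N \<Longrightarrow> dist (a m (y k)) (a n (y k)) < e / 3"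
        using metric_CauchyD[of "\<lambda>n. a n (y k)" "e/3"] e by auto
      have near: "dist (a n l) (a n (y k)) \<le> e / 3" for n
      proof -
        have "dist (a n l) (a n (y k)) = norm (a n (l - y k))" by (simp add: dist_norm blinfun.bilinear_simps)
        also have "\<dots> \<le> C * norm (l - y k)" by (meson C norm_blinfun mult_right_mono norm_ge_zero order_trans)
        also have "\<dots> \<le> C * e'" using k C0 by (intro mult_left_mono) auto
        finally show ?thesis using Ce by linarith
      qed
      have "dist (a m l) (a n l) < e" if "m \<ge> N" "n \<ge> N" for m n
        using near[of m] near[of n] N[OF that] dist_triangle[of "a m l" "a n l" "a m (y k)"]
          dist_triangle[of "a m (y k)" "a n l" "a n (y k)"] by (simp add: dist_commute)
      then show "\<exists>N. \<forall>m\<ge>N. \<forall>n\<ge>N. dist (a m l) (a n l) < e" by blast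
    qed
    then show "l \<in> ?S" by (simp add: Cauchy_convergent)
  qed
  have "x \<in> ?S" for x
  proof -
    obtain y where y: "y \<in> ?S" "\<And>z. z \<in> ?S \<Longrightarrow> inner (x - y) z = 0"
      using closed_subspace_projection[OF cl sub, of x] by blast
    have "x - y = 0"
    proof (rule triv)
      fix r assume r: "r \<in> R"
      have "inner ((r\<^sup>\<star>) (x - y)) z = 0" for z
        using y(2)[of "r z"] conv[OF r] r R by (simp add: adj_inner subset_iff)
      then show "(r\<^sup>\<star>) (x - y) = 0" by (metis inner_eq_zero_iff)
    qed
    then show ?thesis using y by simp
  qed
  then have "\<And>x. convergent (\<lambda>n. a n x)" by blast
  then obtain b where b: "\<And>x. (\<lambda>n. a n x) \<longlonglongrightarrow> blinfun_apply b x" "norm b \<le> C" using pointwise_limit[of a C, OF C] by blast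
  show ?thesis using that[OF M_strong_limit[OF a b(1)] b(2) b(1)] .
qed

end


section \<open>The trace and the 2-norm\<close>

lemma seq_squeeze_zero:
  fixes f :: "nat \<Rightarrow> real"
  assumes "\<And>n. 0 \<le> f n" "\<And>n. f n \<le> g n" "g \<longlonglongrightarrow> 0"
  shows "f \<longlonglongrightarrow> 0"
  by (rule tendsto_sandwich[OF _ _ tendsto_const assms(3)]) (simp_all add: assms)

text \<open>A von Neumann algebra with a faithful normal tracial state.\<close>

locale tracial = vna M for M :: "'h::chilbert_space operator set" +
  fixes tr :: "'h operator \<Rightarrow> complex"
  assumes normalized_trace: "normalized_trace M tr"
begin

lemma tr_add: "x \<in> M \<Longrightarrow> y \<in> M \<Longrightarrow> tr (x + y) = tr x + tr y"
  using normalized_trace by (simp add: normalized_trace_def linear_on_vna_def)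

lemma tr_scale: "x \<in> M \<Longrightarrow> tr (c *\<^sub>O x) = c * tr x"
  using normalized_trace by (simp add: normalized_trace_def linear_on_vna_def)

lemma tr_scaleR: "x \<in> M \<Longrightarrow> tr (r *\<^sub>R x) = complex_of_real r * tr x"
  by (metis tr_scale scale_op_scaleR)

lemma tr_uminus: "x \<in> M \<Longrightarrow> tr (- x) = - tr x"
  using tr_scaleR[of x "-1"] by simp

lemma tr_diff: "x \<in> M \<Longrightarrow> y \<in> M \<Longrightarrow> tr (x - y) = tr x - tr y"
  using tr_add[of x "- y"] tr_uminus[of y] by simp

lemma tr_zero: "tr 0 = 0"
  using tr_scaleR[of 0 0] by simp

lemma tr_id: "tr id_blinfun = 1"
  using normalized_trace by (simp add: normalized_trace_def)

lemma tr_commute: "x \<in> M \<Longrightarrow> y \<in> M \<Longrightarrow> tr (x \<odot> y) = tr (y \<odot> x)"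
proof -
  assume x: "x \<in> M" "y \<in> M"
  have "\<forall>x\<in>M. \<forall>y\<in>M. tr (x \<odot> y) = tr (y \<odot> x)"
    using normalized_trace unfolding normalized_trace_def by (elim conjE)
  then show ?thesis using x by blast
qed

lemma tr_sum: "(\<And>i. i \<in> I \<Longrightarrow> f i \<in> M) \<Longrightarrow> tr (sum f I) = (\<Sum>i\<in>I. tr (f i))"
  by (induction I rule: infinite_finite_induct) (auto simp: tr_zero tr_add)

lemma tr_square_nonneg: "x \<in> M \<Longrightarrow> Im (tr (x\<^sup>\<star> \<odot> x)) = 0 \<and> 0 \<le> Re (tr (x\<^sup>\<star> \<odot> x))"
proof -
  assume x: "x \<in> M"
  have "\<forall>x\<in>M. tr (x\<^sup>\<star> \<odot> x) \<in> \<real>\<^sub>\<ge>\<^sub>0"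
    using normalized_trace unfolding normalized_trace_def by (elim conjE)
  then show ?thesis using x by (meson complex_nonneg_Reals_iff)
qed

lemma tr_faithful: "x \<in> M \<Longrightarrow> tr (x\<^sup>\<star> \<odot> x) = 0 \<Longrightarrow> x = 0"
proof -
  assume x: "x \<in> M" "tr (x\<^sup>\<star> \<odot> x) = 0"
  have "\<forall>x\<in>M. tr (x\<^sup>\<star> \<odot> x) = 0 \<longrightarrow> x = 0"
    using normalized_trace unfolding normalized_trace_def by (elim conjE)
  then show ?thesis using x by blast
qed

text \<open>The real part of the inner product induced by the trace.\<close>

definition ip :: "'h operator \<Rightarrow> 'h operator \<Rightarrow> real" where
  "ip x y = Re (tr (x\<^sup>\<star> \<odot> y))"

abbreviation n2 :: "'h operator \<Rightarrow> real" where "n2 \<equiv> norm2 tr"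

lemma ip_add_right: "x \<in> M \<Longrightarrow> y \<in> M \<Longrightarrow> z \<in> M \<Longrightarrow> ip x (y + z) = ip x y + ip x z"
  and ip_diff_right: "x \<in> M \<Longrightarrow> y \<in> M \<Longrightarrow> z \<in> M \<Longrightarrow> ip x (y - z) = ip x y - ip x z"
  and ip_scaleR_right: "x \<in> M \<Longrightarrow> y \<in> M \<Longrightarrow> ip x (r *\<^sub>R y) = r * ip x y"
  and ip_add_left: "x \<in> M \<Longrightarrow> y \<in> M \<Longrightarrow> z \<in> M \<Longrightarrow> ip (y + z) x = ip y x + ip z x"
  and ip_diff_left: "x \<in> M \<Longrightarrow> y \<in> M \<Longrightarrow> z \<in> M \<Longrightarrow> ip (y - z) x = ip y x - ip z x"
  and ip_scaleR_left: "x \<in> M \<Longrightarrow> y \<in> M \<Longrightarrow> ip (r *\<^sub>R y) x = r * ip y x"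
  by (simp_all add: ip_def opsimps tr_add tr_diff tr_scaleR)

lemma tr_hermitian:
  assumes x: "x \<in> M" and y: "y \<in> M"
  shows "tr (y\<^sup>\<star> \<odot> x) = cnj (tr (x\<^sup>\<star> \<odot> y))"
proof -
  have "Im (tr ((x + y)\<^sup>\<star> \<odot> (x + y))) = 0" using x y by (intro tr_square_nonneg[THEN conjunct1]) simp
  then have 1: "Im (tr (x\<^sup>\<star> \<odot> y)) + Im (tr (y\<^sup>\<star> \<odot> x)) = 0"
    using x y tr_square_nonneg[OF x] tr_square_nonneg[OF y] by (simp add: opsimps tr_add)
  let ?z = "x + \<i> *\<^sub>O y"
  have "Im (tr (?z\<^sup>\<star> \<odot> ?z)) = 0" using x y by (intro tr_square_nonneg[THEN conjunct1]) simp
  then have 2: "Re (tr (x\<^sup>\<star> \<odot> y)) = Re (tr (y\<^sup>\<star> \<odot> x))"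
    using x y tr_square_nonneg[OF x] tr_square_nonneg[OF y]
    by (simp add: opsimps tr_add tr_scale scale_op_scale_op)
  show ?thesis using 1 2 by (simp add: complex_eq_iff)
qed

lemma ip_commute: "x \<in> M \<Longrightarrow> y \<in> M \<Longrightarrow> ip x y = ip y x"
  using tr_hermitian[of x y] by (simp add: ip_def)

lemma n2_sq: "x \<in> M \<Longrightarrow> (n2 x)\<^sup>2 = ip x x"
  by (simp add: norm2_def ip_def tr_square_nonneg)

lemma n2_nonneg [simp]: "x \<in> M \<Longrightarrow> 0 \<le> n2 x"
  by (simp add: norm2_def tr_square_nonneg)

lemma ip_nonneg: "x \<in> M \<Longrightarrow> 0 \<le> ip x x"
  by (metis n2_sq zero_le_power2)

lemma n2_zero [simp]: "n2 0 = 0" by (simp add: norm2_def opsimps tr_zero)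

lemma n2_eq_0: assumes "x \<in> M" "n2 x = 0" shows "x = 0"
proof (rule tr_faithful[OF assms(1)])
  have "ip x x = 0" using n2_sq[OF assms(1)] assms(2) by simp
  then show "tr (x\<^sup>\<star> \<odot> x) = 0" using tr_square_nonneg[OF assms(1)] by (simp add: ip_def complex_eq_iff)
qed

lemma ip_cauchy_schwarz: assumes x: "x \<in> M" and y: "y \<in> M" shows "\<bar>ip x y\<bar> \<le> n2 x * n2 y"
proof -
  have *: "0 \<le> ip x x + 2 * t * ip x y + t\<^sup>2 * ip y y" for t
  proof -
    have "0 \<le> ip (x + t *\<^sub>R y) (x + t *\<^sub>R y)" using x y by (intro ip_nonneg) simp
    also have "\<dots> = ip x x + 2 * t * ip x y + t\<^sup>2 * ip y y"
      using x y ip_commute[OF x y]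
      by (simp add: ip_add_left ip_add_right ip_scaleR_left ip_scaleR_right power2_eq_square algebra_simps)
    finally show ?thesis .
  qed
  have "(ip x y)\<^sup>2 \<le> ip x x * ip y y"
  proof (cases "ip y y = 0")
    case True
    then have "y = 0" using n2_eq_0[OF y] n2_sq[OF y] by simp
    then show ?thesis by (simp add: ip_def opsimps tr_zero)
  next
    case False
    then have r0: "0 < ip y y" using ip_nonneg[OF y] by simp
    have "0 \<le> ip x x - (ip x y)\<^sup>2 / ip y y" using *[of "- ip x y / ip y y"] False
      by (simp add: power2_eq_square field_simps)
    then show ?thesis using r0 by (simp add: field_simps)
  qed
  also have "\<dots> = (n2 x * n2 y)\<^sup>2" using x y by (simp add: power_mult_distrib n2_sq)
  finally show ?thesis using x y abs_le_square_iff[of "ip x y" "n2 x * n2 y"] by simp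
qed

lemma n2_triangle: assumes x: "x \<in> M" and y: "y \<in> M" shows "n2 (x + y) \<le> n2 x + n2 y"
proof (rule power2_le_imp_le)
  have "(n2 (x + y))\<^sup>2 = (n2 x)\<^sup>2 + 2 * ip x y + (n2 y)\<^sup>2"
    using x y ip_commute[OF x y] by (simp add: n2_sq ip_add_left ip_add_right)
  then show "(n2 (x + y))\<^sup>2 \<le> (n2 x + n2 y)\<^sup>2"
    using ip_cauchy_schwarz[OF x y] by (simp add: power2_sum)
qed (use x y in simp)

lemma n2_scale: "x \<in> M \<Longrightarrow> n2 (c *\<^sub>O x) = cmod c * n2 x"
proof -
  assume x: "x \<in> M"
  have "tr ((c *\<^sub>O x)\<^sup>\<star> \<odot> (c *\<^sub>O x)) = (cnj c * c) * tr (x\<^sup>\<star> \<odot> x)"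
    using x by (simp add: opsimps scale_op_scale_op tr_scale)
  also have "cnj c * c = complex_of_real ((cmod c)\<^sup>2)" by (metis complex_norm_square mult.commute)
  finally show ?thesis by (simp add: norm2_def real_sqrt_mult)
qed

lemma n2_scaleR: "x \<in> M \<Longrightarrow> n2 (r *\<^sub>R x) = \<bar>r\<bar> * n2 x"
  using n2_scale[of x "complex_of_real r"] by (simp add: scale_op_scaleR)

lemma n2_uminus: "x \<in> M \<Longrightarrow> n2 (- x) = n2 x"
  using n2_scaleR[of x "-1"] by simp

lemma n2_minus_commute: "x \<in> M \<Longrightarrow> y \<in> M \<Longrightarrow> n2 (x - y) = n2 (y - x)"
  using n2_uminus[of "x - y"] by simp

lemma n2_triangle_diff: "x \<in> M \<Longrightarrow> y \<in> M \<Longrightarrow> n2 (x - y) \<le> n2 x + n2 y"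
  using n2_triangle[of x "- y"] n2_uminus[of y] by simp

lemma n2_triangle3: "x \<in> M \<Longrightarrow> y \<in> M \<Longrightarrow> z \<in> M \<Longrightarrow> n2 (x - z) \<le> n2 (x - y) + n2 (y - z)"
  using n2_triangle[of "x - y" "y - z"] by simp

lemma n2_adj: "x \<in> M \<Longrightarrow> n2 (x\<^sup>\<star>) = n2 x"
  using tr_commute[of "x\<^sup>\<star>" x] by (simp add: norm2_def)

lemma tr_positive: assumes a: "a \<in> M" "positive a" shows "0 \<le> Re (tr a)"
proof -
  obtain h where h: "h \<in> M" "positive h" "h \<odot> h = a" using M_sqrt[OF a] .
  then show ?thesis using tr_square_nonneg[OF h(1)] positiveD(2)[OF h(2)] by simp
qed

lemma tr_mono: "a \<in> M \<Longrightarrow> b \<in> M \<Longrightarrow> positive (b - a) \<Longrightarrow> Re (tr a) \<le> Re (tr b)"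
  using tr_positive[of "b - a"] by (simp add: tr_diff)

text \<open>\<open>\<parallel>ax\<parallel>\<^sub>2 \<le> \<parallel>a\<parallel> \<parallel>x\<parallel>\<^sub>2\<close>, as \<open>x\<^sup>\<star>(\<parallel>a\<parallel>\<^sup>2 - a\<^sup>\<star>a)x\<close> is positive.\<close>

lemma n2_comp_left: assumes a: "a \<in> M" and x: "x \<in> M" and C: "norm a \<le> C" shows "n2 (a \<odot> x) \<le> C * n2 x"
proof -
  have C0: "0 \<le> C" using C norm_ge_zero order_trans by blast
  have "norm (a\<^sup>\<star> \<odot> a) \<le> C * C" using a C by (intro norm_comp_le) auto
  then have "positive ((C * C) *\<^sub>R id_blinfun - a\<^sup>\<star> \<odot> a)" using a by (intro positive_norm_minus) auto
  then have "positive (x\<^sup>\<star> \<odot> ((C * C) *\<^sub>R id_blinfun - a\<^sup>\<star> \<odot> a) \<odot> x)" using x by (intro positive_sandwich) auto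
  then have "0 \<le> Re (tr (x\<^sup>\<star> \<odot> ((C * C) *\<^sub>R id_blinfun - a\<^sup>\<star> \<odot> a) \<odot> x))" using a x by (intro tr_positive) auto
  then have "ip (a \<odot> x) (a \<odot> x) \<le> C * C * ip x x"
    using a x by (simp add: opsimps tr_diff tr_scaleR ip_def)
  moreover have "(C * n2 x)\<^sup>2 = C * C * ip x x"
    by (simp only: power_mult_distrib n2_sq[OF x]) (simp add: power2_eq_square)
  ultimately have "(n2 (a \<odot> x))\<^sup>2 \<le> (C * n2 x)\<^sup>2" using a x by (simp add: n2_sq)
  then show ?thesis by (rule power2_le_imp_le) (use C0 x in simp)
qed

lemma n2_comp_right: assumes a: "a \<in> M" and x: "x \<in> M" and C: "norm a \<le> C" shows "n2 (x \<odot> a) \<le> C * n2 x"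
  using n2_comp_left[of "a\<^sup>\<star>" "x\<^sup>\<star>" C] n2_adj[of "x \<odot> a"] n2_adj[of x] a x C by simp

lemma n2_id [simp]: "n2 id_blinfun = 1" by (simp add: norm2_def opsimps tr_id)

lemma n2_le_norm: "a \<in> M \<Longrightarrow> n2 a \<le> norm a"
  using n2_comp_left[of a id_blinfun "norm a"] by (simp add: opsimps)

lemma n2_unitary_left: "u \<in> M \<Longrightarrow> x \<in> M \<Longrightarrow> unitary u \<Longrightarrow> n2 (u \<odot> x) = n2 x"
proof -
  assume *: "u \<in> M" "x \<in> M" "unitary u"
  have "(u \<odot> x)\<^sup>\<star> \<odot> (u \<odot> x) = x\<^sup>\<star> \<odot> ((u\<^sup>\<star> \<odot> u) \<odot> x)" using * by (simp add: opsimps)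
  also have "\<dots> = x\<^sup>\<star> \<odot> x" using * by (simp only: unitary_def comp_distribs)
  finally show ?thesis by (simp only: norm2_def)
qed

lemma n2_unitary_right: "u \<in> M \<Longrightarrow> x \<in> M \<Longrightarrow> unitary u \<Longrightarrow> n2 (x \<odot> u) = n2 x"
  using n2_unitary_left[of "u\<^sup>\<star>" "x\<^sup>\<star>"] n2_adj[of x] n2_adj[of "x \<odot> u"] by (simp add: unitary_def)

lemma tr_n2_bound: "x \<in> M \<Longrightarrow> y \<in> M \<Longrightarrow> cmod (tr (x \<odot> y)) \<le> 2 * (n2 x * n2 y)"
proof -
  assume x: "x \<in> M" and y: "y \<in> M"
  have "\<bar>Re (tr (x \<odot> y))\<bar> \<le> n2 x * n2 y"
    using ip_cauchy_schwarz[of "x\<^sup>\<star>" y] x y by (simp add: ip_def n2_adj)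
  moreover have "\<bar>Im (tr (x \<odot> y))\<bar> \<le> n2 x * n2 y"
    using ip_cauchy_schwarz[of "x\<^sup>\<star>" "\<i> *\<^sub>O y"] x y by (simp add: ip_def n2_adj n2_scale opsimps tr_scale)
  ultimately show ?thesis using cmod_le[of "tr (x \<odot> y)"] by linarith
qed


section \<open>Completeness of bounded sets in the 2-norm\<close>

text \<open>Normality of the trace enters through this lemma: it bounds the trace of an
  increasing limit.\<close>

lemma tr_increasing_limit:
  assumes d: "\<And>n. d n \<in> M" "\<And>n. positive (d n)" "\<And>n. positive (d (Suc n) - d n)" "\<And>n. norm (d n) \<le> C"
    and e: "\<And>n. Re (tr (d n)) \<le> e"
  obtains s where "s \<in> M" "positive s" "norm s \<le> C" "\<And>n. positive (s - d n)" "Re (tr s) \<le> e"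
    "\<And>x. (\<lambda>n. blinfun_apply (d n) x) \<longlonglongrightarrow> blinfun_apply s x"
proof -
  obtain s where s: "s \<in> commutant (commutant M)" "positive s" "norm s \<le> C" "\<And>n. positive (s - d n)"
    and lim: "\<And>x. (\<lambda>n. d n x) \<longlonglongrightarrow> blinfun_apply s x"
    using monotone_convergence[of d "commutant M" C] d M_bicommutant by blast
  have sM: "s \<in> M" using s(1) M_bicommutant by simp
  have mono: "positive (d n - d m)" if "m \<le> n" for m n
    using that
  proof (induction n rule: dec_induct)
    case (step n)
    then show ?case using positive_add[OF d(3)[of n] step.IH] by (simp add: algebra_simps)
  qed simp
  have "Re (tr s) = (SUP a\<in>range d. Re (tr a))"
  proof -
    have nrm: "normal_on_vna M tr" using normalized_trace unfolding normalized_trace_def by (elim conjE)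
    have "\<exists>c\<in>range d. op_le (d m) c \<and> op_le (d n) c" for m n
      using mono[of m "max m n"] mono[of n "max m n"] d(1) by (auto simp: op_le_iff)
    moreover have "op_le s t" if "t \<in> M" "\<forall>a\<in>range d. op_le a t" for t
    proof -
      have "positive (t - s)"
      proof (rule strong_limit_positive[where a = "\<lambda>n. t - d n"])
        show "positive (t - d n)" for n using that d(1) by (auto simp: op_le_iff)
        show "(\<lambda>n. (t - d n) x) \<longlonglongrightarrow> (t - s) x" for x
          using tendsto_diff[OF tendsto_const lim] by (simp add: blinfun.bilinear_simps)
      qed
      then show ?thesis using that sM by (simp add: op_le_iff)
    qed
    ultimately show ?thesis
      using d(1,2) s(4) sM
      by (intro nrm[unfolded normal_on_vna_def, rule_format]) (auto simp: op_le_iff positive_def)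
  qed
  also have "\<dots> \<le> e" using e by (intro cSUP_least) auto
  finally show ?thesis using that sM s lim by blast
qed

text \<open>A noncommutative Chebyshev inequality for a sequence of positive operators with summable
  traces: outside a set of small trace all of them are bounded. The cut-off \<open>r\<close> is the
  decreasing limit of the resolvents \<open>(1 + g\<^sub>0 + \<dots> + g\<^sub>n)\<inverse>\<close>.\<close>

lemma resolvent_cutoff:
  fixes g :: "nat \<Rightarrow> 'h operator"
  assumes g: "\<And>n. g n \<in> M" "\<And>n. positive (g n)"
    and e: "\<And>N. (\<Sum>n<N. Re (tr (g n))) \<le> e"
  obtains r where "r \<in> M" "positive r" "positive (id_blinfun - r)" "Re (tr (id_blinfun - r)) \<le> e"
    "\<And>n x. inner (blinfun_apply r x) (blinfun_apply (g n) (blinfun_apply r x)) \<le> (norm x)\<^sup>2"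
proof -
  define s where "s N = (\<Sum>n<N. g n)" for N
  have sM: "s N \<in> M" for N using g(1) by (simp add: s_def)
  have sp: "positive (s N)" for N by (induction N) (auto simp: s_def positive_add g)
  have "\<exists>R. R \<in> M \<and> positive R \<and> (id_blinfun + s N) \<odot> R = id_blinfun \<and> R \<odot> (id_blinfun + s N) = id_blinfun" for N
    using positive_inverse[OF sp[of N]] M_bicommutant_subset[OF sM[of N]] by blast
  then obtain R where R: "\<And>N. R N \<in> M" "\<And>N. positive (R N)"
    "\<And>N. (id_blinfun + s N) \<odot> R N = id_blinfun" "\<And>N. R N \<odot> (id_blinfun + s N) = id_blinfun"
    by metis
  have TR: "R N x + s N (R N x) = x" "R N (x + s N x) = x" for N x
    using arg_cong[OF R(3)[of N], of "\<lambda>a. blinfun_apply a x"]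
      arg_cong[OF R(4)[of N], of "\<lambda>a. blinfun_apply a x"] by (auto simp: blinfun.bilinear_simps)
  define T where "T N = id_blinfun + s N" for N
  have T: "positive (T N)" for N using sp by (simp add: T_def positive_add)
  have TM: "T N \<in> M" for N using sM by (simp add: T_def)
  have TRx: "T N (R N x) = x" "R N (T N x) = x" for N x using TR by (simp_all add: T_def blinfun.bilinear_simps)
  \<comment> \<open>Inversion reverses the order: expand the form of \<open>T m\<close> at \<open>R m x - R n x\<close>.\<close>
  have anti: "positive (R m - R n)" if "positive (s n - s m)" for m n
    unfolding positive_iff
  proof (intro conjI allI)
    fix x
    let ?y = "R n x" and ?z = "R m x"
    have "0 \<le> inner (?z - ?y) (T m (?z - ?y))" by (rule positiveD[OF T])
    also have "\<dots> = inner ?z x - 2 * inner x ?y + inner ?y (T m ?y)"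
      using positiveD(4)[OF T, of m ?z ?y] by (simp add: blinfun.bilinear_simps inner_diff TRx inner_commute)
    also have "inner ?y (T m ?y) \<le> inner ?y (T n ?y)"
      using positiveD(3)[OF that, of ?y] by (simp add: T_def blinfun.bilinear_simps inner_diff_right inner_add_right)
    finally show "0 \<le> inner x ((R m - R n) x)"
      by (simp add: TRx blinfun.bilinear_simps inner_diff_right inner_commute)
  qed (use positiveD[OF R(2)] in auto)
  define d where "d N = id_blinfun - R N" for N
  have s0: "s 0 = 0" by (simp add: s_def)
  have R0: "R 0 = id_blinfun" using R(3)[of 0] by (simp add: s0 opsimps)
  have dpos: "positive (d N)" for N
    using anti[of N 0] sp[of N] by (simp add: s0 R0 d_def)
  have dmono: "positive (d (Suc N) - d N)" for N
    using anti[of "Suc N" N] g(2)[of N] by (simp add: s_def d_def)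
  have dM: "d N \<in> M" for N using R by (simp add: d_def)
  have dn: "norm (d N) \<le> 1" for N
    using positive_le_id_norm[OF dpos[of N]] R(2)[of N] by (simp add: d_def)
  \<comment> \<open>\<open>1 - (1 + s)\<inverse> \<le> s\<close>\<close>
  have dtr: "Re (tr (d N)) \<le> e" for N
  proof -
    have "positive (s N - d N)"
      unfolding positive_iff
    proof (intro conjI allI)
      fix x
      have "0 \<le> inner (x - R N x) (T N (x - R N x))" by (rule positiveD[OF T])
      also have "\<dots> = inner x (T N x) - 2 * inner x x + inner (R N x) x"
        using positiveD(4)[OF T, of N x "R N x"] by (simp add: blinfun.bilinear_simps inner_diff TRx inner_commute)
      finally show "0 \<le> inner x ((s N - d N) x)"
        by (simp add: T_def d_def blinfun.bilinear_simps inner_diff_right inner_add_right inner_commute)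
    qed (use positiveD[OF sp] positiveD[OF dpos] in auto)
    then have "Re (tr (d N)) \<le> Re (tr (s N))" using sM dM by (intro tr_mono)
    also have "\<dots> = (\<Sum>n<N. Re (tr (g n)))" using g by (simp add: s_def tr_sum)
    finally show ?thesis using e[of N] by simp
  qed
  obtain t where t: "t \<in> M" "positive t" "norm t \<le> 1" "\<And>n. positive (t - d n)" "Re (tr t) \<le> e"
    "\<And>x. (\<lambda>n. blinfun_apply (d n) x) \<longlonglongrightarrow> blinfun_apply t x"
    by (rule tr_increasing_limit[of d 1 e, OF dM dpos dmono dn dtr]) (rule that)
  define r where "r = id_blinfun - t"
  have r: "positive r" unfolding r_def using positive_norm_minus[of t 1] positiveD[OF t(2)] t(3) by simp
  \<comment> \<open>From \<open>r \<le> T\<inverse>\<close> follows \<open>rTr \<le> r\<close> for \<open>T = 1 + s\<close>, and \<open>g n \<le> T\<close>.\<close>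
  have bound: "inner (r x) (g n (r x)) \<le> (norm x)\<^sup>2" for n x
  proof -
    let ?N = "Suc n"
    have Rr: "positive (R ?N - r)" using t(4)[of ?N] by (simp add: r_def d_def algebra_simps)
    let ?y = "r x" let ?a = "inner ?y (T ?N ?y)"
    have gT: "inner ?y (g n ?y) \<le> ?a"
      using positiveD(3)[OF sp[of n], of ?y]
      by (simp add: T_def s_def blinfun.bilinear_simps inner_add_right)
    have rx: "inner x (r x) \<le> (norm x)\<^sup>2"
      using positiveD(3)[OF t(2), of x] by (simp add: r_def blinfun.bilinear_simps inner_diff_right power2_norm_eq_inner)
    have "?a\<^sup>2 = (inner (T ?N ?y) (r x))\<^sup>2" by (simp add: inner_commute)
    also have "\<dots> \<le> inner (T ?N ?y) (r (T ?N ?y)) * inner x (r x)" by (rule positive_cauchy_schwarz[OF r])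
    also have "\<dots> \<le> inner (T ?N ?y) (R ?N (T ?N ?y)) * inner x (r x)"
      using positiveD(3)[OF Rr, of "T ?N ?y"] positiveD(3)[OF r, of x]
      by (intro mult_right_mono) (auto simp: blinfun.bilinear_simps inner_diff_right)
    also have "\<dots> = ?a * inner x (r x)" by (simp add: TRx inner_commute)
    finally have *: "?a * ?a \<le> inner x (r x) * ?a" by (simp add: power2_eq_square mult.commute)
    have "?a \<le> inner x (r x)"
    proof (cases "?a = 0")
      case True then show ?thesis using positiveD(3)[OF r, of x] by simp
    next
      case False
      then have "0 < ?a" using positiveD(3)[OF T, of ?y ?N] by simp
      then show ?thesis using * by (simp add: mult_le_cancel_right)
    qed
    then show ?thesis using gT rx by linarith
  qed
  show ?thesis using that[of r] t r bound by (simp add: r_def)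
qed

lemma n2_sq_le_tr:
  assumes "a \<in> M" "positive a" "norm a \<le> 1" shows "(n2 a)\<^sup>2 \<le> Re (tr a)"
proof -
  obtain h where h: "h \<in> M" "positive h" "h \<odot> h = a" using M_sqrt[OF assms(1,2)] .
  have hs: "h\<^sup>\<star> = h" by (rule positiveD[OF h(2)])
  have "positive (id_blinfun - a)" using positive_norm_minus[of a 1] assms positiveD[OF assms(2)] by simp
  then have "positive (h\<^sup>\<star> \<odot> (id_blinfun - a) \<odot> h)" using h by (intro positive_sandwich) auto
  then have "0 \<le> Re (tr (h\<^sup>\<star> \<odot> (id_blinfun - a) \<odot> h))" using h assms by (intro tr_positive) auto
  also have "h\<^sup>\<star> \<odot> (id_blinfun - a) \<odot> h = a - a \<odot> a" by (simp add: hs opsimps flip: h(3))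
  finally show ?thesis using assms positiveD(2)[OF assms(2)] by (simp add: tr_diff n2_sq ip_def)
qed

text \<open>For a sequence with rapidly decreasing increments \<open>h\<^sub>n\<close>, the cut-offs for the weighted
  squares \<open>4\<^sup>n h\<^sub>n\<^sup>\<star>h\<^sub>n\<close> make the increments summable in operator norm off
  sets of small trace. This gives a strong limit, which is then also a limit in the 2-norm.\<close>

lemma fast_cauchy_limit:
  assumes x: "\<And>n. x n \<in> M" "\<And>n. norm (x n) \<le> C"
    and fast: "\<And>n. n2 (x (Suc n) - x n) \<le> (1/4) ^ n"
  obtains y where "y \<in> M" "norm y \<le> C" "\<And>v. (\<lambda>n. blinfun_apply (x n) v) \<longlonglongrightarrow> blinfun_apply y v"
    "(\<lambda>n. n2 (x n - y)) \<longlonglongrightarrow> 0"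
proof -
  define h where "h n = x (Suc n) - x n" for n
  have hM: "h n \<in> M" for n by (simp add: h_def x)
  have C0: "0 \<le> C" using x(2)[of 0] norm_ge_zero order_trans by blast
  have "\<exists>r. r \<in> M \<and> positive r \<and> positive (id_blinfun - r) \<and> Re (tr (id_blinfun - r)) \<le> 2 * (1/4)^k \<and>
    (\<forall>n\<ge>k. \<forall>v. norm (blinfun_apply (h n) (blinfun_apply r v)) \<le> (1/2)^n * norm v)" for k
  proof -
    define g where "g n = 4 ^ (k + n) *\<^sub>R ((h (k + n))\<^sup>\<star> \<odot> h (k + n))" for n
    have gM: "g n \<in> M" for n using hM by (simp add: g_def)
    have gp: "positive (g n)" for n using hM by (auto simp: g_def intro!: positive_scaleR positive_adj_comp)
    have gtr: "Re (tr (g n)) \<le> (1/4) ^ k * (1/4) ^ n" for n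
    proof -
      have "Re (tr (g n)) = 4 ^ (k + n) * (n2 (h (k + n)))\<^sup>2"
        using hM by (simp add: g_def tr_scaleR n2_sq ip_def)
      also have "\<dots> \<le> 4 ^ (k + n) * ((1/4) ^ (k + n))\<^sup>2"
        using fast[of "k + n"] hM by (intro mult_left_mono power_mono) (auto simp: h_def x)
      also have "\<dots> = (1/4) ^ k * (1/4) ^ n"
        by (simp add: power2_eq_square power_add power_one_over field_simps)
      finally show ?thesis .
    qed
    have "(\<Sum>n<N. Re (tr (g n))) \<le> 2 * (1/4) ^ k" for N
    proof -
      have "(\<Sum>n<N. Re (tr (g n))) \<le> (\<Sum>n<N. (1/4) ^ k * (1/4) ^ n)" by (intro sum_mono gtr)
      also have "\<dots> = (1/4) ^ k * (\<Sum>n<N. (1/4::real) ^ n)" by (simp add: sum_distrib_left)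
      also have "(\<Sum>n<N. (1/4::real) ^ n) \<le> 2"
      proof -
        have "(\<Sum>n<N. (1/4::real) ^ n) = (1 - (1/4)^N) * (4/3)"
          using geometric_sum[of "1/4::real" N] by (simp add: field_simps)
        also have "\<dots> \<le> 1 * (4/3)" by (intro mult_right_mono) auto
        finally show ?thesis by simp
      qed
      finally show ?thesis by (simp add: mult.commute)
    qed
    then obtain r where r: "r \<in> M" "positive r" "positive (id_blinfun - r)" "Re (tr (id_blinfun - r)) \<le> 2 * (1/4)^k"
      and b: "\<And>n v. inner (blinfun_apply r v) (blinfun_apply (g n) (blinfun_apply r v)) \<le> (norm v)\<^sup>2"
      using resolvent_cutoff[of g "2 * (1/4)^k", OF gM gp] by metis
    have "norm (h n (r v)) \<le> (1/2)^n * norm v" if "k \<le> n" for n v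
    proof -
      have "4 ^ n * (norm (h n (r v)))\<^sup>2 \<le> (norm v)\<^sup>2"
        using b[of v "n - k"] that hM[of n]
        by (simp add: g_def blinfun.bilinear_simps adj_inner' power2_norm_eq_inner)
      moreover have four: "(4::real) ^ n = (2 ^ n)\<^sup>2" by (simp add: power2_eq_square flip: power_mult_distrib)
      ultimately have "(2 ^ n * norm (h n (r v)))\<^sup>2 \<le> (norm v)\<^sup>2"
        by (simp add: four power_mult_distrib)
      then have "2 ^ n * norm (h n (r v)) \<le> norm v" by (rule power2_le_imp_le) simp
      then show ?thesis by (simp add: field_simps power_one_over)
    qed
    then show ?thesis using r by blast
  qed
  then obtain r where r: "\<And>k. r k \<in> M" "\<And>k. positive (r k)" "\<And>k. positive (id_blinfun - r k)"
    "\<And>k. Re (tr (id_blinfun - r k)) \<le> 2 * (1/4)^k"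
    and b: "\<And>k n v. k \<le> n \<Longrightarrow> norm (blinfun_apply (h n) (blinfun_apply (r k) v)) \<le> (1/2)^n * norm v"
    by metis
  have tail: "norm (x n (r k v) - x m (r k v)) \<le> 2 * (1/2)^m * norm v - 2 * (1/2)^n * norm v"
    if "k \<le> m" "m \<le> n" for k m n v
    using that(2)
  proof (induction n rule: dec_induct)
    case (step n)
    have "x (Suc n) (r k v) - x m (r k v) = (x n (r k v) - x m (r k v)) + h n (r k v)"
      by (simp add: h_def blinfun.bilinear_simps)
    then have "norm (x (Suc n) (r k v) - x m (r k v)) \<le> norm (x n (r k v) - x m (r k v)) + norm (h n (r k v))"
      using norm_triangle_ineq by metis
    also have "norm (h n (r k v)) \<le> (1/2)^n * norm v" using b step.hyps that(1) by simp
    finally show ?case using step.IH by (simp add: algebra_simps)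
  qed simp
  have n2r: "n2 (id_blinfun - r k) \<le> 2 * (1/2)^k" for k
  proof (rule power2_le_imp_le)
    have "norm (id_blinfun - r k) \<le> 1" using positive_le_id_norm[OF r(3)[of k]] r(2) by simp
    then have "(n2 (id_blinfun - r k))\<^sup>2 \<le> 2 * (1/4)^k"
      using n2_sq_le_tr[of "id_blinfun - r k"] r(1,3) r(4)[of k] by fastforce
    also have "(1/4::real)^k = ((1/2)^k)\<^sup>2" by (simp add: power2_eq_square flip: power_mult_distrib)
    also have "2 * ((1/2::real)^k)\<^sup>2 \<le> (2 * (1/2)^k)\<^sup>2" unfolding power_mult_distrib by simp
    finally show "(n2 (id_blinfun - r k))\<^sup>2 \<le> (2 * (1/2)^k)\<^sup>2" .
  qed simp
  have half0: "(\<lambda>n. (1/2::real)^n) \<longlonglongrightarrow> 0" by (rule LIMSEQ_realpow_zero) auto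
  have conv: "convergent (\<lambda>n. x n (r k v))" for k v
  proof -
    have "Cauchy (\<lambda>n. x n (r k v))"
    proof (rule CauchyI')
      fix e :: real assume e: "0 < e"
      have "(\<lambda>n. 2 * (1/2::real)^n * norm v) \<longlonglongrightarrow> 2 * 0 * norm v" by (intro tendsto_intros half0)
      from LIMSEQ_D[OF this e] obtain N where "\<forall>n\<ge>N. norm (2 * (1/2::real)^n * norm v - 2 * 0 * norm v) < e"
        by blast
      then have N: "2 * (1/2::real)^n * norm v < e" if "n \<ge> N" for n using that by simp
      have "dist (x m (r k v)) (x n (r k v)) < e" if "m \<ge> max N k" "n > m" for m n
      proof -
        have "0 \<le> 2 * (1/2::real)^n * norm v" by simp
        moreover have "norm (x n (r k v) - x m (r k v)) \<le> 2 * (1/2)^m * norm v - 2 * (1/2)^n * norm v"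
          using that by (intro tail) auto
        moreover have "2 * (1/2::real)^m * norm v < e" using that by (intro N) auto
        ultimately have "norm (x n (r k v) - x m (r k v)) < e" by linarith
        then show ?thesis by (simp add: dist_norm norm_minus_commute)
      qed
      then show "\<exists>M. \<forall>m\<ge>M. \<forall>n>m. dist (x m (r k v)) (x n (r k v)) < e" by blast
    qed
    then show ?thesis by (rule Cauchy_convergent)
  qed
  \<comment> \<open>The projection onto the common kernel of the cut-offs is dominated by every \<open>1 - r k\<close>.\<close>
  have triv: "v = 0" if v: "\<And>s. s \<in> range r \<Longrightarrow> blinfun_apply (s\<^sup>\<star>) v = 0" for v
  proof -
    obtain p where p: "p \<in> M" "projection p" "\<And>v. blinfun_apply p v = v \<longleftrightarrow> (\<forall>a\<in>range r. blinfun_apply a v = 0)"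
      "\<And>a. a \<in> range r \<Longrightarrow> a \<odot> p = 0"
      by (rule kernel_projection[of "range r"]) (use r(1) in blast, rule that)
    have pk: "n2 p \<le> 2 * (1/2)^k" for k
    proof -
      have "r k \<odot> p = 0" using p(4) by blast
      then have "p = (id_blinfun - r k) \<odot> p" by (simp add: opsimps)
      moreover have "norm p \<le> 1"
        using positive_le_id_norm[of p] projectionD[OF p(2)] positive_adj_comp[of "id_blinfun - p"] by (simp add: opsimps)
      ultimately have "n2 p \<le> 1 * n2 (id_blinfun - r k)" 
        using n2_comp_right[of p "id_blinfun - r k" 1] p(1) r(1) by simp
      then show ?thesis using n2r[of k] by linarith
    qed
    have "(\<lambda>k. 2 * (1/2::real)^k) \<longlonglongrightarrow> 2 * 0" by (intro tendsto_intros half0)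
    then have "n2 p \<le> 2 * 0" by (rule LIMSEQ_le_const) (use pk in blast)
    then have "p = 0" using n2_eq_0[OF p(1)] n2_nonneg[OF p(1)] by linarith
    moreover have "r k v = 0" for k using v[of "r k"] positiveD(2)[OF r(2)[of k]] by simp
    then have "p v = v" by (simp add: p(3))
    ultimately show "v = 0" by simp
  qed
  have R: "range r \<subseteq> M" using r(1) by blast
  have conv': "convergent (\<lambda>n. x n (s v))" if "s \<in> range r" for s v using conv that by auto
  obtain y where y: "y \<in> M" "norm y \<le> C" "\<And>v. (\<lambda>n. x n v) \<longlonglongrightarrow> blinfun_apply y v"
    by (rule strong_limit_exists[of x C "range r", OF x R]) (erule conv', rule triv, blast, rule that)
  have bnd: "n2 (x k - y) \<le> (2 + 4 * C) * (1/2)^k" for k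
  proof -
    have "norm ((x k - y) \<odot> r k) \<le> 2 * (1/2)^k"
    proof (rule norm_blinfun_bound)
      fix v
      have "norm (y (r k v) - x k (r k v)) \<le> 2 * (1/2)^k * norm v"
      proof (rule LIMSEQ_le_const2)
        show "(\<lambda>n. norm (x n (r k v) - x k (r k v))) \<longlonglongrightarrow> norm (y (r k v) - x k (r k v))"
          by (intro tendsto_intros y)
        show "\<exists>N. \<forall>n\<ge>N. norm (x n (r k v) - x k (r k v)) \<le> 2 * (1/2)^k * norm v"
        proof (intro exI allI impI)
          fix n assume "k \<le> n"
          then have "norm (x n (r k v) - x k (r k v)) \<le> 2 * (1/2)^k * norm v - 2 * (1/2)^n * norm v"
            using tail by blast
          moreover have "0 \<le> 2 * (1/2)^n * norm v" by simp
          ultimately show "norm (x n (r k v) - x k (r k v)) \<le> 2 * (1/2)^k * norm v" by linarith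
        qed
      qed
      then show "norm (((x k - y) \<odot> r k) v) \<le> 2 * (1/2)^k * norm v"
        by (simp add: blinfun.bilinear_simps norm_minus_commute)
    qed simp
    then have 1: "n2 ((x k - y) \<odot> r k) \<le> 2 * (1/2)^k"
      using n2_le_norm[of "(x k - y) \<odot> r k"] x y r by fastforce
    have "norm (x k - y) \<le> 2 * C" using norm_triangle_ineq4[of "x k" y] x(2)[of k] y(2) by linarith
    then have "n2 ((x k - y) \<odot> (id_blinfun - r k)) \<le> 2 * C * n2 (id_blinfun - r k)"
      using x y r by (intro n2_comp_left) auto
    also have "\<dots> \<le> 2 * C * (2 * (1/2)^k)" using n2r C0 by (intro mult_left_mono) auto
    finally have 2: "n2 ((x k - y) \<odot> (id_blinfun - r k)) \<le> 4 * C * (1/2)^k" by simp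
    have "x k - y = (x k - y) \<odot> r k + (x k - y) \<odot> (id_blinfun - r k)" by (simp add: opsimps)
    then have "n2 (x k - y) \<le> n2 ((x k - y) \<odot> r k) + n2 ((x k - y) \<odot> (id_blinfun - r k))"
      using n2_triangle[of "(x k - y) \<odot> r k" "(x k - y) \<odot> (id_blinfun - r k)"] x y r by simp
    then show ?thesis using 1 2 by (simp add: algebra_simps)
  qed
  have "(\<lambda>k. (2 + 4 * C) * (1/2::real)^k) \<longlonglongrightarrow> (2 + 4 * C) * 0" by (intro tendsto_intros half0)
  then have g0: "(\<lambda>k. (2 + 4 * C) * (1/2::real)^k) \<longlonglongrightarrow> 0" by simp
  have "(\<lambda>n. n2 (x n - y)) \<longlonglongrightarrow> 0"
    by (rule seq_squeeze_zero[OF _ bnd g0]) (simp add: x y)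
  then show ?thesis by (rule that[OF y(1) y(2) y(3)])
qed

text \<open>Norm balls of \<open>M\<close> are complete for the 2-norm. The limit is also a strong limit
  along a subsequence, so that it inherits positivity.\<close>

lemma bounded_cauchy_limit:
  assumes x: "\<And>n. x n \<in> M" "\<And>n. norm (x n) \<le> C"
    and cauchy: "\<And>e. e > 0 \<Longrightarrow> \<exists>N. \<forall>m\<ge>N. \<forall>n\<ge>N. n2 (x m - x n) < e"
  obtains y where "y \<in> M" "norm y \<le> C" "(\<lambda>n. n2 (x n - y)) \<longlonglongrightarrow> 0"
    "(\<And>n. positive (x n)) \<Longrightarrow> positive y"
proof -
  have "\<forall>k. \<exists>N. \<forall>m\<ge>N. \<forall>n\<ge>N. n2 (x m - x n) < (1/4)^k" using cauchy by simp
  then obtain N where N: "\<And>k m n. m \<ge> N k \<Longrightarrow> n \<ge> N k \<Longrightarrow> n2 (x m - x n) < (1/4)^k" by metis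
  define f where "f k = (\<Sum>i\<le>k. N i)" for k
  have fN: "N k \<le> f k" for k by (simp add: f_def member_le_sum)
  have fS: "f k \<le> f (Suc k)" for k by (simp add: f_def)
  have fast: "n2 (x (f (Suc k)) - x (f k)) \<le> (1/4)^k" for k
    using N[of k "f (Suc k)" "f k"] fN[of k] fS[of k] by simp
  obtain y where y: "y \<in> M" "norm y \<le> C" "\<And>v. (\<lambda>n. blinfun_apply (x (f n)) v) \<longlonglongrightarrow> blinfun_apply y v"
    "(\<lambda>n. n2 (x (f n) - y)) \<longlonglongrightarrow> 0"
    using fast
    by (rule fast_cauchy_limit[of "\<lambda>n. x (f n)" C, OF x(1) x(2)]) (rule that)
  have "(\<lambda>n. n2 (x n - y)) \<longlonglongrightarrow> 0"
  proof (rule LIMSEQ_I)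
    fix e :: real assume e: "0 < e"
    have "(\<lambda>k. (1/4::real)^k) \<longlonglongrightarrow> 0" by (rule LIMSEQ_realpow_zero) auto
    then obtain k1 where k1: "\<And>k. k \<ge> k1 \<Longrightarrow> (1/4::real)^k < e/2" using e LIMSEQ_D[of _ 0 "e/2"] by fastforce
    obtain k2 where k2: "\<And>k. k \<ge> k2 \<Longrightarrow> n2 (x (f k) - y) < e/2"
      using LIMSEQ_D[OF y(4), of "e/2"] e by (auto simp: x y)
    let ?k = "max k1 k2"
    have "norm (n2 (x n - y) - 0) < e" if "n \<ge> N ?k" for n
    proof -
      have "n2 (x n - y) \<le> n2 (x n - x (f ?k)) + n2 (x (f ?k) - y)" using x y by (intro n2_triangle3)
      also have "\<dots> < e/2 + e/2" using N[of ?k n "f ?k"] that fN[of ?k] k1[of ?k] k2[of ?k] by (auto intro: order_less_le_trans)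
      finally show ?thesis using x y by simp
    qed
    then show "\<exists>no. \<forall>n\<ge>no. norm (n2 (x n - y) - 0) < e" by blast
  qed
  moreover have "positive y" if "\<And>n. positive (x n)" using strong_limit_positive[of "\<lambda>n. x (f n)", OF _ y(3)] that by blast
  ultimately show ?thesis by (rule that[OF y(1) y(2)])
qed

lemma n2_limit_unique:
  fixes x :: "nat \<Rightarrow> 'h operator"
  assumes "\<And>n. x n \<in> M" "y \<in> M" "z \<in> M" "(\<lambda>n. n2 (x n - y)) \<longlonglongrightarrow> 0" "(\<lambda>n. n2 (x n - z)) \<longlonglongrightarrow> 0"
  shows "y = z"
proof -
  have "(\<lambda>n. n2 (x n - y) + n2 (x n - z)) \<longlonglongrightarrow> 0 + 0" by (intro tendsto_intros assms)
  then have "n2 (y - z) \<le> 0 + 0"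
  proof (rule LIMSEQ_le_const, intro exI allI impI)
    fix n show "n2 (y - z) \<le> n2 (x n - y) + n2 (x n - z)"
    using n2_triangle3[of y "x n" z] n2_minus_commute[of y "x n"] assms by simp
  qed
  moreover have "0 \<le> n2 (y - z)" using assms by (intro n2_nonneg) simp
  ultimately have "n2 (y - z) = 0" by linarith
  then show ?thesis using n2_eq_0[of "y - z"] assms by simp
qed

lemma n2_limit_comp:
  fixes x y :: "nat \<Rightarrow> 'h operator"
  assumes "\<And>n. x n \<in> M" "\<And>n. y n \<in> M" "x' \<in> M" "y' \<in> M" "\<And>n. norm (x n) \<le> C"
    and lim: "(\<lambda>n. n2 (x n - x')) \<longlonglongrightarrow> 0" "(\<lambda>n. n2 (y n - y')) \<longlonglongrightarrow> 0"
  shows "(\<lambda>n. n2 (x n \<odot> y n - x' \<odot> y')) \<longlonglongrightarrow> 0"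
proof -
  have "(\<lambda>n. C * n2 (y n - y') + norm y' * n2 (x n - x')) \<longlonglongrightarrow> C * 0 + norm y' * 0"
    by (intro tendsto_intros lim)
  then have *: "(\<lambda>n. C * n2 (y n - y') + norm y' * n2 (x n - x')) \<longlonglongrightarrow> 0" by simp
  have "n2 (x n \<odot> y n - x' \<odot> y') \<le> C * n2 (y n - y') + norm y' * n2 (x n - x')" for n
  proof -
    have "x n \<odot> y n - x' \<odot> y' = x n \<odot> (y n - y') + (x n - x') \<odot> y'" by (simp add: opsimps)
    then have "n2 (x n \<odot> y n - x' \<odot> y') \<le> n2 (x n \<odot> (y n - y')) + n2 ((x n - x') \<odot> y')"
      using n2_triangle[of "x n \<odot> (y n - y')" "(x n - x') \<odot> y'"] assms by simp
    also have "\<dots> \<le> C * n2 (y n - y') + norm y' * n2 (x n - x')"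
      using assms by (intro add_mono n2_comp_left n2_comp_right) auto
    finally show ?thesis .
  qed
  then show ?thesis by (intro seq_squeeze_zero[OF _ _ *]) (simp_all add: assms)
qed

lemma n2_limit_adj:
  fixes x :: "nat \<Rightarrow> 'h operator"
  assumes "\<And>n. x n \<in> M" "x' \<in> M" "(\<lambda>n. n2 (x n - x')) \<longlonglongrightarrow> 0"
  shows "(\<lambda>n. n2 ((x n)\<^sup>\<star> - x'\<^sup>\<star>)) \<longlonglongrightarrow> 0"
proof -
  have "n2 ((x n)\<^sup>\<star> - x'\<^sup>\<star>) = n2 (x n - x')" for n using n2_adj[of "x n - x'"] assms by simp
  then show ?thesis using assms(3) by simp
qed

lemma tr_limit:
  fixes x :: "nat \<Rightarrow> 'h operator"
  assumes "\<And>n. x n \<in> M" "x' \<in> M" "(\<lambda>n. n2 (x n - x')) \<longlonglongrightarrow> 0"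
  shows "(\<lambda>n. tr (x n)) \<longlonglongrightarrow> tr x'"
proof -
  have "(\<lambda>n. 2 * n2 (x n - x')) \<longlonglongrightarrow> 2 * 0" by (intro tendsto_intros assms)
  moreover have "norm (tr (x n) - tr x') \<le> 2 * n2 (x n - x')" for n
    using tr_n2_bound[of "x n - x'" id_blinfun] assms by (simp add: opsimps tr_diff)
  ultimately have "(\<lambda>n. tr (x n) - tr x') \<longlonglongrightarrow> 0"
    by (intro Lim_null_comparison[of "\<lambda>n. tr (x n) - tr x'" "\<lambda>n. 2 * n2 (x n - x')" sequentially]) simp_all
  then show ?thesis by (simp add: LIM_zero_iff)
qed

end


section \<open>Maximal abelian subalgebras and conditional expectations\<close>

locale masa_in = tracial M tr
  for M :: "'h::chilbert_space operator set" and tr :: "'h operator \<Rightarrow> complex" +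
  fixes A :: "'h operator set"
  assumes masa: "masa A M"
begin

lemma A_star: "star_subalgebra A M" and A_abelian: "abelian A"
  using masa by (simp_all add: masa_def)

lemma A_M [simp]: "a \<in> A \<Longrightarrow> a \<in> M"
  using A_star by (auto simp: star_subalgebra_def)

lemma A_closed [simp]:
  "a \<in> A \<Longrightarrow> b \<in> A \<Longrightarrow> a + b \<in> A" "a \<in> A \<Longrightarrow> b \<in> A \<Longrightarrow> a \<odot> b \<in> A" "a \<in> A \<Longrightarrow> c *\<^sub>O a \<in> A"
  "a \<in> A \<Longrightarrow> a\<^sup>\<star> \<in> A" "0 \<in> A"
  using A_star by (auto simp: star_subalgebra_def)

lemma A_scaleR [simp]: "a \<in> A \<Longrightarrow> r *\<^sub>R a \<in> A"
  using A_closed(3)[of a "complex_of_real r"] by (simp add: scale_op_scaleR)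

lemma A_uminus [simp]: "a \<in> A \<Longrightarrow> - a \<in> A"
  using A_scaleR[of a "-1"] by simp

lemma A_diff [simp]: "a \<in> A \<Longrightarrow> b \<in> A \<Longrightarrow> a - b \<in> A"
  using A_closed(1)[of a "- b"] by simp

lemma A_commute: "a \<in> A \<Longrightarrow> b \<in> A \<Longrightarrow> a \<odot> b = b \<odot> a"
  using A_abelian by (simp add: abelian_def)

text \<open>The bicommutant of the masa and a self-adjoint element commuting with it is abelian, so
  maximality applies without describing the generated algebra.\<close>

lemma A_maximal_self_adjoint:
  assumes x: "x \<in> M" "x\<^sup>\<star> = x" and comm: "\<And>a. a \<in> A \<Longrightarrow> a \<odot> x = x \<odot> a"
  shows "x \<in> A"
proof -
  let ?S = "insert x A"
  define B where "B = commutant (commutant ?S)"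
  have SM: "?S \<subseteq> M" using x by auto
  have Sb: "?S \<subseteq> bounded_ops" using x by auto
  have Sadj: "s\<^sup>\<star> \<in> ?S" if "s \<in> ?S" for s using that x by auto
  have SS: "?S \<subseteq> commutant ?S" using Sb comm A_commute by (auto simp: commutant_def)
  have cb: "commutant ?S \<subseteq> bounded_ops" by (auto simp: commutant_def)
  have SB: "?S \<subseteq> B" using Sb by (auto simp: B_def commutant_def)
  have BM: "B \<subseteq> M"
    using commutant_antimono[OF commutant_antimono[OF SM]] M_bicommutant by (simp add: B_def)
  have "abelian B"
    unfolding abelian_def
  proof (intro ballI)
    fix a b assume ab: "a \<in> B" "b \<in> B"
    have "b \<in> commutant ?S" using commutant_antimono[OF SS] ab by (auto simp: B_def)
    moreover have "\<forall>c\<in>commutant ?S. c \<odot> a = a \<odot> c"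
      using ab(1) unfolding B_def commutant_def[of "commutant ?S"] by blast
    ultimately show "a \<odot> b = b \<odot> a" by simp
  qed
  moreover have "star_subalgebra B M"
    unfolding star_subalgebra_def
  proof (intro conjI ballI allI)
    show "b\<^sup>\<star> \<in> B" if "b \<in> B" for b
      using that unfolding B_def by (intro commutant_adj cb commutant_adj[OF Sb Sadj])
  qed (use BM commutant_closed[OF cb] in \<open>auto simp: B_def\<close>)
  ultimately have "B = A" using masa SB by (auto simp: masa_def)
  then show ?thesis using SB by blast
qed

lemma adj_commute_A:
  assumes x: "x \<in> M" and comm: "\<And>a. a \<in> A \<Longrightarrow> a \<odot> x = x \<odot> a" and a: "a \<in> A"
  shows "a \<odot> x\<^sup>\<star> = x\<^sup>\<star> \<odot> a"
proof -
  have "(a\<^sup>\<star> \<odot> x)\<^sup>\<star> = (x \<odot> a\<^sup>\<star>)\<^sup>\<star>" using comm[of "a\<^sup>\<star>"] a by simp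
  then show ?thesis using a x by simp
qed

lemma real_imag_parts:
  assumes x: "x \<in> M"
  defines "h \<equiv> (1/2) *\<^sub>R (x + x\<^sup>\<star>)" and "k \<equiv> (- \<i> / 2) *\<^sub>O (x - x\<^sup>\<star>)"
  shows "h \<in> M" "k \<in> M" "h\<^sup>\<star> = h" "k\<^sup>\<star> = k" "x = h + \<i> *\<^sub>O k"
proof -
  show "h \<in> M" "k \<in> M" "h\<^sup>\<star> = h" using x by (simp_all add: h_def k_def add.commute)
  show "k\<^sup>\<star> = k"
    using x by (simp add: k_def scale_op_linear)
  have "\<i> *\<^sub>O k = (1/2) *\<^sub>R (x - x\<^sup>\<star>)"
    using scale_op_scaleR[of "1/2" "x - x\<^sup>\<star>"] by (simp add: k_def scale_op_scale_op)
  then have "h + \<i> *\<^sub>O k = (1/2) *\<^sub>R ((x + x\<^sup>\<star>) + (x - x\<^sup>\<star>))" by (simp only: h_def scaleR_add_right)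
  also have "\<dots> = x" by simp
  finally show "x = h + \<i> *\<^sub>O k" ..
qed

text \<open>A masa is its own relative commutant.\<close>

lemma A_maximal:
  assumes x: "x \<in> M" and comm: "\<And>a. a \<in> A \<Longrightarrow> a \<odot> x = x \<odot> a"
  shows "x \<in> A"
proof -
  note parts = real_imag_parts[OF x]
  have "(1/2) *\<^sub>R (x + x\<^sup>\<star>) \<in> A"
    using parts(1,3) comm adj_commute_A[OF x comm] x by (intro A_maximal_self_adjoint) (auto simp: opsimps)
  moreover have "(- \<i> / 2) *\<^sub>O (x - x\<^sup>\<star>) \<in> A"
    using parts(2,4) comm adj_commute_A[OF x comm] x by (intro A_maximal_self_adjoint) (auto simp: opsimps)
  ultimately show ?thesis by (subst parts(5)) simp
qed

lemma A_id [simp]: "id_blinfun \<in> A"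
  by (rule A_maximal) (auto simp: opsimps)

lemma A_bicommutant:
  assumes "k \<in> A" "h \<in> commutant (commutant {k})" shows "h \<in> A"
proof (rule A_maximal)
  show "h \<in> M" using M_bicommutant_subset[of k] assms by auto
  show "a \<odot> h = h \<odot> a" if "a \<in> A" for a
    using bicommutant_commutes[OF assms(2), of a] A_commute[OF that assms(1)] that by simp
qed

lemma A_sqrt:
  assumes "k \<in> A" "positive k"
  obtains h where "h \<in> A" "positive h" "h \<odot> h = k"
  using positive_sqrt[OF assms(2)] A_bicommutant[OF assms(1)] by blast

text \<open>A self-adjoint contraction \<open>a\<close> is the real part of the unitary
  \<open>a + \<i> \<surd>(1 - a\<^sup>2)\<close>, so that the unitaries span the masa.\<close>

lemma commutes_if_commutes_unitaries:
  assumes y: "y \<in> M" and comm: "\<And>w. w \<in> A \<Longrightarrow> unitary w \<Longrightarrow> w \<odot> y = y \<odot> w" and a: "a \<in> A"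
  shows "a \<odot> y = y \<odot> a"
proof -
  have contr: "a \<odot> y = y \<odot> a" if a: "a \<in> A" "a\<^sup>\<star> = a" "norm a \<le> 1" for a
  proof -
    have "norm (a \<odot> a) \<le> 1 * 1" using a by (intro norm_comp_le)
    then have pos: "positive (id_blinfun - a \<odot> a)"
      using positive_norm_minus[of "a \<odot> a" 1] a by simp
    obtain h where h: "h \<in> A" "positive h" "h \<odot> h = id_blinfun - a \<odot> a"
      using A_sqrt[OF _ pos] a by auto
    have hs: "h\<^sup>\<star> = h" and ha: "h \<odot> a = a \<odot> h" using positiveD(2)[OF h(2)] A_commute a h by auto
    have u: "unitary (a + c *\<^sub>O h)" if "cnj c = - c" "c * c = -1" for c
    proof -
      have *: "(a + c *\<^sub>O h)\<^sup>\<star> = a - c *\<^sub>O h" using a h hs that by (simp add: scale_op_linear)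
      have cc: "c *\<^sub>O c *\<^sub>O b = - b" for b :: "'h operator"
        using that scale_op_linear(4)[of 1 b] by (simp add: scale_op_scale_op)
      show ?thesis using a h ha
        by (simp add: unitary_def * comp_distribs scale_op_comp comp_scale_op cc)
    qed
    have "(a + \<i> *\<^sub>O h) \<odot> y = y \<odot> (a + \<i> *\<^sub>O h)" "(a + (-\<i>) *\<^sub>O h) \<odot> y = y \<odot> (a + (-\<i>) *\<^sub>O h)"
      using a h by (auto intro!: comm u)
    then have "((a + \<i> *\<^sub>O h) + (a + (-\<i>) *\<^sub>O h)) \<odot> y = y \<odot> ((a + \<i> *\<^sub>O h) + (a + (-\<i>) *\<^sub>O h))"
      by (simp only: comp_distribs)
    moreover have "(a + \<i> *\<^sub>O h) + (a + (-\<i>) *\<^sub>O h) = 2 *\<^sub>R a" by (simp add: scale_op_linear scaleR_2)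
    ultimately show ?thesis by (simp add: comp_distribs)
  qed
  have sa: "a \<odot> y = y \<odot> a" if a: "a \<in> A" "a\<^sup>\<star> = a" for a
  proof -
    let ?r = "1 / (norm a + 1)"
    have r: "?r > 0" by (simp add: add_nonneg_pos)
    have "0 < norm a + 1" by (simp add: add_nonneg_pos)
    then have n: "norm (?r *\<^sub>R a) \<le> 1" by (simp add: divide_le_eq_1)
    have "(?r *\<^sub>R a) \<odot> y = y \<odot> (?r *\<^sub>R a)" by (rule contr) (use a n in auto)
    then have "?r *\<^sub>R (a \<odot> y) = ?r *\<^sub>R (y \<odot> a)" by (simp only: comp_distribs)
    then show ?thesis using r by (simp only: scaleR_cancel_left) simp
  qed
  have aM: "a \<in> M" using a by simp
  have "a = (1/2) *\<^sub>R (a + a\<^sup>\<star>) + \<i> *\<^sub>O ((- \<i> / 2) *\<^sub>O (a - a\<^sup>\<star>))" by (rule real_imag_parts(5)[OF aM])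
  moreover have "((1/2) *\<^sub>R (a + a\<^sup>\<star>)) \<odot> y = y \<odot> ((1/2) *\<^sub>R (a + a\<^sup>\<star>))"
    using real_imag_parts(3)[OF aM] a by (intro sa) auto
  moreover have "((- \<i> / 2) *\<^sub>O (a - a\<^sup>\<star>)) \<odot> y = y \<odot> ((- \<i> / 2) *\<^sub>O (a - a\<^sup>\<star>))"
    using real_imag_parts(4)[OF aM] a by (intro sa) auto
  moreover have "(h + \<i> *\<^sub>O k) \<odot> y = y \<odot> (h + \<i> *\<^sub>O k)" if "h \<odot> y = y \<odot> h" "k \<odot> y = y \<odot> k" for h k
    using that y by (simp add: comp_distribs scale_op_comp comp_scale_op)
  ultimately show ?thesis by metis
qed

text \<open>The convex hull of the orbit of \<open>x\<close> under conjugation by unitaries of the masa.\<close>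

definition orbit_hull :: "'h operator \<Rightarrow> 'h operator set" where
  "orbit_hull x = convex hull {w \<odot> x \<odot> w\<^sup>\<star> | w. w \<in> A \<and> unitary w}"

lemma orbit_hull_subset:
  assumes "convex S" "\<And>w. w \<in> A \<Longrightarrow> unitary w \<Longrightarrow> w \<odot> x \<odot> w\<^sup>\<star> \<in> S"
  shows "orbit_hull x \<subseteq> S"
  unfolding orbit_hull_def using assms by (intro hull_minimal) auto

lemma unitary_norm: "w \<in> M \<Longrightarrow> unitary w \<Longrightarrow> norm w \<le> 1"
proof (rule norm_blinfun_bound)
  fix v assume w: "w \<in> M" "unitary w"
  have "(norm (w v))\<^sup>2 = inner v ((w\<^sup>\<star> \<odot> w) v)" using w(1) by (simp add: adj_inner' power2_norm_eq_inner)
  also have "w\<^sup>\<star> \<odot> w = id_blinfun" using w(2) by (simp add: unitary_def)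
  finally have "(norm (w v))\<^sup>2 = (norm v)\<^sup>2" by (simp add: power2_norm_eq_inner)
  then show "norm (w v) \<le> 1 * norm v" by (simp add: power2_eq_iff_nonneg)
qed simp

lemma unitary_adj: "w \<in> M \<Longrightarrow> unitary w \<Longrightarrow> unitary (w\<^sup>\<star>)"
  by (simp add: unitary_def)

lemma unitary_comp: "v \<in> M \<Longrightarrow> w \<in> M \<Longrightarrow> unitary v \<Longrightarrow> unitary w \<Longrightarrow> unitary (v \<odot> w)"
proof -
  assume *: "v \<in> M" "w \<in> M" "unitary v" "unitary w"
  have "w\<^sup>\<star> \<odot> ((v\<^sup>\<star> \<odot> v) \<odot> w) = id_blinfun" "v \<odot> ((w \<odot> w\<^sup>\<star>) \<odot> v\<^sup>\<star>) = id_blinfun"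
    using * by (simp_all only: unitary_def comp_distribs)
  then show ?thesis using * by (simp add: unitary_def comp_assoc)
qed

lemma orbit_hull_bound:
  assumes x: "x \<in> M" shows "orbit_hull x \<subseteq> {y \<in> M. norm y \<le> norm x}"
proof (rule orbit_hull_subset)
  have "{y \<in> M. norm y \<le> norm x} = M \<inter> cball 0 (norm x)" by auto
  moreover have "convex M" by (auto simp: convex_def)
  ultimately show "convex {y \<in> M. norm y \<le> norm x}" by (simp add: convex_Int)
  fix w assume w: "w \<in> A" "unitary w"
  have "norm (w \<odot> x \<odot> w\<^sup>\<star>) \<le> 1 * norm x * 1"
    using unitary_norm[of w] unitary_norm[of "w\<^sup>\<star>"] w by (intro norm_comp_le) (auto intro: unitary_adj)
  then show "w \<odot> x \<odot> w\<^sup>\<star> \<in> {y \<in> M. norm y \<le> norm x}" using w x by simp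
qed

lemma orbit_hull_conj:
  assumes x: "x \<in> M" and w: "w \<in> A" "unitary w" and c: "c \<in> orbit_hull x"
  shows "w \<odot> c \<odot> w\<^sup>\<star> \<in> orbit_hull x"
proof -
  have "orbit_hull x \<subseteq> {c. w \<odot> c \<odot> w\<^sup>\<star> \<in> orbit_hull x}"
  proof (rule orbit_hull_subset)
    have "convex (orbit_hull x)" by (simp add: orbit_hull_def convex_convex_hull)
    then show "convex {c. w \<odot> c \<odot> w\<^sup>\<star> \<in> orbit_hull x}"
      by (auto simp: convex_def comp_distribs)
    fix v assume v: "v \<in> A" "unitary v"
    have "w \<odot> (v \<odot> x \<odot> v\<^sup>\<star>) \<odot> w\<^sup>\<star> = (w \<odot> v) \<odot> x \<odot> (w \<odot> v)\<^sup>\<star>" using v w by (simp add: comp_assoc)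
    moreover have "(w \<odot> v) \<odot> x \<odot> (w \<odot> v)\<^sup>\<star> \<in> orbit_hull x"
      unfolding orbit_hull_def
    proof (rule hull_inc)
      show "(w \<odot> v) \<odot> x \<odot> (w \<odot> v)\<^sup>\<star> \<in> {w \<odot> x \<odot> w\<^sup>\<star> | w. w \<in> A \<and> unitary w}"
      using v w unitary_comp[of w v] by (intro CollectI exI[of _ "w \<odot> v"] conjI) simp_all
    qed
    ultimately show "v \<odot> x \<odot> v\<^sup>\<star> \<in> {c. w \<odot> c \<odot> w\<^sup>\<star> \<in> orbit_hull x}" by simp
  qed
  then show ?thesis using c by blast
qed

lemma orbit_hull_tr:
  assumes x: "x \<in> M" and c: "c \<in> orbit_hull x" and a: "a \<in> A"
  shows "tr (c \<odot> a) = tr (x \<odot> a)"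
proof -
  have "orbit_hull x \<subseteq> {c \<in> M. tr (c \<odot> a) = tr (x \<odot> a)}"
  proof (rule orbit_hull_subset)
    show "convex {c \<in> M. tr (c \<odot> a) = tr (x \<odot> a)}"
      using a by (auto simp: convex_def comp_distribs tr_add tr_scaleR simp flip: distrib_right of_real_add)
    fix w assume w: "w \<in> A" "unitary w"
    have "tr (w \<odot> x \<odot> w\<^sup>\<star> \<odot> a) = tr (w \<odot> (x \<odot> w\<^sup>\<star> \<odot> a))" by (simp add: comp_assoc)
    also have "\<dots> = tr ((x \<odot> w\<^sup>\<star> \<odot> a) \<odot> w)" using x w a by (intro tr_commute) auto
    also have "(x \<odot> w\<^sup>\<star> \<odot> a) \<odot> w = x \<odot> a \<odot> (w\<^sup>\<star> \<odot> w)" using A_commute[of "w\<^sup>\<star>" a] w a by (simp add: comp_assoc)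
    also have "\<dots> = x \<odot> a" using w by (simp only: unitary_def comp_distribs)
    finally show "w \<odot> x \<odot> w\<^sup>\<star> \<in> {c \<in> M. tr (c \<odot> a) = tr (x \<odot> a)}" using w x by simp
  qed
  then show ?thesis using c by blast
qed

lemma n2_parallelogram:
  assumes "x \<in> M" "y \<in> M"
  shows "(n2 (x - y))\<^sup>2 + (n2 (x + y))\<^sup>2 = 2 * (n2 x)\<^sup>2 + 2 * (n2 y)\<^sup>2"
  using assms by (simp add: n2_sq ip_add_left ip_add_right ip_diff_left ip_diff_right)

text \<open>The element of minimal 2-norm in the 2-norm closure of the orbit hull is fixed by the
  unitaries of the masa and hence lies in the masa.\<close>

lemma orbit_hull_average:
  assumes x: "x \<in> M"
  shows "\<exists>y\<in>A. norm y \<le> norm x \<and> (positive x \<longrightarrow> positive y) \<and>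
    (\<exists>c. (\<forall>n. c n \<in> orbit_hull x) \<and> (\<lambda>n. n2 (c n - y)) \<longlonglongrightarrow> 0)"
proof -
  let ?C = "orbit_hull x"
  define Q where "Q c = (n2 c)\<^sup>2" for c
  define d where "d = (INF c\<in>?C. Q c)"
  have CM: "\<And>c. c \<in> ?C \<Longrightarrow> c \<in> M" and Cn: "\<And>c. c \<in> ?C \<Longrightarrow> norm c \<le> norm x"
    using orbit_hull_bound[OF x] by auto
  have conv: "convex ?C" by (simp add: orbit_hull_def convex_convex_hull)
  have ne: "?C \<noteq> {}"
  proof -
    have "unitary (id_blinfun :: 'h operator)" by (simp add: unitary_def comp_distribs)
    then have "{w \<odot> x \<odot> w\<^sup>\<star> | w. w \<in> A \<and> unitary w} \<noteq> {}" using A_id by blast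
    then show ?thesis by (simp add: orbit_hull_def)
  qed
  have bdd: "bdd_below (Q ` ?C)" by (rule bdd_belowI[of _ 0]) (auto simp: Q_def)
  have dle: "d \<le> Q c" if "c \<in> ?C" for c unfolding d_def using bdd that by (rule cINF_lower)
  have "\<exists>c\<in>?C. Q c < d + inverse (real (Suc n))" for n
    using cINF_less_iff[OF ne bdd, of "d + inverse (real (Suc n))"] unfolding d_def[symmetric] by simp
  then obtain c where cC: "\<And>n. c n \<in> ?C" and cd: "\<And>n. Q (c n) < d + inverse (real (Suc n))" by metis
  have inc: "Q (a - b) \<le> 2 * e + 2 * e'" if "a \<in> ?C" "b \<in> ?C" "Q a \<le> d + e" "Q b \<le> d + e'" for a b e e'
  proof (rule minimizing_increment[of Q a b d e e', OF _ _ _ that(3,4)])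
    show "Q (a - b) + Q (a + b) = 2 * Q a + 2 * Q b" unfolding Q_def using that CM by (intro n2_parallelogram) auto
    show "Q (a + b) = 4 * Q ((1 / 2) *\<^sub>R (a + b))" using that CM by (simp add: Q_def n2_scaleR power_divide)
    have "(1/2) *\<^sub>R a + (1/2) *\<^sub>R b \<in> ?C" using conv that by (intro convexD) auto
    then show "d \<le> Q ((1 / 2) *\<^sub>R (a + b))" using dle by (simp add: scaleR_add_right)
  qed
  have small: "n2 z < e" if "z \<in> M" "Q z < e\<^sup>2" "0 < e" for z e
    by (rule power_less_imp_less_base[of _ 2]) (use that in \<open>auto simp: Q_def\<close>)
  obtain y where y: "y \<in> M" "norm y \<le> norm x" "(\<lambda>n. n2 (c n - y)) \<longlonglongrightarrow> 0"
    "(\<And>n. positive (c n)) \<Longrightarrow> positive y"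
  proof (rule bounded_cauchy_limit[of c "norm x"])
    show "c n \<in> M" "norm (c n) \<le> norm x" for n using cC CM Cn by auto
    fix e :: real assume e: "0 < e"
    obtain N where N: "inverse (real (Suc N)) < e\<^sup>2 / 4" using reals_Archimedean[of "e\<^sup>2/4"] e by auto
    have "n2 (c m - c n) < e" if "m \<ge> N" "n \<ge> N" for m n
    proof (rule small)
      have "inverse (real (Suc m)) \<le> inverse (real (Suc N))" "inverse (real (Suc n)) \<le> inverse (real (Suc N))"
        using that by (auto intro!: le_imp_inverse_le)
      moreover have "Q (c m - c n) \<le> 2 * inverse (real (Suc m)) + 2 * inverse (real (Suc n))"
        using cC cd less_imp_le by (intro inc) blast+
      ultimately show "Q (c m - c n) < e\<^sup>2" using N by linarith
    qed (use cC CM e in auto)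
    then show "\<exists>N. \<forall>m\<ge>N. \<forall>n\<ge>N. n2 (c m - c n) < e" by blast
  qed (rule that, assumption, assumption, assumption, blast)
  have inv0: "(\<lambda>n. inverse (real (Suc n))) \<longlonglongrightarrow> 0" by (rule LIMSEQ_inverse_real_of_nat)
  have "w \<odot> y = y \<odot> w" if w: "w \<in> A" "unitary w" for w
  proof -
    let ?z = "\<lambda>n. w \<odot> c n \<odot> w\<^sup>\<star>"
    have zC: "?z n \<in> ?C" for n using orbit_hull_conj[OF x w cC] .
    have wM: "w \<in> M" "w\<^sup>\<star> \<in> M" "unitary (w\<^sup>\<star>)" using w unitary_adj by auto
    have wn: "n2 (w \<odot> b \<odot> w\<^sup>\<star>) = n2 b" if "b \<in> M" for b
      using n2_unitary_left[of w "b \<odot> w\<^sup>\<star>"] n2_unitary_right[of "w\<^sup>\<star>" b] wM w that by (simp add: comp_assoc)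
    have qb: "Q (c n - ?z n) \<le> 4 * inverse (real (Suc n))" for n
    proof -
      have "Q (?z n) = Q (c n)" using wn cC CM by (simp add: Q_def)
      then show ?thesis using inc[OF cC zC, of n "inverse (real (Suc n))" n "inverse (real (Suc n))"] cd[of n] by simp
    qed
    have q0: "(\<lambda>n. 4 * inverse (real (Suc n))) \<longlonglongrightarrow> 0" using tendsto_mult_left[OF inv0, of 4] by simp
    have "(\<lambda>n. Q (c n - ?z n)) \<longlonglongrightarrow> 0"
      by (rule seq_squeeze_zero[OF _ qb q0]) (simp add: Q_def)
    then have "(\<lambda>n. sqrt (Q (c n - ?z n))) \<longlonglongrightarrow> sqrt 0" by (intro tendsto_real_sqrt)
    then have 1: "(\<lambda>n. n2 (c n - ?z n)) \<longlonglongrightarrow> 0" using cC zC CM by (simp add: Q_def)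
    have bnd: "n2 (c n - w \<odot> y \<odot> w\<^sup>\<star>) \<le> n2 (c n - ?z n) + n2 (c n - y)" for n
    proof -
      have "n2 (c n - w \<odot> y \<odot> w\<^sup>\<star>) \<le> n2 (c n - ?z n) + n2 (?z n - w \<odot> y \<odot> w\<^sup>\<star>)"
        using cC zC CM y wM by (intro n2_triangle3) auto
      also have "?z n - w \<odot> y \<odot> w\<^sup>\<star> = w \<odot> (c n - y) \<odot> w\<^sup>\<star>" by (simp add: comp_distribs)
      also have "n2 \<dots> = n2 (c n - y)" using cC CM y by (intro wn) auto
      finally show ?thesis .
    qed
    have s0: "(\<lambda>n. n2 (c n - ?z n) + n2 (c n - y)) \<longlonglongrightarrow> 0" using tendsto_add[OF 1 y(3)] by simp
    have lim: "(\<lambda>n. n2 (c n - w \<odot> y \<odot> w\<^sup>\<star>)) \<longlonglongrightarrow> 0"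
      by (rule seq_squeeze_zero[OF _ bnd s0]) (use cC CM y wM in auto)
    have eq: "y = w \<odot> y \<odot> w\<^sup>\<star>"
      by (rule n2_limit_unique[OF _ _ _ y(3) lim]) (use cC CM y wM in auto)
    have "y \<odot> w = (w \<odot> y \<odot> w\<^sup>\<star>) \<odot> w" using eq by simp
    also have "\<dots> = w \<odot> y \<odot> (w\<^sup>\<star> \<odot> w)" by (simp only: comp_assoc)
    also have "\<dots> = w \<odot> y" using w by (simp only: unitary_def comp_distribs)
    finally show ?thesis by simp
  qed
  then have "y \<in> A" using A_maximal[OF y(1)] commutes_if_commutes_unitaries[OF y(1)] by blast
  moreover have "positive y" if "positive x"
  proof (rule y(4))
    have "?C \<subseteq> {c. positive c}"
    proof (rule orbit_hull_subset)
      show "convex {c. positive (c::'h operator)}" by (auto simp: convex_def intro!: positive_add positive_scaleR)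
      show "w \<odot> x \<odot> w\<^sup>\<star> \<in> {c. positive c}" if "w \<in> A" for w
        using positive_sandwich[OF \<open>positive x\<close>, of "w\<^sup>\<star>"] that by simp
    qed
    then show "positive (c n)" for n using cC by blast
  qed
  ultimately show ?thesis using y cC by blast
qed

text \<open>An element of the masa is determined by its traces against the masa.\<close>

lemma A_eqI:
  assumes "y \<in> A" "z \<in> A" "\<And>a. a \<in> A \<Longrightarrow> tr (y \<odot> a) = tr (z \<odot> a)"
  shows "y = z"
proof -
  have "tr ((y - z) \<odot> (y - z)\<^sup>\<star>) = 0"
    using assms(3)[of "(y - z)\<^sup>\<star>"] assms by (simp add: comp_distribs tr_diff)
  then have "tr ((y - z)\<^sup>\<star> \<odot> (y - z)) = 0" using tr_commute[of "y - z" "(y - z)\<^sup>\<star>"] assms(1,2) by simp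
  then show ?thesis using tr_faithful[of "y - z"] assms by simp
qed

lemma average_exists:
  assumes x: "x \<in> M"
  shows "\<exists>y\<in>A. norm y \<le> norm x \<and> (positive x \<longrightarrow> positive y) \<and> (\<forall>a\<in>A. tr (y \<odot> a) = tr (x \<odot> a)) \<and>
    (\<exists>c. (\<forall>n. c n \<in> orbit_hull x) \<and> (\<lambda>n. n2 (c n - y)) \<longlonglongrightarrow> 0)"
proof -
  obtain y c where y: "y \<in> A" "norm y \<le> norm x" "positive x \<longrightarrow> positive y"
    and c: "\<And>n. c n \<in> orbit_hull x" "(\<lambda>n. n2 (c n - y)) \<longlonglongrightarrow> 0"
    using orbit_hull_average[OF x] by blast
  have cM: "c n \<in> M" "norm (c n) \<le> norm x" for n using c(1)[of n] orbit_hull_bound[OF x] by auto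
  have "tr (y \<odot> a) = tr (x \<odot> a)" if a: "a \<in> A" for a
  proof -
    have "(\<lambda>n. n2 (c n \<odot> a - y \<odot> a)) \<longlonglongrightarrow> 0"
      by (rule n2_limit_comp[where C = "norm x"]) (use cM y a c(2) in auto)
    then have "(\<lambda>n. tr (c n \<odot> a)) \<longlonglongrightarrow> tr (y \<odot> a)" using cM y a by (intro tr_limit) auto
    moreover have "tr (c n \<odot> a) = tr (x \<odot> a)" for n using orbit_hull_tr[OF x c(1) a] .
    ultimately have "(\<lambda>n. tr (x \<odot> a)) \<longlonglongrightarrow> tr (y \<odot> a)" by simp
    then show ?thesis by (rule LIMSEQ_unique[OF tendsto_const, symmetric])
  qed
  then show ?thesis using y c by blast
qed

lemma is_cond_exp_exists: "\<exists>E. is_cond_exp M tr A E"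
proof -
  have "\<forall>x. \<exists>y. x \<in> M \<longrightarrow> y \<in> A \<and> (positive x \<longrightarrow> positive y) \<and> (\<forall>a\<in>A. tr (y \<odot> a) = tr (x \<odot> a))"
    using average_exists by blast
  then obtain E where E: "\<And>x. x \<in> M \<Longrightarrow> E x \<in> A" "\<And>x. x \<in> M \<Longrightarrow> positive x \<Longrightarrow> positive (E x)"
    "\<And>x a. x \<in> M \<Longrightarrow> a \<in> A \<Longrightarrow> tr (E x \<odot> a) = tr (x \<odot> a)" by metis
  have uniq: "E x = y" if "x \<in> M" "y \<in> A" "\<And>a. a \<in> A \<Longrightarrow> tr (y \<odot> a) = tr (x \<odot> a)" for x y
    using that E by (intro A_eqI) auto
  have "is_cond_exp M tr A E"
    unfolding is_cond_exp_def
  proof (intro conjI ballI allI impI)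
    fix x y assume "x \<in> M" "y \<in> M"
    then show "E (x + y) = E x + E y"
      by (intro uniq) (auto simp: E comp_distribs tr_add)
  next
    fix x c assume "x \<in> M"
    then show "E (c *\<^sub>O x) = c *\<^sub>O E x"
      by (intro uniq) (auto simp: E scale_op_comp tr_scale)
  next
    fix x assume "x \<in> M" "pos_op x"
    then show "pos_op (E x)" using E(2)[of x] by (simp add: positive_def)
  next
    fix a assume "a \<in> A" then show "E a = a" by (intro uniq) auto
  next
    fix a x b assume *: "a \<in> A" "x \<in> M" "b \<in> A"
    show "E (a \<odot> x \<odot> b) = a \<odot> E x \<odot> b"
    proof (rule uniq)
      fix c assume c: "c \<in> A"
      have "tr (a \<odot> E x \<odot> b \<odot> c) = tr (a \<odot> (E x \<odot> (b \<odot> c)))" by (simp only: comp_assoc)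
      also have "\<dots> = tr ((E x \<odot> (b \<odot> c)) \<odot> a)" using * c E by (intro tr_commute) auto
      also have "\<dots> = tr (E x \<odot> (b \<odot> c \<odot> a))" by (simp only: comp_assoc)
      also have "\<dots> = tr (x \<odot> (b \<odot> c \<odot> a))" using * c by (intro E) auto
      also have "\<dots> = tr ((x \<odot> (b \<odot> c)) \<odot> a)" by (simp only: comp_assoc)
      also have "\<dots> = tr (a \<odot> (x \<odot> (b \<odot> c)))" using * c by (intro tr_commute) auto
      also have "\<dots> = tr (a \<odot> x \<odot> b \<odot> c)" by (simp only: comp_assoc)
      finally show "tr (a \<odot> E x \<odot> b \<odot> c) = tr (a \<odot> x \<odot> b \<odot> c)" .
    qed (use * E in auto)
  next
    fix x assume "x \<in> M" then show "tr (E x) = tr x" using E(3)[of x id_blinfun] by (simp add: comp_distribs)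
  qed (use E in auto)
  then show ?thesis by blast
qed

abbreviation E :: "'h operator \<Rightarrow> 'h operator" where "E \<equiv> cond_exp M tr A"

lemma is_cond_exp_E: "is_cond_exp M tr A E"
  unfolding cond_exp_def using is_cond_exp_exists by (rule someI_ex[of "is_cond_exp M tr A"])

lemma E_A [simp]: "x \<in> M \<Longrightarrow> E x \<in> A"
  and E_add: "x \<in> M \<Longrightarrow> y \<in> M \<Longrightarrow> E (x + y) = E x + E y"
  and E_scale: "x \<in> M \<Longrightarrow> E (c *\<^sub>O x) = c *\<^sub>O E x"
  and E_id: "a \<in> A \<Longrightarrow> E a = a"
  and E_bimodule: "a \<in> A \<Longrightarrow> x \<in> M \<Longrightarrow> b \<in> A \<Longrightarrow> E (a \<odot> x \<odot> b) = a \<odot> E x \<odot> b"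
  and tr_E: "x \<in> M \<Longrightarrow> tr (E x) = tr x"
  using is_cond_exp_E unfolding is_cond_exp_def by blast+

lemma E_left: "a \<in> A \<Longrightarrow> x \<in> M \<Longrightarrow> E (a \<odot> x) = a \<odot> E x"
  using E_bimodule[of a x id_blinfun] by (simp add: comp_distribs)

lemma E_right: "a \<in> A \<Longrightarrow> x \<in> M \<Longrightarrow> E (x \<odot> a) = E x \<odot> a"
  using E_bimodule[of id_blinfun x a] by (simp add: comp_distribs)

lemma E_diff: "x \<in> M \<Longrightarrow> y \<in> M \<Longrightarrow> E (x - y) = E x - E y"
  using E_add[of "x - y" y] by simp

lemma tr_E_right: "x \<in> M \<Longrightarrow> a \<in> A \<Longrightarrow> tr (E x \<odot> a) = tr (x \<odot> a)"
  using E_right[of a x] tr_E[of "x \<odot> a"] by simp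

lemma E_unique:
  assumes "x \<in> M" "y \<in> A" "\<And>a. a \<in> A \<Longrightarrow> tr (y \<odot> a) = tr (x \<odot> a)" shows "E x = y"
  using assms tr_E_right by (intro A_eqI) auto

lemma E_average:
  assumes x: "x \<in> M"
  shows "norm (E x) \<le> norm x" "\<exists>c. (\<forall>n. c n \<in> orbit_hull x) \<and> (\<lambda>n. n2 (c n - E x)) \<longlonglongrightarrow> 0"
proof -
  obtain y where y: "y \<in> A" "norm y \<le> norm x" "\<And>a. a \<in> A \<Longrightarrow> tr (y \<odot> a) = tr (x \<odot> a)"
    "\<exists>c. (\<forall>n. c n \<in> orbit_hull x) \<and> (\<lambda>n. n2 (c n - y)) \<longlonglongrightarrow> 0"
    using average_exists[OF x] by blast
  moreover have "E x = y" by (rule E_unique[OF x y(1,3)])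
  ultimately show "norm (E x) \<le> norm x" "\<exists>c. (\<forall>n. c n \<in> orbit_hull x) \<and> (\<lambda>n. n2 (c n - E x)) \<longlonglongrightarrow> 0"
    by simp_all
qed

text \<open>On the Hilbert space of the trace, \<open>E\<close> is the orthogonal projection onto the masa.\<close>

lemma E_pythagoras:
  assumes x: "x \<in> M" and a: "a \<in> A"
  shows "(n2 (x - a))\<^sup>2 = (n2 (x - E x))\<^sup>2 + (n2 (E x - a))\<^sup>2"
proof -
  let ?b = "E x - a"
  have b: "?b \<in> A" using x a by simp
  have "ip ?b (x - E x) = Re (tr (x \<odot> ?b\<^sup>\<star>) - tr (E x \<odot> ?b\<^sup>\<star>))"
    using x b tr_commute[of "?b\<^sup>\<star>" "x - E x"]
    by (simp only: ip_def comp_distribs M_closed M_adj A_M E_A tr_diff)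
  also have "\<dots> = 0" using tr_E_right[OF x, of "?b\<^sup>\<star>"] A_closed(4)[OF b] by simp
  finally have o: "ip ?b (x - E x) = 0" .
  have "(n2 (x - a))\<^sup>2 = (n2 ((x - E x) + ?b))\<^sup>2" by simp
  also have "\<dots> = (n2 (x - E x))\<^sup>2 + 2 * ip ?b (x - E x) + (n2 ?b)\<^sup>2"
  proof -
    have bM: "?b \<in> M" and cM: "x - E x \<in> M" using b x by auto
    show ?thesis
      by (simp only: n2_sq M_closed bM cM ip_add_left ip_add_right) (simp add: ip_commute[OF cM bM])
  qed
  finally show ?thesis using o by simp
qed

lemma n2_E_le: "x \<in> M \<Longrightarrow> n2 (E x) \<le> n2 x"
  using E_pythagoras[of x 0] by (auto intro: power2_le_imp_le)

lemma n2_diff_E_le: "x \<in> M \<Longrightarrow> n2 (x - E x) \<le> n2 x"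
  using E_pythagoras[of x 0] by (auto intro: power2_le_imp_le)

end


subsection \<open>Unitary conjugates of a masa\<close>

lemma (in vna) conj_star_subalgebra:
  assumes B: "star_subalgebra B M" "abelian B" and u: "u \<in> M" "unitary u"
  shows "star_subalgebra (conj_set u B) M" "abelian (conj_set u B)"
proof -
  have BM: "b \<in> B \<Longrightarrow> b \<in> M" for b using B by (auto simp: star_subalgebra_def)
  have mult: "(u \<odot> a \<odot> u\<^sup>\<star>) \<odot> (u \<odot> b \<odot> u\<^sup>\<star>) = u \<odot> (a \<odot> b) \<odot> u\<^sup>\<star>" for a b
  proof -
    have "(u \<odot> a \<odot> u\<^sup>\<star>) \<odot> (u \<odot> b \<odot> u\<^sup>\<star>) = u \<odot> a \<odot> ((u\<^sup>\<star> \<odot> u) \<odot> (b \<odot> u\<^sup>\<star>))" by (simp only: comp_assoc)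
    also have "u\<^sup>\<star> \<odot> u = id_blinfun" using u by (simp add: unitary_def)
    finally show ?thesis by (simp add: comp_distribs comp_assoc)
  qed
  show "abelian (conj_set u B)" using B(2) by (auto simp: abelian_def conj_set_def mult)
  have memI: "u \<odot> b \<odot> u\<^sup>\<star> \<in> conj_set u B" if "b \<in> B" for b using that by (auto simp: conj_set_def)
  show "star_subalgebra (conj_set u B) M"
    unfolding star_subalgebra_def
  proof (intro conjI ballI allI subsetI)
    fix x assume "x \<in> conj_set u B"
    then obtain a where a: "a \<in> B" "x = u \<odot> a \<odot> u\<^sup>\<star>" by (auto simp: conj_set_def)
    show "x \<in> M" using a BM u by simp
    show "c *\<^sub>O x \<in> conj_set u B" for c
      using memI[of "c *\<^sub>O a"] a B(1) u by (simp add: star_subalgebra_def scale_op_comp comp_scale_op)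
    show "x\<^sup>\<star> \<in> conj_set u B"
      using memI[of "a\<^sup>\<star>"] a B(1) u BM[OF a(1)] by (simp add: star_subalgebra_def comp_assoc)
    fix y assume "y \<in> conj_set u B"
    then obtain b where b: "b \<in> B" "y = u \<odot> b \<odot> u\<^sup>\<star>" by (auto simp: conj_set_def)
    show "x + y \<in> conj_set u B"
      using memI[of "a + b"] a b B(1) by (simp add: star_subalgebra_def comp_distribs)
    show "x \<odot> y \<in> conj_set u B"
      using memI[of "a \<odot> b"] a b B(1) by (simp add: star_subalgebra_def mult)
  next
    show "0 \<in> conj_set u B" using memI[of 0] B(1) by (simp add: star_subalgebra_def comp_distribs)
  qed
qed

lemma (in vna) conj_set_adj:
  assumes "unitary u" "u \<in> M" "B \<subseteq> M" shows "conj_set (u\<^sup>\<star>) (conj_set u B) = B"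
proof -
  have "u\<^sup>\<star> \<odot> (u \<odot> b \<odot> u\<^sup>\<star>) \<odot> (u\<^sup>\<star>)\<^sup>\<star> = b" for b
  proof -
    have "u\<^sup>\<star> \<odot> (u \<odot> b \<odot> u\<^sup>\<star>) \<odot> (u\<^sup>\<star>)\<^sup>\<star> = (u\<^sup>\<star> \<odot> u) \<odot> b \<odot> (u\<^sup>\<star> \<odot> u)" using assms by (simp add: comp_assoc)
    then show ?thesis using assms by (simp add: unitary_def comp_distribs)
  qed
  then show ?thesis by (simp add: conj_set_def image_image)
qed

lemma (in masa_in) masa_conj:
  assumes u: "u \<in> M" "unitary u" shows "masa (conj_set u A) M"
  unfolding masa_def
proof (intro conjI allI impI)
  show "star_subalgebra (conj_set u A) M" "abelian (conj_set u A)"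
    using conj_star_subalgebra[OF A_star A_abelian u] by auto
  fix B assume B: "star_subalgebra B M \<and> abelian B \<and> conj_set u A \<subseteq> B"
  have us: "u\<^sup>\<star> \<in> M" "unitary (u\<^sup>\<star>)" using u unitary_adj by auto
  have "star_subalgebra (conj_set (u\<^sup>\<star>) B) M" "abelian (conj_set (u\<^sup>\<star>) B)"
    using conj_star_subalgebra[OF _ _ us] B by auto
  moreover have "A \<subseteq> conj_set (u\<^sup>\<star>) B"
  proof -
    have "conj_set (u\<^sup>\<star>) (conj_set u A) \<subseteq> conj_set (u\<^sup>\<star>) B" using B unfolding conj_set_def by blast
    moreover have "A \<subseteq> M" by auto
    ultimately show ?thesis using conj_set_adj[OF u(2) u(1), of A] by simp
  qed
  ultimately have "conj_set (u\<^sup>\<star>) B = A" using masa by (auto simp: masa_def)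
  moreover have "B \<subseteq> M" using B by (simp add: star_subalgebra_def)
  then have "conj_set ((u\<^sup>\<star>)\<^sup>\<star>) (conj_set (u\<^sup>\<star>) B) = B" using conj_set_adj[OF us(2) us(1)] by blast
  ultimately show "B = conj_set u A" using u by simp
qed


section \<open>The main estimate\<close>

context masa_in begin

lemma delta_upper:
  assumes v: "v \<in> M" and b: "b \<in> conj_set v A" "norm b \<le> 1"
  shows "n2 (b - E b) \<le> delta_dist M tr (conj_set v A) A"
  unfolding delta_dist_def
proof (rule cSUP_upper)
  show "b \<in> {x \<in> conj_set v A. norm x \<le> 1}" using b by simp
  have "n2 (x - E x) \<le> 1" if "x \<in> conj_set v A" "norm x \<le> 1" for x
  proof -
    have x: "x \<in> M" using that(1) v by (auto simp: conj_set_def)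
    show ?thesis using n2_diff_E_le[OF x] n2_le_norm[OF x] that(2) by linarith
  qed
  then show "bdd_above ((\<lambda>x. n2 (x - E x)) ` {x \<in> conj_set v A. norm x \<le> 1})"
    by (auto intro!: bdd_aboveI[of _ 1])
qed

lemma delta_nonneg: "v \<in> M \<Longrightarrow> 0 \<le> delta_dist M tr (conj_set v A) A"
proof -
  assume v: "v \<in> M"
  have "0 \<in> conj_set v A" unfolding conj_set_def by (rule image_eqI[of _ _ 0]) (simp_all add: comp_distribs)
  then have "n2 (0 - E 0) \<le> delta_dist M tr (conj_set v A) A" using v by (intro delta_upper) auto
  then show ?thesis using n2_nonneg[of "0 - E 0"] E_id[of 0] by simp
qed

end

text \<open>A partial isometry \<open>v\<close> whose range projection \<open>q\<close> and source projection \<open>p\<close> are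
  orthogonal and lie in the masa. The symmetry \<open>u\<close> exchanges \<open>p\<close> and \<open>q\<close>.\<close>

locale popa_isometry = masa_in M tr A
  for M :: "'h::chilbert_space operator set" and tr :: "'h operator \<Rightarrow> complex" and A +
  fixes v :: "'h operator"
  assumes vM [simp]: "v \<in> M" and pv: "partial_isometry v"
    and qA: "v \<odot> v\<^sup>\<star> \<in> A" and pA: "v\<^sup>\<star> \<odot> v \<in> A"
    and qp: "(v \<odot> v\<^sup>\<star>) \<odot> (v\<^sup>\<star> \<odot> v) = 0"
begin

text \<open>The source projection, the range projection, their common complement and the symmetry.\<close>

definition p where "p = v\<^sup>\<star> \<odot> v"
definition q where "q = v \<odot> v\<^sup>\<star>"
definition r where "r = id_blinfun - p - q"
definition u where "u = v + v\<^sup>\<star> + r"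

lemma pA' [simp]: "p \<in> A" and qA' [simp]: "q \<in> A" using pA qA by (simp_all add: p_def q_def)

lemma rA [simp]: "r \<in> A" by (simp add: r_def)

lemma uM [simp]: "u \<in> M" by (simp add: u_def)

lemma adjs: "p\<^sup>\<star> = p" "q\<^sup>\<star> = q" "r\<^sup>\<star> = r" "u\<^sup>\<star> = u"
proof -
  show 1: "p\<^sup>\<star> = p" "q\<^sup>\<star> = q" by (simp_all add: p_def q_def)
  show 2: "r\<^sup>\<star> = r" by (simp add: r_def 1)
  show "u\<^sup>\<star> = u" by (simp add: u_def 2 add.commute)
qed

lemma table:
  "v \<odot> v\<^sup>\<star> = q" "v\<^sup>\<star> \<odot> v = p" "v \<odot> p = v" "q \<odot> v = v" "p \<odot> v\<^sup>\<star> = v\<^sup>\<star>" "v\<^sup>\<star> \<odot> q = v\<^sup>\<star>"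
  "q \<odot> p = 0" "p \<odot> q = 0" "p \<odot> p = p" "q \<odot> q = q"
  "v \<odot> v = 0" "v\<^sup>\<star> \<odot> v\<^sup>\<star> = 0" "p \<odot> v = 0" "v \<odot> q = 0" "v\<^sup>\<star> \<odot> p = 0" "q \<odot> v\<^sup>\<star> = 0"
proof -
  show q: "v \<odot> v\<^sup>\<star> = q" and p: "v\<^sup>\<star> \<odot> v = p" by (simp_all add: p_def q_def)
  show vp: "v \<odot> p = v" and qv: "q \<odot> v = v" using pv by (simp_all add: p_def q_def partial_isometry_def comp_assoc)
  show pvs: "p \<odot> v\<^sup>\<star> = v\<^sup>\<star>" using arg_cong[OF vp, of adj] by (simp add: adjs)
  show vsq: "v\<^sup>\<star> \<odot> q = v\<^sup>\<star>" using arg_cong[OF qv, of adj] by (simp add: adjs)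
  show qp': "q \<odot> p = 0" using qp by (simp add: p_def q_def)
  show pq: "p \<odot> q = 0" using A_commute[of p q] qp' by simp
  show "p \<odot> p = p" by (metis p vp comp_assoc)
  show "q \<odot> q = q" by (metis q qv comp_assoc)
  show vv: "v \<odot> v = 0"
    using comp_assoc[of v p "q \<odot> v"] comp_assoc[of p q v] by (simp add: vp qv pq comp_distribs)
  show "v\<^sup>\<star> \<odot> v\<^sup>\<star> = 0" using arg_cong[OF vv, of adj] by simp
  show "p \<odot> v = 0" by (metis qv pq comp_assoc comp_distribs(11))
  show "v \<odot> q = 0" by (metis vp pq comp_assoc comp_distribs(12))
  show "v\<^sup>\<star> \<odot> p = 0" by (metis vsq qp' comp_assoc comp_distribs(12))
  show "q \<odot> v\<^sup>\<star> = 0" by (metis pvs qp' comp_assoc comp_distribs(11))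
qed

lemma u_table: "u \<odot> u = id_blinfun" "q \<odot> u = v" "u \<odot> p = v" "u \<odot> q = v\<^sup>\<star>" "p \<odot> u = v\<^sup>\<star>" "r \<odot> u = r" "u \<odot> r = r"
  by (simp_all add: u_def r_def comp_distribs table)

lemma u_unitary: "unitary u" by (simp add: unitary_def adjs u_table)

lemma uu_cancel: "u \<odot> (u \<odot> x) = (x :: 'h operator)"
  using comp_assoc[of u u x, symmetric] by (simp add: u_table comp_distribs)

lemma norm_q: "norm q \<le> 1"
proof -
  have "projection q" by (simp add: projection_def adjs table)
  moreover have "projection (id_blinfun - q)"
    by (simp add: projection_def adjs table comp_distribs)
  ultimately show ?thesis using projectionD(4) by (intro positive_le_id_norm) auto
qed

lemma norm_u: "norm u \<le> 1" using unitary_norm[OF uM u_unitary] .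

abbreviation B where "B \<equiv> conj_set u A"

sublocale B: masa_in M tr B
  by unfold_locales (rule masa_conj[OF uM u_unitary])

abbreviation F where "F \<equiv> cond_exp M tr B"
abbreviation d where "d \<equiv> delta_dist M tr (conj_set v A) A"

lemma B_memI: "a \<in> A \<Longrightarrow> u \<odot> a \<odot> u \<in> B" by (auto simp: conj_set_def adjs)

lemma B_memE: assumes "b \<in> B" obtains a where "a \<in> A" "b = u \<odot> a \<odot> u"
  using assms by (auto simp: conj_set_def adjs)

lemma qB: "q \<in> B"
proof -
  have "u \<odot> p \<odot> u = q" by (simp add: u_table) (simp add: u_def r_def comp_distribs table)
  then show ?thesis using B_memI[of p] by simp
qed

text \<open>The conditional expectation onto \<open>B = uAu\<^sup>\<star>\<close> is the conjugate of \<open>E\<close>.\<close>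

lemma F_eq: assumes x: "x \<in> M" shows "F x = u \<odot> E (u \<odot> x \<odot> u) \<odot> u"
proof (rule B.E_unique[OF x])
  let ?y = "E (u \<odot> x \<odot> u)"
  have y: "?y \<in> A" using x by simp
  then show "u \<odot> ?y \<odot> u \<in> B" by (rule B_memI)
  fix b assume "b \<in> B"
  then obtain a where a: "a \<in> A" "b = u \<odot> a \<odot> u" by (rule B_memE)
  have "tr (u \<odot> ?y \<odot> u \<odot> b) = tr (u \<odot> (?y \<odot> a \<odot> u))" using a by (simp add: comp_assoc uu_cancel)
  also have "\<dots> = tr ((?y \<odot> a \<odot> u) \<odot> u)" using y a by (intro tr_commute) auto
  also have "\<dots> = tr (?y \<odot> a)" by (simp add: comp_assoc u_table comp_distribs)
  also have "\<dots> = tr (u \<odot> x \<odot> u \<odot> a)" using x a by (intro tr_E_right) auto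
  also have "\<dots> = tr (u \<odot> (x \<odot> u \<odot> a))" by (simp add: comp_assoc)
  also have "\<dots> = tr ((x \<odot> u \<odot> a) \<odot> u)" using x a by (intro tr_commute) auto
  also have "\<dots> = tr (x \<odot> b)" using a by (simp add: comp_assoc)
  finally show "tr (u \<odot> ?y \<odot> u \<odot> b) = tr (x \<odot> b)" .
qed

lemma qB_conj_v: assumes b: "b \<in> B" "norm b \<le> 1"
  shows "q \<odot> b \<in> conj_set v A" "norm (q \<odot> b) \<le> 1" "n2 (q \<odot> b - E (q \<odot> b)) \<le> d"
proof -
  obtain a where a: "a \<in> A" "b = u \<odot> a \<odot> u" using B_memE[OF b(1)] .
  have "q \<odot> b = (q \<odot> u) \<odot> (a \<odot> u)" using a by (simp add: comp_assoc)
  also have "\<dots> = (v \<odot> p) \<odot> (a \<odot> u)" by (simp add: u_table table)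
  also have "\<dots> = v \<odot> ((p \<odot> a) \<odot> u)" by (simp only: comp_assoc)
  also have "p \<odot> a = a \<odot> p" using a by (intro A_commute) auto
  also have "v \<odot> ((a \<odot> p) \<odot> u) = v \<odot> a \<odot> v\<^sup>\<star>" by (simp only: comp_assoc u_table)
  finally show 1: "q \<odot> b \<in> conj_set v A" using a by (auto simp: conj_set_def)
  show 2: "norm (q \<odot> b) \<le> 1" using norm_comp_le[OF norm_q b(2)] by simp
  show "n2 (q \<odot> b - E (q \<odot> b)) \<le> d" by (rule delta_upper[OF vM 1 2])
qed

text \<open>Since \<open>q w\<close> is close to the masa for every unitary \<open>w\<close> of \<open>B\<close>, conjugation by \<open>w\<close>
  hardly changes \<open>q E(x)\<close>.\<close>

lemma q_E_conj:
  assumes x: "x \<in> M" "norm x \<le> 1" and w: "w \<in> B" "unitary w"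
  shows "n2 (q \<odot> E x - q \<odot> E (w \<odot> x \<odot> w\<^sup>\<star>)) \<le> 2 * d"
proof -
  have wM: "w \<in> M" using w by simp
  have wn: "norm w \<le> 1" "norm (w\<^sup>\<star>) \<le> 1" using unitary_norm[OF wM w(2)] wM by auto
  define b where "b = q \<odot> w"
  define y where "y = x \<odot> w\<^sup>\<star>"
  have bM: "b \<in> M" and yM: "y \<in> M" using wM x by (simp_all add: b_def y_def)
  have yn: "norm y \<le> 1" using norm_comp_le[OF x(2) wn(2)] by (simp add: y_def)
  let ?a = "E b"
  have aA: "?a \<in> A" using bM by simp
  have e: "n2 (b - ?a) \<le> d" using qB_conj_v(3)[OF w(1) wn(1)] by (simp add: b_def)
  have "q \<odot> E (w \<odot> x \<odot> w\<^sup>\<star>) = E (b \<odot> y)"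
    using E_left[of q "w \<odot> x \<odot> w\<^sup>\<star>"] wM x by (simp add: b_def y_def comp_assoc)
  also have "b \<odot> y = (b - ?a) \<odot> y + ?a \<odot> y" by (simp add: comp_distribs)
  also have "E \<dots> = E ((b - ?a) \<odot> y) + ?a \<odot> E y" using bM yM aA by (simp add: E_add E_left)
  finally have 1: "q \<odot> E (w \<odot> x \<odot> w\<^sup>\<star>) = E ((b - ?a) \<odot> y) + ?a \<odot> E y" .
  have "w\<^sup>\<star> \<odot> b = w\<^sup>\<star> \<odot> (w \<odot> q)" using B.A_commute[OF w(1) qB] by (simp add: b_def)
  also have "\<dots> = (w\<^sup>\<star> \<odot> w) \<odot> q" by (simp only: comp_assoc)
  also have "\<dots> = q" using w by (simp only: unitary_def comp_distribs)
  finally have "y \<odot> b = x \<odot> q" by (simp add: y_def comp_assoc)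
  then have "q \<odot> E x = E (y \<odot> b)" using E_right[of q x] x A_commute[of q "E x"] by simp
  also have "y \<odot> b = y \<odot> (b - ?a) + y \<odot> ?a" by (simp add: comp_distribs)
  also have "E \<dots> = E (y \<odot> (b - ?a)) + E y \<odot> ?a" using bM yM aA by (simp add: E_add E_right)
  finally have 2: "q \<odot> E x = E (y \<odot> (b - ?a)) + E y \<odot> ?a" .
  have "q \<odot> E x - q \<odot> E (w \<odot> x \<odot> w\<^sup>\<star>) = E (y \<odot> (b - ?a)) - E ((b - ?a) \<odot> y)"
    using A_commute[of "E y" ?a] yM aA unfolding 1 2 by simp
  also have "n2 \<dots> \<le> n2 (E (y \<odot> (b - ?a))) + n2 (E ((b - ?a) \<odot> y))"
    using bM yM aA by (intro n2_triangle_diff) auto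
  also have "\<dots> \<le> n2 (y \<odot> (b - ?a)) + n2 ((b - ?a) \<odot> y)"
    using bM yM aA by (intro add_mono n2_E_le) auto
  also have "\<dots> \<le> 1 * n2 (b - ?a) + 1 * n2 (b - ?a)"
    using bM yM aA yn by (intro add_mono n2_comp_left n2_comp_right) auto
  finally show ?thesis using e by linarith
qed

text \<open>The bound passes to convex combinations and to their 2-norm limit \<open>F(x)\<close>.\<close>

lemma q_E_F:
  assumes x: "x \<in> M" "norm x \<le> 1"
  shows "n2 (q \<odot> E x - q \<odot> E (F x)) \<le> 2 * d"
proof -
  obtain c where c: "\<And>n. c n \<in> B.orbit_hull x" and lim: "(\<lambda>n. n2 (c n - F x)) \<longlonglongrightarrow> 0"
    using B.E_average(2)[OF x(1)] by blast
  have "B.orbit_hull x \<subseteq> {c \<in> M. n2 (q \<odot> E x - q \<odot> E c) \<le> 2 * d}"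
  proof (rule B.orbit_hull_subset)
    show "w \<odot> x \<odot> w\<^sup>\<star> \<in> {c \<in> M. n2 (q \<odot> E x - q \<odot> E c) \<le> 2 * d}" if "w \<in> B" "unitary w" for w
      using q_E_conj[OF x that] that x by simp
    show "convex {c \<in> M. n2 (q \<odot> E x - q \<odot> E c) \<le> 2 * d}"
      unfolding convex_def
    proof (intro ballI allI impI)
      fix a b and s t :: real
      assume a: "a \<in> {c \<in> M. n2 (q \<odot> E x - q \<odot> E c) \<le> 2 * d}"
        and b: "b \<in> {c \<in> M. n2 (q \<odot> E x - q \<odot> E c) \<le> 2 * d}" and st: "0 \<le> s" "0 \<le> t" "s + t = 1"
      have abM: "a \<in> M" "b \<in> M" using a b by auto
      have ER: "E (k *\<^sub>R z) = k *\<^sub>R E z" if "z \<in> M" for k z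
        using E_scale[OF that, of "complex_of_real k"] by (simp add: scale_op_scaleR)
      have "q \<odot> E x = s *\<^sub>R (q \<odot> E x) + t *\<^sub>R (q \<odot> E x)" using st by (simp flip: scaleR_add_left)
      then have "q \<odot> E x - q \<odot> E (s *\<^sub>R a + t *\<^sub>R b)
        = s *\<^sub>R (q \<odot> E x - q \<odot> E a) + t *\<^sub>R (q \<odot> E x - q \<odot> E b)"
        using abM by (simp add: E_add ER comp_distribs scaleR_diff_right)
      also have "n2 \<dots> \<le> n2 (s *\<^sub>R (q \<odot> E x - q \<odot> E a)) + n2 (t *\<^sub>R (q \<odot> E x - q \<odot> E b))"
        using abM x by (intro n2_triangle) auto
      also have "\<dots> = s * n2 (q \<odot> E x - q \<odot> E a) + t * n2 (q \<odot> E x - q \<odot> E b)"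
        using abM x st by (simp add: n2_scaleR)
      also have "\<dots> \<le> s * (2 * d) + t * (2 * d)"
        using a b st by (intro add_mono mult_left_mono) auto
      also have "\<dots> = (s + t) * (2 * d)" by (simp only: distrib_right)
      finally show "s *\<^sub>R a + t *\<^sub>R b \<in> {c \<in> M. n2 (q \<odot> E x - q \<odot> E c) \<le> 2 * d}" using abM st by simp
    qed
  qed
  then have cM: "c n \<in> M" and cd: "n2 (q \<odot> E x - q \<odot> E (c n)) \<le> 2 * d" for n using c by auto
  have bnd: "n2 (q \<odot> E x - q \<odot> E (F x)) \<le> 2 * d + n2 (c n - F x)" for n
  proof -
    have FM: "F x \<in> M" using x by simp
    have "n2 (q \<odot> E x - q \<odot> E (F x)) \<le> n2 (q \<odot> E x - q \<odot> E (c n)) + n2 (q \<odot> E (c n) - q \<odot> E (F x))"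
      using cM FM x by (intro n2_triangle3) auto
    also have "q \<odot> E (c n) - q \<odot> E (F x) = q \<odot> E (c n - F x)" using cM FM by (simp add: E_diff comp_distribs)
    also have "n2 \<dots> \<le> 1 * n2 (E (c n - F x))" using cM FM by (intro n2_comp_left norm_q) auto
    also have "\<dots> \<le> n2 (c n - F x)" using cM FM n2_E_le[of "c n - F x"] by simp
    finally show ?thesis using cd[of n] by linarith
  qed
  have "(\<lambda>n. 2 * d + n2 (c n - F x)) \<longlonglongrightarrow> 2 * d + 0" by (intro tendsto_add tendsto_const lim)
  then have "n2 (q \<odot> E x - q \<odot> E (F x)) \<le> 2 * d + 0" by (rule LIMSEQ_le_const) (use bnd in blast)
  then show ?thesis by simp
qed

lemma q_part:
  assumes x: "x \<in> M" "norm x \<le> 1"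
  shows "(n2 (q \<odot> (F x - E x)))\<^sup>2 \<le> 5 * d\<^sup>2"
proof -
  have Fx: "F x \<in> B" "norm (F x) \<le> 1" "F x \<in> M" using x B.E_average(1)[OF x(1)] by auto
  let ?z = "q \<odot> F x"
  have zM: "?z \<in> M" using Fx by simp
  have d0: "0 \<le> d" by (rule delta_nonneg) simp
  have "(n2 (q \<odot> (F x - E x)))\<^sup>2 = (n2 (?z - q \<odot> E x))\<^sup>2" by (simp add: comp_distribs)
  also have "\<dots> = (n2 (?z - E ?z))\<^sup>2 + (n2 (E ?z - q \<odot> E x))\<^sup>2" using x by (intro E_pythagoras zM) auto
  also have "(n2 (?z - E ?z))\<^sup>2 \<le> d\<^sup>2"
    using qB_conj_v(3)[OF Fx(1,2)] zM by (intro power_mono) auto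
  also have "n2 (E ?z - q \<odot> E x) = n2 (q \<odot> E x - q \<odot> E (F x))"
    using Fx x by (simp add: E_left n2_minus_commute)
  also have "(n2 (q \<odot> E x - q \<odot> E (F x)))\<^sup>2 \<le> (2 * d)\<^sup>2"
    using q_E_F[OF x] Fx x by (intro power_mono) auto
  finally show ?thesis by (simp add: power_mult_distrib)
qed

text \<open>Conjugation by \<open>u\<close> turns the part under \<open>p\<close> into a part under \<open>q\<close>.\<close>

lemma p_part:
  assumes x: "x \<in> M" "norm x \<le> 1"
  shows "(n2 (p \<odot> (F x - E x)))\<^sup>2 \<le> 5 * d\<^sup>2"
proof -
  let ?x = "u \<odot> x \<odot> u"
  have x': "?x \<in> M" "norm ?x \<le> 1"
    using x norm_comp_le[OF norm_comp_le[OF norm_u x(2)] norm_u] by auto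
  have FM: "F x \<in> M" "F ?x \<in> M" using B.E_A[OF x(1)] B.E_A[OF x'(1)] B.A_M by blast+
  have 1: "u \<odot> F x \<odot> u = E ?x" by (simp add: F_eq[OF x(1)] comp_assoc uu_cancel u_table comp_distribs)
  have "u \<odot> ?x \<odot> u = x" by (simp add: comp_assoc uu_cancel u_table comp_distribs)
  then have 2: "u \<odot> E x \<odot> u = F ?x" using F_eq[OF x'(1)] by simp
  have "u \<odot> p \<odot> (F x - E x) \<odot> u = q \<odot> (u \<odot> F x \<odot> u - u \<odot> E x \<odot> u)"
  proof -
    have "u \<odot> p = q \<odot> u" by (simp add: u_table)
    then have "u \<odot> p \<odot> (F x - E x) \<odot> u = q \<odot> (u \<odot> (F x - E x) \<odot> u)" by (simp add: comp_assoc)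
    then show ?thesis by (simp add: comp_distribs)
  qed
  then have 3: "u \<odot> (p \<odot> (F x - E x) \<odot> u) = - (q \<odot> (F ?x - E ?x))"
    unfolding 1 2 by (simp add: comp_distribs comp_assoc)
  have DM: "F x - E x \<in> M" using FM x by simp
  have "n2 (p \<odot> (F x - E x)) = n2 (u \<odot> (p \<odot> (F x - E x) \<odot> u))"
    using DM n2_unitary_left[of u "p \<odot> (F x - E x) \<odot> u"] n2_unitary_right[of u "p \<odot> (F x - E x)"] u_unitary
    by simp
  also have "\<dots> = n2 (q \<odot> (F ?x - E ?x))" unfolding 3 using FM x' by (intro n2_uminus) auto
  finally show ?thesis using q_part[OF x'] by simp
qed

lemma r_part: assumes x: "x \<in> M" shows "r \<odot> (F x - E x) = 0"
proof -
  let ?y = "E (u \<odot> x \<odot> u)"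
  have yA: "?y \<in> A" using x by simp
  have rr: "r \<odot> r = r" by (simp add: r_def comp_distribs table)
  have "r \<odot> F x = (r \<odot> u) \<odot> (?y \<odot> u)" by (simp add: F_eq[OF x] comp_assoc)
  also have "\<dots> = r \<odot> r \<odot> ?y \<odot> u" by (simp add: u_table rr comp_assoc)
  also have "\<dots> = r \<odot> ((r \<odot> ?y) \<odot> u)" by (simp only: comp_assoc)
  also have "r \<odot> ?y = ?y \<odot> r" using yA by (intro A_commute) auto
  also have "r \<odot> ((?y \<odot> r) \<odot> u) = r \<odot> ?y \<odot> r" by (simp add: comp_assoc u_table)
  also have "\<dots> = E (r \<odot> (u \<odot> x \<odot> u) \<odot> r)" using x by (subst E_bimodule) auto
  also have "r \<odot> (u \<odot> x \<odot> u) \<odot> r = (r \<odot> u) \<odot> x \<odot> (u \<odot> r)" by (simp only: comp_assoc)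
  also have "\<dots> = r \<odot> x \<odot> r" by (simp add: u_table)
  also have "E \<dots> = r \<odot> E x \<odot> r" using x by (subst E_bimodule) auto
  also have "\<dots> = r \<odot> (E x \<odot> r)" by (simp only: comp_assoc)
  also have "E x \<odot> r = r \<odot> E x" using x by (intro A_commute) auto
  also have "r \<odot> (r \<odot> E x) = (r \<odot> r) \<odot> E x" by (simp only: comp_assoc)
  finally show ?thesis by (simp add: comp_distribs rr)
qed

lemma diff_bound:
  assumes x: "x \<in> M" "norm x \<le> 1"
  shows "n2 (F x - E x) \<le> sqrt 10 * d"
proof -
  let ?D = "F x - E x"
  have "F x \<in> M" using B.E_A[OF x(1)] B.A_M by blast
  then have DM: "?D \<in> M" using x by simp
  have "?D = (p + q + r) \<odot> ?D" by (simp add: r_def comp_distribs(9))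
  also have "\<dots> = p \<odot> ?D + q \<odot> ?D" using r_part[OF x(1)] by (simp add: comp_distribs(2))
  finally have eq: "?D = p \<odot> ?D + q \<odot> ?D" .
  have pM: "p \<odot> ?D \<in> M" and qM: "q \<odot> ?D \<in> M" using DM by auto
  have o: "ip (p \<odot> ?D) (q \<odot> ?D) = 0"
  proof -
    have "(p \<odot> ?D)\<^sup>\<star> \<odot> (q \<odot> ?D) = ?D\<^sup>\<star> \<odot> ((p \<odot> q) \<odot> ?D)"
      using DM by (simp only: adj_comp M_bounded A_M pA' adjs comp_assoc)
    then show ?thesis by (simp add: ip_def table comp_distribs tr_zero)
  qed
  have "(n2 ?D)\<^sup>2 = (n2 (p \<odot> ?D + q \<odot> ?D))\<^sup>2" by (subst eq) simp
  also have "\<dots> = (n2 (p \<odot> ?D))\<^sup>2 + (n2 (q \<odot> ?D))\<^sup>2"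
    using o ip_commute[OF pM qM] by (simp only: n2_sq M_closed pM qM ip_add_left ip_add_right)
  also have "\<dots> \<le> 5 * d\<^sup>2 + 5 * d\<^sup>2" by (intro add_mono p_part q_part x)
  also have "\<dots> = (sqrt 10 * d)\<^sup>2" by (simp add: power_mult_distrib)
  finally show ?thesis by (rule power2_le_imp_le) (use delta_nonneg[OF vM] in simp)
qed

lemma norm_inf_2_bound: "norm_inf_2 M tr (\<lambda>x. F x - E x) \<le> sqrt 10 * d"
  unfolding norm_inf_2_def
proof (rule cSUP_least)
  show "{x \<in> M. norm x \<le> 1} \<noteq> {}" using M_closed(7) by (metis (mono_tags) empty_Collect_eq norm_zero zero_le_one)
qed (use diff_bound in auto)

lemma E_v: "E v = 0" "E (v\<^sup>\<star>) = 0"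
proof -
  have "E v = E (q \<odot> v \<odot> p)" by (simp add: table)
  also have "\<dots> = q \<odot> E v \<odot> p" by (rule E_bimodule) auto
  also have "\<dots> = q \<odot> (E v \<odot> p)" by (rule comp_assoc)
  also have "E v \<odot> p = p \<odot> E v" by (intro A_commute) auto
  also have "q \<odot> (p \<odot> E v) = (q \<odot> p) \<odot> E v" by (simp only: comp_assoc)
  finally show "E v = 0" by (simp add: table comp_distribs)
  have "E (v\<^sup>\<star>) = E (p \<odot> v\<^sup>\<star> \<odot> q)" by (simp add: table)
  also have "\<dots> = p \<odot> E (v\<^sup>\<star>) \<odot> q" by (rule E_bimodule) auto
  also have "\<dots> = p \<odot> (E (v\<^sup>\<star>) \<odot> q)" by (rule comp_assoc)
  also have "E (v\<^sup>\<star>) \<odot> q = q \<odot> E (v\<^sup>\<star>)" by (intro A_commute) auto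
  also have "p \<odot> (q \<odot> E (v\<^sup>\<star>)) = (p \<odot> q) \<odot> E (v\<^sup>\<star>)" by (simp only: comp_assoc)
  finally show "E (v\<^sup>\<star>) = 0" by (simp add: table comp_distribs)
qed

lemma n2_u: "n2 (u - E u) = sqrt 2 * n2 p"
proof -
  have "E u = r" by (simp add: u_def E_add E_v E_id)
  then have 1: "u - E u = v + v\<^sup>\<star>" by (simp add: u_def)
  have "tr q = tr p" using tr_commute[of v "v\<^sup>\<star>"] by (simp add: table)
  then have "(n2 (v + v\<^sup>\<star>))\<^sup>2 = 2 * Re (tr p)"
    by (simp add: n2_sq ip_def comp_distribs table tr_add)
  also have "\<dots> = 2 * (n2 p)\<^sup>2" by (simp add: n2_sq ip_def adjs table)
  also have "\<dots> = (sqrt 2 * n2 p)\<^sup>2" by (simp add: power_mult_distrib)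
  finally show ?thesis unfolding 1 by (subst (asm) power2_eq_iff_nonneg) auto
qed

lemma delta_ge:
  assumes "sing_ineq M tr A \<alpha>" shows "\<alpha> / sqrt 5 * n2 (v\<^sup>\<star> \<odot> v) \<le> d"
proof -
  have "\<alpha> * (sqrt 2 * n2 p) \<le> sqrt 10 * d"
    using assms u_unitary uM norm_inf_2_bound unfolding sing_ineq_def n2_u[symmetric] by (meson order_trans)
  also have "sqrt 10 = sqrt 2 * sqrt 5" by (simp flip: real_sqrt_mult)
  finally have "sqrt 2 * (\<alpha> * n2 p) \<le> sqrt 2 * (sqrt 5 * d)" by (simp add: ac_simps)
  then have "\<alpha> * n2 p \<le> sqrt 5 * d" by (simp only: mult_le_cancel_left_pos real_sqrt_gt_zero)
  then show ?thesis by (simp add: table field_simps)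
qed

end

lemma (in masa_in) popa_ineq_of_sing_ineq:
  assumes "sing_ineq M tr A \<alpha>" shows "popa_ineq M tr A (\<alpha> / sqrt 5)"
  unfolding popa_ineq_def
proof (intro ballI impI, elim conjE)
  fix v assume "v \<in> M" "partial_isometry v" "v \<odot> v\<^sup>\<star> \<in> A" "v\<^sup>\<star> \<odot> v \<in> A" "(v \<odot> v\<^sup>\<star>) \<odot> (v\<^sup>\<star> \<odot> v) = 0"
  then interpret popa_isometry M tr A v by unfold_locales
  show "\<alpha> / sqrt 5 * n2 (v\<^sup>\<star> \<odot> v) \<le> delta_dist M tr (conj_set v A) A" by (rule delta_ge[OF assms])
qed


section \<open>A maximality principle\<close>

text \<open>An order that is compatible with a bounded real function and in which increasing sequences
  are bounded has elements that are maximal with respect to the function; the sequence is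
  chosen greedily.\<close>

lemma greedy_maximal:
  fixes \<tau> :: "'a \<Rightarrow> real"
  assumes ne: "x0 \<in> S" and bnd: "\<And>x. x \<in> S \<Longrightarrow> \<tau> x \<le> C"
    and refl: "\<And>x. x \<in> S \<Longrightarrow> le x x"
    and trans: "\<And>x y z. x \<in> S \<Longrightarrow> y \<in> S \<Longrightarrow> z \<in> S \<Longrightarrow> le x y \<Longrightarrow> le y z \<Longrightarrow> le x z"
    and mono: "\<And>x y. x \<in> S \<Longrightarrow> y \<in> S \<Longrightarrow> le x y \<Longrightarrow> \<tau> x \<le> \<tau> y"
    and chain: "\<And>f::nat \<Rightarrow> 'a. (\<And>n. f n \<in> S) \<Longrightarrow> (\<And>n. le (f n) (f (Suc n))) \<Longrightarrow> \<exists>b\<in>S. \<forall>n. le (f n) b"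
  shows "\<exists>m\<in>S. \<forall>y\<in>S. le m y \<longrightarrow> \<tau> y \<le> \<tau> m"
proof -
  define \<sigma> where "\<sigma> x = (SUP y\<in>{y \<in> S. le x y}. \<tau> y)" for x
  have bdd: "bdd_above (\<tau> ` {y \<in> S. le x y})" for x using bnd by (auto intro!: bdd_aboveI[of _ C])
  have \<sigma>: "\<tau> y \<le> \<sigma> x" if "y \<in> S" "le x y" for x y
    unfolding \<sigma>_def using that by (intro cSUP_upper bdd) auto
  have step: "\<exists>y. y \<in> S \<and> le x y \<and> \<sigma> x - inverse (real (Suc n)) < \<tau> y" if x: "x \<in> S" for x n
  proof -
    have "{y \<in> S. le x y} \<noteq> {}" using refl x by auto
    then show ?thesis
      using less_cSUP_iff[OF _ bdd, of x "\<sigma> x - inverse (real (Suc n))"] by (auto simp: \<sigma>_def)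
  qed
  obtain f where f0: "f 0 = x0" and fS: "\<And>n. f n \<in> S"
    and f: "\<And>n. le (f n) (f (Suc n)) \<and> \<sigma> (f n) - inverse (real (Suc n)) < \<tau> (f (Suc n))"
    using dependent_nat_choice[of "\<lambda>n x. x \<in> S \<and> (n = 0 \<longrightarrow> x = x0)"
      "\<lambda>n x y. le x y \<and> \<sigma> x - inverse (real (Suc n)) < \<tau> y"] ne step by auto
  obtain b where b: "b \<in> S" "\<And>n. le (f n) b" using chain[of f] fS f by blast
  have "\<tau> y \<le> \<tau> b" if y: "y \<in> S" "le b y" for y
  proof -
    have "\<tau> y \<le> \<tau> b + inverse (real (Suc n))" for n
    proof -
      have "\<tau> y \<le> \<sigma> (f n)" using trans[OF fS b(1) y(1) b(2) y(2)] y(1) by (intro \<sigma>)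
      moreover have "\<tau> (f (Suc n)) \<le> \<tau> b" by (intro mono fS b)
      ultimately show ?thesis using f[of n] by linarith
    qed
    moreover have "(\<lambda>n. \<tau> b + inverse (real (Suc n))) \<longlonglongrightarrow> \<tau> b + 0"
      by (intro tendsto_add tendsto_const LIMSEQ_inverse_real_of_nat)
    ultimately show ?thesis using LIMSEQ_le_const[of "\<lambda>n. \<tau> b + inverse (real (Suc n))" "\<tau> b + 0" "\<tau> y"] by auto
  qed
  then show ?thesis using b(1) by blast
qed


section \<open>Partial isometries\<close>

context tracial begin

lemma partial_isometry_source: "v \<in> M \<Longrightarrow> partial_isometry v \<Longrightarrow> projection (v\<^sup>\<star> \<odot> v)"
  by (simp add: projection_def partial_isometry_def comp_assoc)

lemma partial_isometry_adj: "v \<in> M \<Longrightarrow> partial_isometry v \<Longrightarrow> partial_isometry (v\<^sup>\<star>)"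
proof -
  assume v: "v \<in> M" "partial_isometry v"
  have "(v \<odot> v\<^sup>\<star> \<odot> v)\<^sup>\<star> = v\<^sup>\<star>" using v by (simp add: partial_isometry_def)
  then show ?thesis using v by (simp add: partial_isometry_def comp_assoc)
qed

lemma projection_compl: "projection e \<Longrightarrow> projection (id_blinfun - e)"
  by (simp add: projection_def comp_distribs)

lemma projection_norm: "projection e \<Longrightarrow> norm e \<le> 1"
  using projectionD(4)[of e] projectionD(4)[OF projection_compl[of e]] by (intro positive_le_id_norm)

lemma partial_isometry_norm: assumes v: "v \<in> M" "partial_isometry v" shows "norm v \<le> 1"
proof (rule norm_blinfun_bound)
  fix x
  have "(norm (v x))\<^sup>2 = inner x ((v\<^sup>\<star> \<odot> v) x)" using v(1) by (simp add: adj_inner' power2_norm_eq_inner)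
  also have "\<dots> \<le> norm (v\<^sup>\<star> \<odot> v) * (norm x)\<^sup>2" by (rule inner_le_norm)
  also have "\<dots> \<le> 1 * (norm x)\<^sup>2"
    using projection_norm[OF partial_isometry_source[OF v]] by (intro mult_right_mono) auto
  finally show "norm (v x) \<le> 1 * norm x" by (intro power2_le_imp_le[of "norm (v x)"]) auto
qed simp

lemma projection_tr: "e \<in> M \<Longrightarrow> projection e \<Longrightarrow> Re (tr e) = (n2 e)\<^sup>2"
  by (simp add: n2_sq ip_def projectionD)

lemma projection_tr_pos: assumes "e \<in> M" "projection e" "e \<noteq> 0" shows "0 < Re (tr e)"
proof -
  have "n2 e \<noteq> 0" using n2_eq_0 assms by blast
  then show ?thesis using projection_tr[OF assms(1,2)] by simp
qed

text \<open>The partial isometry \<open>w\<close> agrees with \<open>v\<close> on the source of \<open>v\<close>, and the adjoints agree on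
  the range of \<open>v\<close>.\<close>

definition extends :: "'h operator \<Rightarrow> 'h operator \<Rightarrow> bool" where
  "extends v w \<longleftrightarrow> v \<odot> v\<^sup>\<star> \<odot> w = v \<and> w \<odot> v\<^sup>\<star> \<odot> v = v"

lemma extends_refl: "partial_isometry v \<Longrightarrow> extends v v"
  by (simp add: extends_def partial_isometry_def)

lemma extends_trans:
  assumes M: "v \<in> M" "w \<in> M" "z \<in> M" and p: "partial_isometry v" and 1: "extends v w" and 2: "extends w z"
  shows "extends v z"
proof -
  have a1: "v \<odot> (v\<^sup>\<star> \<odot> w) = v" and a2: "w \<odot> (v\<^sup>\<star> \<odot> v) = v" using 1 by (simp_all add: extends_def comp_assoc)
  have b1: "w \<odot> (w\<^sup>\<star> \<odot> z) = w" and b2: "z \<odot> (w\<^sup>\<star> \<odot> w) = w" using 2 by (simp_all add: extends_def comp_assoc)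
  have p': "v \<odot> (v\<^sup>\<star> \<odot> v) = v" using p by (simp add: partial_isometry_def comp_assoc)
  have s1: "v\<^sup>\<star> \<odot> (v \<odot> w\<^sup>\<star>) = v\<^sup>\<star>" using arg_cong[OF a2, of adj] M by (simp add: comp_assoc)
  have s2: "w\<^sup>\<star> \<odot> (v \<odot> v\<^sup>\<star>) = v\<^sup>\<star>" using arg_cong[OF a1, of adj] M by (simp add: comp_assoc)
  have "v \<odot> v\<^sup>\<star> \<odot> z = v \<odot> (v\<^sup>\<star> \<odot> (v \<odot> w\<^sup>\<star>)) \<odot> z" by (simp only: s1)
  also have "\<dots> = (v \<odot> (v\<^sup>\<star> \<odot> v)) \<odot> w\<^sup>\<star> \<odot> z" by (simp only: comp_assoc)
  also have "\<dots> = (v \<odot> (v\<^sup>\<star> \<odot> w)) \<odot> w\<^sup>\<star> \<odot> z" by (simp only: p' a1)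
  also have "\<dots> = v \<odot> (v\<^sup>\<star> \<odot> (w \<odot> (w\<^sup>\<star> \<odot> z)))" by (simp only: comp_assoc)
  also have "\<dots> = v" by (simp only: b1 a1)
  finally have 3: "v \<odot> v\<^sup>\<star> \<odot> z = v" .
  have "z \<odot> v\<^sup>\<star> \<odot> v = z \<odot> (w\<^sup>\<star> \<odot> (v \<odot> v\<^sup>\<star>)) \<odot> v" by (simp only: s2)
  also have "\<dots> = z \<odot> w\<^sup>\<star> \<odot> (v \<odot> (v\<^sup>\<star> \<odot> v))" by (simp only: comp_assoc)
  also have "\<dots> = z \<odot> w\<^sup>\<star> \<odot> (w \<odot> (v\<^sup>\<star> \<odot> v))" by (simp only: p' a2)
  also have "\<dots> = (z \<odot> (w\<^sup>\<star> \<odot> w)) \<odot> (v\<^sup>\<star> \<odot> v)" by (simp only: comp_assoc)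
  also have "\<dots> = v" by (simp only: b2 a2)
  finally show ?thesis using 3 by (simp add: extends_def)
qed

lemma extends_n2:
  assumes M: "v \<in> M" "w \<in> M" and p: "partial_isometry v" and e: "extends v w"
  shows "(n2 (w - v))\<^sup>2 = (n2 w)\<^sup>2 - (n2 v)\<^sup>2"
proof -
  have p': "v\<^sup>\<star> \<odot> v \<odot> v\<^sup>\<star> = v\<^sup>\<star>" using partial_isometry_adj[OF M(1) p] M by (simp add: partial_isometry_def)
  have "v\<^sup>\<star> \<odot> w = (v\<^sup>\<star> \<odot> v \<odot> v\<^sup>\<star>) \<odot> w" by (simp only: p')
  also have "\<dots> = v\<^sup>\<star> \<odot> (v \<odot> v\<^sup>\<star> \<odot> w)" by (simp only: comp_assoc)
  also have "\<dots> = v\<^sup>\<star> \<odot> v" using e by (simp add: extends_def)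
  finally have "ip v w = ip v v" by (simp add: ip_def)
  then show ?thesis using M ip_commute[of v w] by (simp add: n2_sq ip_diff_left ip_diff_right)
qed

lemma n2_limit_comp_const:
  fixes x :: "nat \<Rightarrow> 'h operator"
  assumes "\<And>n. x n \<in> M" "y \<in> M" "(\<lambda>n. n2 (x n - y)) \<longlonglongrightarrow> 0" "a \<in> M"
  shows "(\<lambda>n. n2 (a \<odot> x n - a \<odot> y)) \<longlonglongrightarrow> 0" "(\<lambda>n. n2 (x n \<odot> a - y \<odot> a)) \<longlonglongrightarrow> 0"
proof -
  have l: "(\<lambda>n. norm a * n2 (x n - y)) \<longlonglongrightarrow> 0" using tendsto_mult_left[OF assms(3), of "norm a"] by simp
  have "n2 (a \<odot> x n - a \<odot> y) \<le> norm a * n2 (x n - y)" for n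
    using n2_comp_left[of a "x n - y" "norm a"] assms by (simp add: comp_distribs)
  then show "(\<lambda>n. n2 (a \<odot> x n - a \<odot> y)) \<longlonglongrightarrow> 0" using assms by (intro seq_squeeze_zero[OF _ _ l]) auto
  have "n2 (x n \<odot> a - y \<odot> a) \<le> norm a * n2 (x n - y)" for n
    using n2_comp_right[of a "x n - y" "norm a"] assms by (simp add: comp_distribs)
  then show "(\<lambda>n. n2 (x n \<odot> a - y \<odot> a)) \<longlonglongrightarrow> 0" using assms by (intro seq_squeeze_zero[OF _ _ l]) auto
qed

text \<open>Increasing sequences of partial isometries converge in the 2-norm to a common extension.\<close>

lemma extends_chain:
  assumes v: "\<And>n. v n \<in> M" "\<And>n. partial_isometry (v n)" "\<And>n::nat. extends (v n) (v (Suc n))"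
  obtains w where "w \<in> M" "partial_isometry w" "\<And>n. extends (v n) w" "(\<lambda>n. n2 (v n - w)) \<longlonglongrightarrow> 0"
proof -
  have norm1: "norm (v n) \<le> 1" for n using partial_isometry_norm v by blast
  have ext: "extends (v m) (v n)" if "m \<le> n" for m n
    using that
  proof (induction n rule: dec_induct)
    case base show ?case by (rule extends_refl[OF v(2)])
  next
    case (step n) then show ?case using extends_trans[OF v(1) v(1) v(1) v(2) step.IH v(3)] by blast
  qed
  let ?t = "\<lambda>n. (n2 (v n))\<^sup>2"
  have "incseq ?t"
  proof (rule incseq_SucI)
    fix n show "?t n \<le> ?t (Suc n)"
      using extends_n2[OF v(1) v(1) v(2) v(3), of n] by (metis diff_ge_0_iff_ge zero_le_power2)
  qed
  moreover have "?t n \<le> 1" for n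
  proof -
    have "n2 (v n) \<le> 1" using n2_le_norm[OF v(1)[of n]] norm1[of n] by simp
    then show ?thesis using v(1) by (simp add: power_le_one)
  qed
  ultimately obtain L where "?t \<longlonglongrightarrow> L" using incseq_convergent[of ?t 1] by blast
  then have cq: "Cauchy ?t" by (rule LIMSEQ_imp_Cauchy)
  obtain w where w: "w \<in> M" "(\<lambda>n. n2 (v n - w)) \<longlonglongrightarrow> 0"
  proof (rule bounded_cauchy_limit[of v 1, OF v(1) norm1])
    fix e :: real assume e: "0 < e"
    obtain N where N: "\<And>m n. m \<ge> N \<Longrightarrow> n \<ge> N \<Longrightarrow> \<bar>?t m - ?t n\<bar> < e\<^sup>2"
      using cq[unfolded Cauchy_iff, rule_format, of "e\<^sup>2"] e by auto
    have le: "n2 (v n - v m) < e" if "N \<le> m" "m \<le> n" for m n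
    proof -
      have "(n2 (v n - v m))\<^sup>2 = ?t n - ?t m" by (rule extends_n2[OF v(1) v(1) v(2) ext[OF that(2)]])
      also have "\<dots> < e\<^sup>2" using N[of n m] that by simp
      finally show ?thesis using e by (simp add: power_less_imp_less_base)
    qed
    have "n2 (v m - v n) < e" if "N \<le> m" "N \<le> n" for m n
      using le[of m n] le[of n m] that v(1) n2_minus_commute[of "v m" "v n"] by (cases "m \<le> n") auto
    then show "\<exists>N. \<forall>m\<ge>N. \<forall>n\<ge>N. n2 (v m - v n) < e" by blast
  qed (rule that)
  note adjl = n2_limit_adj[OF v(1) w]
  have na: "norm ((v n)\<^sup>\<star>) \<le> 1" for n using norm1 v(1) by simp
  have vv: "(\<lambda>n. n2 (v n \<odot> (v n)\<^sup>\<star> - w \<odot> w\<^sup>\<star>)) \<longlonglongrightarrow> 0"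
    by (rule n2_limit_comp[OF _ _ _ _ norm1 w(2) adjl]) (simp_all add: v w)
  have nvv: "norm (v n \<odot> (v n)\<^sup>\<star>) \<le> 1" for n using norm_comp_le[OF norm1 na] by simp
  have vvv: "(\<lambda>n. n2 (v n \<odot> (v n)\<^sup>\<star> \<odot> v n - w \<odot> w\<^sup>\<star> \<odot> w)) \<longlonglongrightarrow> 0"
    by (rule n2_limit_comp[OF _ _ _ _ nvv vv w(2)]) (simp_all add: v w)
  have "v n \<odot> (v n)\<^sup>\<star> \<odot> v n = v n" for n using v(2) by (simp add: partial_isometry_def)
  then have vvv': "(\<lambda>n. n2 (v n - w \<odot> w\<^sup>\<star> \<odot> w)) \<longlonglongrightarrow> 0" using vvv by simp
  have "w \<odot> w\<^sup>\<star> \<odot> w = w" by (rule n2_limit_unique[OF v(1) _ _ vvv' w(2)]) (simp_all add: w)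
  then have pw: "partial_isometry w" by (simp add: partial_isometry_def)
  have "extends (v k) w" for k
  proof -
    let ?a = "v k \<odot> (v k)\<^sup>\<star>" and ?b = "(v k)\<^sup>\<star> \<odot> v k"
    have shift: "(\<lambda>n. n2 (v (n + k) - w)) \<longlonglongrightarrow> 0" using LIMSEQ_ignore_initial_segment[OF w(2)] .
    have e: "?a \<odot> v (n + k) = v k" "v (n + k) \<odot> ?b = v k" for n
      using ext[of k "n + k"] by (simp_all add: extends_def comp_assoc)
    have "(\<lambda>n. n2 (?a \<odot> v (n + k) - ?a \<odot> w)) \<longlonglongrightarrow> 0"
      by (rule n2_limit_comp_const(1)[OF v(1) w(1) shift]) (simp add: v)
    then have "(\<lambda>n. n2 (v k - ?a \<odot> w)) \<longlonglongrightarrow> 0" by (simp only: e)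
    then have "n2 (v k - ?a \<odot> w) = 0" by (simp add: LIMSEQ_const_iff)
    then have 1: "?a \<odot> w = v k" using n2_eq_0[of "v k - ?a \<odot> w"] v w by simp
    have "(\<lambda>n. n2 (v (n + k) \<odot> ?b - w \<odot> ?b)) \<longlonglongrightarrow> 0"
      by (rule n2_limit_comp_const(2)[OF v(1) w(1) shift]) (simp add: v)
    then have "(\<lambda>n. n2 (v k - w \<odot> ?b)) \<longlonglongrightarrow> 0" by (simp only: e)
    then have "n2 (v k - w \<odot> ?b) = 0" by (simp add: LIMSEQ_const_iff)
    then have 2: "w \<odot> ?b = v k" using n2_eq_0[of "v k - w \<odot> ?b"] v w by simp
    show ?thesis using 1 2 by (simp add: extends_def comp_assoc)
  qed
  then show ?thesis using that w pw by blast
qed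

text \<open>The polar decomposition, reduced to the existence of the partial isometry. It is the strong limit of
  \<open>x (1/n + \<bar>x\<bar>)\<inverse>\<close>.\<close>

lemma polar_partial_isometry:
  assumes x: "x \<in> M" "x \<noteq> 0"
  obtains w where "w \<in> M" "partial_isometry w" "w \<noteq> 0"
    "\<And>q. q \<in> M \<Longrightarrow> q \<odot> x = x \<Longrightarrow> q \<odot> w = w" "\<And>p. p \<in> M \<Longrightarrow> x \<odot> p = x \<Longrightarrow> w \<odot> p = w"
proof -
  obtain h where h: "h \<in> M" "positive h" "h \<odot> h = x\<^sup>\<star> \<odot> x"
    using M_sqrt[of "x\<^sup>\<star> \<odot> x"] positive_adj_comp[of x] x by auto
  have hs: "h\<^sup>\<star> = h" by (rule positiveD[OF h(2)])
  have nx: "norm (x y) = norm (h y)" for y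
  proof -
    have "(norm (x y))\<^sup>2 = inner y ((x\<^sup>\<star> \<odot> x) y)" using x by (simp add: adj_inner' power2_norm_eq_inner)
    also have "\<dots> = (norm (h y))\<^sup>2" using positiveD(4)[OF h(2), of y "h y"] by (simp add: power2_norm_eq_inner flip: h(3))
    finally show ?thesis by (simp add: power2_eq_iff_nonneg)
  qed
  obtain P where P: "P \<in> M" "projection P" "\<And>y. blinfun_apply P y = y \<longleftrightarrow> (\<forall>a\<in>{h}. blinfun_apply a y = 0)"
    "\<And>a. a \<in> {h} \<Longrightarrow> a \<odot> P = 0"
    by (rule kernel_projection[of "{h}"]) (use h in simp, rule that)
  have hP: "h \<odot> P = 0" using P(4) by simp
  have P_iff: "P y = y \<longleftrightarrow> h y = 0" for y using P(3) by simp
  have Ps: "P\<^sup>\<star> = P" by (rule projectionD[OF P(2)])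
  have xz: "x y = 0" if "h y = 0" for y using nx[of y] that by simp
  have xP: "x (P y) = 0" for y
    using hP xz[of "P y"] by (metis blinfun_apply_blinfun_compose blinfun.zero_left)
  have "\<exists>R. R \<in> M \<and> positive R \<and> (id_blinfun + real n *\<^sub>R h) \<odot> R = id_blinfun \<and> R \<odot> (id_blinfun + real n *\<^sub>R h) = id_blinfun" for n
    using positive_inverse[of "real n *\<^sub>R h"] M_bicommutant_subset[of "real n *\<^sub>R h"] positive_scaleR[OF h(2)] h(1) by auto
  then obtain R where R: "\<And>n. R n \<in> M" "\<And>n. positive (R n)"
    "\<And>n. (id_blinfun + real n *\<^sub>R h) \<odot> R n = id_blinfun" "\<And>n. R n \<odot> (id_blinfun + real n *\<^sub>R h) = id_blinfun"
    by metis
  have R1: "R n y + real n *\<^sub>R h (R n y) = y" for n y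
    using arg_cong[OF R(3)[of n], of "\<lambda>a. blinfun_apply a y"] by (simp add: blinfun.bilinear_simps)
  have R2: "R n y + real n *\<^sub>R R n (h y) = y" for n y
    using arg_cong[OF R(4)[of n], of "\<lambda>a. blinfun_apply a y"] by (simp add: blinfun.bilinear_simps)
  have Rn: "norm (y - R n y) \<le> norm y" for n y
  proof -
    have "positive (id_blinfun - R n)"
      unfolding positive_iff
    proof (intro conjI allI)
      fix y
      let ?z = "R n y"
      have "inner y (y - ?z) = inner (?z + real n *\<^sub>R h ?z) (real n *\<^sub>R h ?z)"
        using R1[of n y] by (metis add_diff_cancel_left')
      also have "\<dots> = real n * inner ?z (h ?z) + (norm (real n *\<^sub>R h ?z))\<^sup>2"
        unfolding power2_norm_eq_inner by (simp add: inner_add_left algebra_simps)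
      also have "\<dots> \<ge> 0" using positiveD(3)[OF h(2), of ?z] by (intro add_nonneg_nonneg mult_nonneg_nonneg) auto
      finally show "0 \<le> inner y ((id_blinfun - R n) y)" by (simp add: blinfun.bilinear_simps)
    qed (use positiveD[OF R(2)] in auto)
    then have "norm (id_blinfun - R n) \<le> 1" using R(2)[of n] by (intro positive_le_id_norm) auto
    then have "norm ((id_blinfun - R n) y) \<le> 1 * norm y"
      by (meson norm_blinfun mult_right_mono norm_ge_zero order_trans)
    then show ?thesis by (simp add: blinfun.bilinear_simps)
  qed
  have hR: "real n * norm (h (R n y)) \<le> norm y" for n y
  proof -
    have "real n *\<^sub>R h (R n y) = y - R n y" using R1[of n y] by (metis add_diff_cancel_left')
    then have "norm (real n *\<^sub>R h (R n y)) \<le> norm y" using Rn by simp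
    then show ?thesis by simp
  qed
  define a where "a n = real n *\<^sub>R (x \<odot> R n)" for n
  have aM: "a n \<in> M" for n using x R by (simp add: a_def)
  have a1: "norm (a n) \<le> 1" for n
    by (rule norm_blinfun_bound) (use hR[of n] in \<open>simp_all add: a_def blinfun.bilinear_simps nx\<close>)
  have ah: "(\<lambda>n. a n (h y)) \<longlonglongrightarrow> x y" for y
  proof -
    have eq: "a n (h y) = x y - x (R n y)" for n
    proof -
      have "real n *\<^sub>R R n (h y) = y - R n y" using R2[of n y] by (metis add_diff_cancel_left')
      then have "x (real n *\<^sub>R R n (h y)) = x (y - R n y)" by simp
      then show ?thesis by (simp add: a_def blinfun.bilinear_simps)
    qed
    have bnd: "norm (x (R (Suc n) y)) \<le> norm y * inverse (real (Suc n))" for n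
      using hR[of "Suc n" y] by (simp add: nx field_simps)
    have "(\<lambda>n. norm y * inverse (real (Suc n))) \<longlonglongrightarrow> 0"
      using tendsto_mult_left[OF LIMSEQ_inverse_real_of_nat, of "norm y"] by simp
    then have "(\<lambda>n. x (R (Suc n) y)) \<longlonglongrightarrow> 0"
      using Lim_null_comparison[of "\<lambda>n. x (R (Suc n) y)" "\<lambda>n. norm y * inverse (real (Suc n))" sequentially] bnd by simp
    then have "(\<lambda>n. x (R n y)) \<longlonglongrightarrow> 0" by (rule LIMSEQ_imp_Suc)
    then have "(\<lambda>n. x y - x (R n y)) \<longlonglongrightarrow> x y - 0" by (intro tendsto_diff tendsto_const)
    then show ?thesis by (simp add: eq)
  qed
  have aP: "a n (P y) = 0" for n y
  proof -
    have "h (P y) = 0" using hP by (metis blinfun_apply_blinfun_compose blinfun.zero_left)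
    then have "R n (P y) = P y" using R2[of n "P y"] by (simp add: blinfun.bilinear_simps)
    then show ?thesis by (simp add: a_def blinfun.bilinear_simps xP)
  qed
  obtain w where w: "w \<in> M" "norm w \<le> 1" "\<And>y. (\<lambda>n. blinfun_apply (a n) y) \<longlonglongrightarrow> blinfun_apply w y"
  proof (rule strong_limit_exists[of a 1 "{h, P}", OF aM a1])
    show "{h, P} \<subseteq> M" using h P by simp
    show "convergent (\<lambda>n. a n (r y))" if "r \<in> {h, P}" for r y
    proof -
      have "convergent (\<lambda>n. a n (h y))" using ah by (auto simp: convergent_def)
      moreover have "convergent (\<lambda>n. a n (P y))" by (simp add: aP convergent_const)
      ultimately show ?thesis using that by auto
    qed
    show "y = 0" if "\<And>r. r \<in> {h, P} \<Longrightarrow> blinfun_apply (r\<^sup>\<star>) y = 0" for y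
      using that[of h] that[of P] P_iff[of y] by (simp add: hs Ps)
  qed (rule that)
  have wh: "w \<odot> h = x"
    by (rule blinfun_eqI) (use LIMSEQ_unique[OF w(3) ah] in simp)
  have wP: "w \<odot> P = 0"
  proof (rule blinfun_eqI)
    fix y
    have "(\<lambda>n. a n (P y)) \<longlonglongrightarrow> w (P y)" by (rule w)
    then show "(w \<odot> P) y = blinfun_apply 0 y" by (simp add: aP LIMSEQ_const_iff)
  qed
  have absorb: "P \<odot> z = z" if "h \<odot> z = 0" for z
  proof (rule blinfun_eqI)
    fix y
    have "h (z y) = 0" using that by (metis blinfun_apply_blinfun_compose blinfun.zero_left)
    then show "(P \<odot> z) y = z y" by (simp add: P_iff)
  qed
  have vanish: "T = 0" if T: "T \<in> M" "T \<odot> h = 0" "T \<odot> P = 0" for T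
  proof -
    have "h \<odot> T\<^sup>\<star> = 0" using arg_cong[OF T(2), of adj] T(1) h(1) by (simp add: hs)
    then have "P \<odot> T\<^sup>\<star> = T\<^sup>\<star>" by (rule absorb)
    then have "(P \<odot> T\<^sup>\<star>)\<^sup>\<star> = (T\<^sup>\<star>)\<^sup>\<star>" by simp
    then have "T \<odot> P = T" using T(1) P(1) by (simp add: Ps)
    then show ?thesis using T by simp
  qed
  have wwh: "w\<^sup>\<star> \<odot> w \<odot> h = h"
  proof -
    let ?z = "w\<^sup>\<star> \<odot> x - h"
    have xsw: "h \<odot> w\<^sup>\<star> = x\<^sup>\<star>" using arg_cong[OF wh, of adj] w(1) h(1) by (simp add: hs)
    have Pw: "P \<odot> w\<^sup>\<star> = 0" using arg_cong[OF wP, of adj] w(1) P(1) by (simp add: Ps)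
    have Ph: "P \<odot> h = 0" using arg_cong[OF hP, of adj] h(1) P(1) by (simp add: Ps hs)
    have "h \<odot> ?z = (h \<odot> w\<^sup>\<star>) \<odot> x - h \<odot> h" by (simp add: comp_distribs comp_assoc)
    then have "h \<odot> ?z = 0" by (simp add: xsw h(3))
    then have "?z = P \<odot> ?z" by (rule absorb[symmetric])
    also have "\<dots> = (P \<odot> w\<^sup>\<star>) \<odot> x - P \<odot> h" by (simp add: comp_distribs comp_assoc)
    also have "\<dots> = 0" by (simp add: Pw Ph comp_distribs)
    finally show ?thesis by (simp add: comp_assoc wh)
  qed
  have "w \<odot> w\<^sup>\<star> \<odot> w - w = 0"
  proof (rule vanish)
    have "(w \<odot> w\<^sup>\<star> \<odot> w - w) \<odot> h = w \<odot> (w\<^sup>\<star> \<odot> w \<odot> h) - w \<odot> h" by (simp add: comp_distribs comp_assoc)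
    then show "(w \<odot> w\<^sup>\<star> \<odot> w - w) \<odot> h = 0" by (simp only: wwh) simp
    show "(w \<odot> w\<^sup>\<star> \<odot> w - w) \<odot> P = 0" by (simp add: comp_distribs comp_assoc wP)
  qed (use w in simp)
  then have 1: "partial_isometry w" by (simp add: partial_isometry_def)
  have 2: "w \<noteq> 0" using wh x by (auto simp: comp_distribs)
  have 3: "q \<odot> w = w" if q: "q \<in> M" "q \<odot> x = x" for q
  proof -
    have "q \<odot> w - w = 0"
      by (rule vanish) (use q w in \<open>simp_all add: comp_distribs comp_assoc wh wP\<close>)
    then show ?thesis by simp
  qed
  have 4: "w \<odot> p = w" if p: "p \<in> M" "x \<odot> p = x" for p
  proof -
    have "h \<odot> (id_blinfun - p) = 0"
    proof (rule blinfun_eqI)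
      fix y
      have "x (y - p y) = 0" using arg_cong[OF p(2), of "\<lambda>a. blinfun_apply a y"] by (simp add: blinfun.bilinear_simps)
      then show "(h \<odot> (id_blinfun - p)) y = blinfun_apply 0 y"
        using nx[of "y - p y"] by (simp add: blinfun.bilinear_simps)
    qed
    then have "P \<odot> (id_blinfun - p) = id_blinfun - p" by (rule absorb)
    then have "w \<odot> (id_blinfun - p) = (w \<odot> P) \<odot> (id_blinfun - p)" by (simp add: comp_assoc)
    then show ?thesis by (simp add: wP comp_distribs)
  qed
  show ?thesis by (rule that[OF w(1) 1 2 3 4])
qed

end


section \<open>Comparison of projections in a factor\<close>

locale tracial_factor = tracial M tr
  for M :: "'h::chilbert_space operator set" and tr +
  assumes factor: "factor M"
begin

text \<open>In a factor the projection onto the common kernel of all \<open>qx\<close>, \<open>x \<in> M\<close>, is central, hence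
  a scalar.\<close>

lemma factor_connect:
  assumes p: "p \<in> M" "p \<noteq> 0" and q: "q \<in> M" "q \<noteq> 0"
  shows "\<exists>x\<in>M. q \<odot> x \<odot> p \<noteq> 0"
proof (rule ccontr)
  assume "\<not> ?thesis"
  then have z: "q \<odot> x \<odot> p = 0" if "x \<in> M" for x using that by blast
  let ?X = "{q \<odot> x | x. x \<in> M}"
  have XM: "?X \<subseteq> M" using q by auto
  obtain e where e: "e \<in> M" "projection e" "\<And>x. blinfun_apply e x = x \<longleftrightarrow> (\<forall>a\<in>?X. blinfun_apply a x = 0)"
    "\<And>a. a \<in> ?X \<Longrightarrow> a \<odot> e = 0"
    "\<And>b. b \<in> bounded_ops \<Longrightarrow> \<forall>x. (\<forall>a\<in>?X. a x = 0) \<longrightarrow> (\<forall>a\<in>?X. a (b x) = 0 \<and> a ((b\<^sup>\<star>) x) = 0) \<Longrightarrow>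
      b \<odot> e = e \<odot> b"
    by (rule kernel_projection_commuting[OF XM]) (rule that)
  have inv: "\<forall>a\<in>?X. a (b x) = 0" if b: "b \<in> M" and x: "\<forall>a\<in>?X. a x = 0" for b x
  proof
    fix a assume "a \<in> ?X"
    then obtain y where y: "y \<in> M" "a = q \<odot> y" by blast
    have "q \<odot> (y \<odot> b) \<in> ?X" using y(1) b by (intro CollectI exI[of _ "y \<odot> b"]) simp
    with x have "(q \<odot> (y \<odot> b)) x = 0" by (rule bspec)
    then show "a (b x) = 0" by (simp add: y)
  qed
  have "b \<odot> e = e \<odot> b" if b: "b \<in> M" for b
    by (rule e(5)) (use inv[OF b] inv[OF M_adj[OF b]] b in simp_all)
  then have "e \<in> M \<inter> commutant M" using e(1) by (simp add: commutant_def)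
  then obtain c where c: "e = c *\<^sub>O id_blinfun" using factor unfolding factor_def by blast
  have "e \<odot> p = p"
  proof (rule blinfun_eqI)
    fix x
    have "\<forall>a\<in>?X. a (p x) = 0"
    proof
      fix a assume "a \<in> ?X"
      then obtain y where y: "y \<in> M" "a = q \<odot> y" by blast
      then have "(q \<odot> y \<odot> p) x = 0" using z[OF y(1)] by simp
      then show "a (p x) = 0" by (simp add: y)
    qed
    then show "(e \<odot> p) x = p x" using e(3)[of "p x"] by simp
  qed
  then have 1: "c *\<^sub>O p = p" by (simp add: c scale_op_comp comp_distribs)
  have "q \<odot> id_blinfun \<in> ?X" by (intro CollectI exI[of _ id_blinfun]) simp
  then have "q \<odot> id_blinfun \<odot> e = 0" by (rule e(4))
  then have 2: "c *\<^sub>O q = 0" using q by (simp add: c comp_scale_op comp_distribs)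
  have "c \<noteq> 0" using 1 p scale_op_scaleR[of 0 p] by auto
  then have "q = inverse c *\<^sub>O c *\<^sub>O q" by (simp add: scale_op_scale_op)
  also have "\<dots> = 0" unfolding 2 using scale_op_linear(2)[of "inverse c" 0 0] by simp
  finally show False using q by simp
qed

text \<open>A partial isometry between the two projections that is maximal for extension leaves nothing over:
  the complements have equal trace, and if they are nonzero, the factor provides a nonzero partial
  isometry between them.\<close>

lemma equivalent_projections:
  assumes p: "p \<in> M" "projection p" and q: "q \<in> M" "projection q" and tr: "tr p = tr q"
  shows "\<exists>v\<in>M. v\<^sup>\<star> \<odot> v = p \<and> v \<odot> v\<^sup>\<star> = q"
proof -
  let ?S = "{v \<in> M. partial_isometry v \<and> v \<odot> p = v \<and> q \<odot> v = v}"
  let ?t = "\<lambda>v. (n2 v)\<^sup>2"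
  have "\<exists>m\<in>?S. \<forall>y\<in>?S. extends m y \<longrightarrow> ?t y \<le> ?t m"
  proof (rule greedy_maximal[where C = 1])
    show "0 \<in> ?S" by (simp add: partial_isometry_def comp_distribs)
    show "?t v \<le> 1" if "v \<in> ?S" for v
      using that n2_le_norm[of v] partial_isometry_norm[of v] by (auto intro!: power_le_one)
    show "extends v v" if "v \<in> ?S" for v using that extends_refl by auto
    show "extends v z" if "v \<in> ?S" "w \<in> ?S" "z \<in> ?S" "extends v w" "extends w z" for v w z
      using that extends_trans[of v w z] by auto
    show "?t v \<le> ?t w" if "v \<in> ?S" "w \<in> ?S" "extends v w" for v w
      using extends_n2[of v w] that by (metis (mono_tags, lifting) diff_ge_0_iff_ge mem_Collect_eq zero_le_power2)
    show "\<exists>b\<in>?S. \<forall>n. extends (f n) b" if f: "\<And>n. f n \<in> ?S" "\<And>n. extends (f n) (f (Suc n))" for f :: "nat \<Rightarrow> _"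
    proof -
      have fM: "f n \<in> M" "partial_isometry (f n)" "f n \<odot> p = f n" "q \<odot> f n = f n" for n using f(1) by auto
      obtain w where w: "w \<in> M" "partial_isometry w" "\<And>n. extends (f n) w" "(\<lambda>n. n2 (f n - w)) \<longlonglongrightarrow> 0"
        by (rule extends_chain[of f, OF fM(1,2) f(2)]) (rule that)
      have "(\<lambda>n. n2 (f n \<odot> p - w \<odot> p)) \<longlonglongrightarrow> 0" by (rule n2_limit_comp_const(2)[OF fM(1) w(1,4)]) (rule p)
      then have "(\<lambda>n. n2 (f n - w \<odot> p)) \<longlonglongrightarrow> 0" by (simp only: fM)
      then have "w \<odot> p = w" using fM(1) w p by (intro n2_limit_unique[of f "w \<odot> p" w]) simp_all
      moreover have "(\<lambda>n. n2 (q \<odot> f n - q \<odot> w)) \<longlonglongrightarrow> 0" by (rule n2_limit_comp_const(1)[OF fM(1) w(1,4)]) (rule q)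
      then have "(\<lambda>n. n2 (f n - q \<odot> w)) \<longlonglongrightarrow> 0" by (simp only: fM)
      then have "q \<odot> w = w" using fM(1) w q by (intro n2_limit_unique[of f "q \<odot> w" w]) simp_all
      ultimately show ?thesis using w by blast
    qed
  qed
  then obtain v where v: "v \<in> M" "partial_isometry v" "v \<odot> p = v" "q \<odot> v = v"
    and max: "\<And>y. y \<in> ?S \<Longrightarrow> extends v y \<Longrightarrow> ?t y \<le> ?t v" by blast
  note ps = projectionD(2,3)[OF p(2)] and qs = projectionD(2,3)[OF q(2)]
  define p' where "p' = p - v\<^sup>\<star> \<odot> v"
  define q' where "q' = q - v \<odot> v\<^sup>\<star>"
  have M': "p' \<in> M" "q' \<in> M" using p q v by (simp_all add: p'_def q'_def)
  have pvs: "p \<odot> v\<^sup>\<star> = v\<^sup>\<star>" using arg_cong[OF v(3), of adj] v(1) p(1) by (simp add: ps)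
  have vsq: "v\<^sup>\<star> \<odot> q = v\<^sup>\<star>" using arg_cong[OF v(4), of adj] v(1) q(1) by (simp add: qs)
  have vv: "v \<odot> (v\<^sup>\<star> \<odot> v) = v" "v\<^sup>\<star> \<odot> (v \<odot> v\<^sup>\<star>) = v\<^sup>\<star>"
    using v(1,2) partial_isometry_adj[OF v(1,2)] by (simp_all add: partial_isometry_def comp_assoc)
  have vp': "v \<odot> p' = 0" and vq': "v\<^sup>\<star> \<odot> q' = 0" by (simp_all add: p'_def q'_def comp_distribs v vv vsq)
  have trp: "tr p' = tr q'" using p q v tr tr_commute[of v "v\<^sup>\<star>"] by (simp add: p'_def q'_def tr_diff)
  have proj': "projection p'" "projection q'"
  proof -
    have pv: "p \<odot> (v\<^sup>\<star> \<odot> v) = v\<^sup>\<star> \<odot> v" using pvs by (metis comp_assoc)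
    have "p' \<odot> p' = p'"
      by (simp add: p'_def comp_distribs comp_assoc ps pv v vv)
    then show "projection p'" using p v by (simp add: projection_def p'_def ps)
    have qv: "q \<odot> (v \<odot> v\<^sup>\<star>) = v \<odot> v\<^sup>\<star>" using v(4) by (metis comp_assoc)
    have "q' \<odot> q' = q'"
      by (simp add: q'_def comp_distribs comp_assoc qs qv vsq vv)
    then show "projection q'" using q v by (simp add: projection_def q'_def qs)
  qed
  have "p' = 0"
  proof (rule ccontr)
    assume p0: "p' \<noteq> 0"
    then have "0 < Re (tr q')" using projection_tr_pos[OF M'(1) proj'(1)] trp by simp
    then have q0: "q' \<noteq> 0" using tr_zero by auto
    obtain x where x: "x \<in> M" "q' \<odot> x \<odot> p' \<noteq> 0" using factor_connect[OF M'(1) p0 M'(2) q0] by blast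
    let ?x = "q' \<odot> x \<odot> p'"
    have xM: "?x \<in> M" using x M' by simp
    obtain w where w: "w \<in> M" "partial_isometry w" "w \<noteq> 0"
      and wq: "\<And>q. q \<in> M \<Longrightarrow> q \<odot> ?x = ?x \<Longrightarrow> q \<odot> w = w" and wp: "\<And>p. p \<in> M \<Longrightarrow> ?x \<odot> p = ?x \<Longrightarrow> w \<odot> p = w"
      by (rule polar_partial_isometry[OF xM x(2)]) (rule that)
    have q'w: "q' \<odot> w = w"
    proof (rule wq[OF M'(2)])
      have "q' \<odot> ?x = (q' \<odot> q') \<odot> x \<odot> p'" by (simp only: comp_assoc)
      then show "q' \<odot> ?x = ?x" using projectionD(3)[OF proj'(2)] by simp
    qed
    have wp': "w \<odot> p' = w"
    proof (rule wp[OF M'(1)])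
      have "?x \<odot> p' = q' \<odot> x \<odot> (p' \<odot> p')" by (simp only: comp_assoc)
      then show "?x \<odot> p' = ?x" using projectionD(3)[OF proj'(1)] by simp
    qed
    have vsw: "v\<^sup>\<star> \<odot> w = 0"
    proof -
      have "v\<^sup>\<star> \<odot> w = (v\<^sup>\<star> \<odot> q') \<odot> w" by (simp only: q'w comp_assoc)
      then show ?thesis by (simp add: vq' comp_distribs)
    qed
    have p'ws: "p' \<odot> w\<^sup>\<star> = w\<^sup>\<star>" using arg_cong[OF wp', of adj] w M' projectionD(2)[OF proj'(1)] by simp
    have vws: "v \<odot> w\<^sup>\<star> = 0"
    proof -
      have "v \<odot> w\<^sup>\<star> = (v \<odot> p') \<odot> w\<^sup>\<star>" by (simp only: p'ws comp_assoc)
      then show ?thesis by (simp add: vp' comp_distribs)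
    qed
    have wsv: "w\<^sup>\<star> \<odot> v = 0" using arg_cong[OF vsw, of adj] w v by simp
    have wvs: "w \<odot> v\<^sup>\<star> = 0" using arg_cong[OF vws, of adj] w v by simp
    have wvs': "w \<odot> (v\<^sup>\<star> \<odot> y) = 0" "v \<odot> (w\<^sup>\<star> \<odot> y) = 0" for y :: "'h operator"
      using comp_assoc[of w "v\<^sup>\<star>" y] comp_assoc[of v "w\<^sup>\<star>" y] by (simp_all add: wvs vws comp_distribs)
    have ww: "w \<odot> (w\<^sup>\<star> \<odot> w) = w" using w by (simp add: partial_isometry_def comp_assoc)
    let ?y = "v + w"
    have "?y \<odot> (?y\<^sup>\<star> \<odot> ?y) = ?y"
      using v(1) w(1) by (simp add: comp_distribs vsw wsv wvs' vv ww)
    then have "partial_isometry ?y" by (simp add: partial_isometry_def comp_assoc)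
    moreover have "w \<odot> p = w"
    proof -
      have "p' \<odot> p = p'" by (simp add: p'_def comp_distribs comp_assoc ps v)
      then show ?thesis using wp' by (metis comp_assoc)
    qed
    moreover have "q \<odot> w = w"
    proof -
      have "q \<odot> q' = q'" using v(4) by (simp add: q'_def comp_distribs qs flip: comp_assoc)
      then show ?thesis using q'w by (metis comp_assoc)
    qed
    ultimately have yS: "?y \<in> ?S" using v w by (simp add: comp_distribs)
    have "extends v ?y"
      using w v by (simp add: extends_def comp_assoc comp_distribs vsw wvs' vv)
    then have "?t ?y \<le> ?t v" using max[OF yS] by blast
    moreover have "?t ?y = ?t v + ?t w"
    proof -
      have "ip v w = 0" by (simp add: ip_def vsw tr_zero)
      then show ?thesis using v(1) w(1) ip_commute[of v w] by (simp add: n2_sq ip_add_left ip_add_right)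
    qed
    ultimately have "?t w \<le> 0" by simp
    then show False using n2_eq_0[OF w(1)] w(3) by simp
  qed
  moreover have "q' = 0"
  proof (rule ccontr)
    assume "q' \<noteq> 0"
    then show False using projection_tr_pos[OF M'(2) proj'(2)] trp \<open>p' = 0\<close> tr_zero by simp
  qed
  ultimately show ?thesis using v by (intro bexI[of _ v]) (simp_all add: p'_def q'_def)
qed

end


section \<open>Masas of type II1 factors are diffuse\<close>

locale masa_in_II1 = masa_in M tr A
  for M :: "'h::chilbert_space operator set" and tr :: "'h operator \<Rightarrow> complex" and A +
  assumes II1: "type_II1_factor M"
begin

sublocale tracial_factor M tr
  by unfold_locales (use II1 in \<open>simp add: type_II1_factor_def\<close>)

lemma abelian_projection_zero: "abelian_projection M e \<Longrightarrow> e = 0"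
  using II1 by (simp add: type_II1_factor_def)

lemma kernel_projection_in_masa:
  assumes c: "c \<in> A"
  obtains P where "P \<in> A" "projection P" "\<And>x. blinfun_apply P x = x \<longleftrightarrow> blinfun_apply c x = 0" "c \<odot> P = 0"
proof -
  have cM: "{c} \<subseteq> M" using c by simp
  obtain P where P: "P \<in> M" "projection P" "\<And>x. blinfun_apply P x = x \<longleftrightarrow> (\<forall>a\<in>{c}. blinfun_apply a x = 0)"
    "\<And>a. a \<in> {c} \<Longrightarrow> a \<odot> P = 0"
    "\<And>b. b \<in> bounded_ops \<Longrightarrow> \<forall>x. (\<forall>a\<in>{c}. a x = 0) \<longrightarrow> (\<forall>a\<in>{c}. a (b x) = 0 \<and> a ((b\<^sup>\<star>) x) = 0) \<Longrightarrow>
      b \<odot> P = P \<odot> b"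
    by (rule kernel_projection_commuting[OF cM]) (rule that)
  have ker: "c (b x) = 0" if "b \<in> A" "c x = 0" for b x
  proof -
    have "(c \<odot> b) x = (b \<odot> c) x" using A_commute[OF c that(1)] by simp
    then show ?thesis using that(2) by simp
  qed
  have "b \<odot> P = P \<odot> b" if "b \<in> A" for b
    by (rule P(5)) (use ker that in simp_all)
  then have "P \<in> A" using A_maximal[OF P(1)] by blast
  then show ?thesis using that P by simp
qed

text \<open>Let \<open>e\<close> be a minimal projection of the masa. For a self-adjoint \<open>c\<close> below \<open>e\<close> with absolute
  value \<open>m\<close>, the kernel projection of \<open>m - c\<close> restricted to \<open>e\<close> is \<open>0\<close> or \<open>e\<close>, so that one of the
  elements \<open>m + c\<close> and \<open>m - c\<close>, whose product is zero, vanishes.\<close>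

lemma minimal_sign:
  assumes e: "e \<in> A" "projection e"
    and min: "\<And>f. f \<in> A \<Longrightarrow> projection f \<Longrightarrow> e \<odot> f = f \<Longrightarrow> f = 0 \<or> f = e"
    and c: "c \<in> A" "c\<^sup>\<star> = c" "e \<odot> c = c"
  shows "positive c \<or> positive (- c)"
proof -
  note es = projectionD(2,3)[OF e(2)]
  have "positive (c \<odot> c)" using positive_adj_comp[of c] c by simp
  then obtain m0 where m0: "m0 \<in> A" "positive m0" "m0 \<odot> m0 = c \<odot> c"
    using A_sqrt[of "c \<odot> c"] c by auto
  define m where "m = e \<odot> m0"
  have em0: "m0 \<odot> e = e \<odot> m0" using A_commute e m0 by blast
  have mA: "m \<in> A" using e m0 by (simp add: m_def)
  have em: "e \<odot> m = m" using es by (simp add: m_def flip: comp_assoc)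
  have "positive (e\<^sup>\<star> \<odot> m0 \<odot> e)" using m0 e by (intro positive_sandwich) auto
  moreover have "e\<^sup>\<star> \<odot> m0 \<odot> e = m" using em em0 by (simp add: es m_def comp_assoc)
  ultimately have mpos: "positive m" by simp
  have "m \<odot> m = e \<odot> ((m0 \<odot> e) \<odot> m0)" by (simp add: m_def comp_assoc)
  also have "\<dots> = (e \<odot> e) \<odot> (m0 \<odot> m0)" by (simp only: em0 comp_assoc)
  also have "\<dots> = (e \<odot> c) \<odot> c" by (simp only: es m0(3) comp_assoc)
  finally have mm: "m \<odot> m = c \<odot> c" using c by simp
  have cm: "c \<odot> m = m \<odot> c" using A_commute c mA by blast
  have prod: "(m - c) \<odot> (m + c) = 0" by (simp add: comp_distribs mm cm)
  have mcA: "m - c \<in> A" using mA c by simp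
  obtain P where P: "P \<in> A" "projection P" "\<And>x. blinfun_apply P x = x \<longleftrightarrow> blinfun_apply (m - c) x = 0"
    "(m - c) \<odot> P = 0"
    by (rule kernel_projection_in_masa[OF mcA]) (rule that)
  have Pe: "P \<odot> e = e \<odot> P" using A_commute e P by blast
  let ?f = "e \<odot> P"
  have "?f \<odot> ?f = ?f"
  proof -
    have "?f \<odot> ?f = e \<odot> ((P \<odot> e) \<odot> P)" by (simp only: comp_assoc)
    also have "\<dots> = (e \<odot> e) \<odot> (P \<odot> P)" by (simp only: Pe comp_assoc)
    finally show ?thesis using projectionD(3)[OF P(2)] by (simp only: es)
  qed
  then have "projection ?f" using e P Pe projectionD(2)[OF P(2)] by (simp add: projection_def es)
  moreover have "e \<odot> ?f = ?f" using es by (simp flip: comp_assoc)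
  ultimately consider "?f = 0" | "?f = e" using min[of ?f] e P by auto
  then show ?thesis
  proof cases
    case 1
    have "P \<odot> (m + c) = m + c"
    proof (rule blinfun_eqI)
      fix x
      have "((m - c) \<odot> (m + c)) x = 0" using prod by simp
      then have "(m - c) ((m + c) x) = 0" by simp
      then show "(P \<odot> (m + c)) x = (m + c) x" using P(3) by simp
    qed
    then have "m + c = e \<odot> (P \<odot> (m + c))" using em c(3) by (simp add: comp_distribs)
    also have "\<dots> = ?f \<odot> (m + c)" by (simp only: comp_assoc)
    also have "\<dots> = 0" using 1 by (simp add: comp_distribs(11))
    finally have "m = - c" by (rule eq_neg_iff_add_eq_0[THEN iffD2])
    then show ?thesis using mpos by simp
  next
    case 2
    have "m - c = (m - c) \<odot> e" using A_commute[of "m - c" e] mA c e em by (simp add: comp_distribs)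
    also have "\<dots> = (m - c) \<odot> (P \<odot> e)" by (simp only: Pe 2)
    also have "\<dots> = ((m - c) \<odot> P) \<odot> e" by (simp only: comp_assoc)
    also have "\<dots> = 0" by (simp only: P(4) comp_distribs(11))
    finally have "c = m" by simp
    then show ?thesis using mpos by simp
  qed
qed

lemma le_of_smaller_multiples:
  fixes g k t :: real
  assumes "\<And>s. s < t \<Longrightarrow> s * k \<le> g" "0 \<le> k" shows "t * k \<le> g"
proof (rule ccontr)
  assume c: "\<not> t * k \<le> g"
  show False
  proof (cases "k = 0")
    case True then show False using assms(1)[of "t - 1"] c by simp
  next
    case False
    then have k: "0 < k" using assms(2) by simp
    then have "(g / k + t) / 2 < t" using c by (simp add: field_simps)
    then have "(g / k + t) / 2 * k \<le> g" by (rule assms(1))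
    then show False using c k by (simp add: field_simps)
  qed
qed

text \<open>All shifts \<open>a - s e\<close> have a definite sign, which changes at a single value of \<open>s\<close>.\<close>

lemma minimal_scalar:
  assumes e: "e \<in> A" "projection e" "e \<noteq> 0"
    and min: "\<And>f. f \<in> A \<Longrightarrow> projection f \<Longrightarrow> e \<odot> f = f \<Longrightarrow> f = 0 \<or> f = e"
    and a: "a \<in> A" "a\<^sup>\<star> = a" "e \<odot> a = a"
  shows "\<exists>t. a = t *\<^sub>R e"
proof -
  note es = projectionD(2,3)[OF e(2)]
  have sign: "positive (a - s *\<^sub>R e) \<or> positive (- (a - s *\<^sub>R e))" for s
    by (rule minimal_sign[OF e(1,2) min]) (use a e es in \<open>auto simp: comp_distribs\<close>)
  obtain y where "e y \<noteq> 0" using e(3) by (metis blinfun_eqI blinfun.zero_left)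
  \<comment> \<open>A vector in the range of \<open>e\<close> determines the scalar.\<close>
  define z where "z = e y"
  have z: "z \<noteq> 0" "e z = z" using \<open>e y \<noteq> 0\<close> es by (auto simp: z_def simp flip: blinfun_apply_blinfun_compose)
  define t where "t = inner z (a z) / (norm z)\<^sup>2"
  have tz: "inner z (a z) = t * (norm z)\<^sup>2" using z by (simp add: t_def)
  have zz: "inner z ((a - s *\<^sub>R e) z) = (t - s) * (norm z)\<^sup>2" for s
    using z by (simp add: blinfun.bilinear_simps inner_diff_right tz algebra_simps power2_norm_eq_inner)
  have n0: "0 < (norm z)\<^sup>2" using z by simp
  have lo: "positive (a - s *\<^sub>R e)" if "s < t" for s
  proof (rule ccontr)
    assume "\<not> positive (a - s *\<^sub>R e)"
    then have "0 \<le> inner z ((- (a - s *\<^sub>R e)) z)" using sign positiveD(3) by blast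
    then have "(t - s) * (norm z)\<^sup>2 \<le> 0" using zz[of s] by (simp only: blinfun.minus_left inner_minus_right)
    moreover have "0 < (t - s) * (norm z)\<^sup>2" using that n0 by (intro mult_pos_pos) auto
    ultimately show False by linarith
  qed
  have hi: "positive (- (a - s *\<^sub>R e))" if "t < s" for s
  proof (rule ccontr)
    assume "\<not> positive (- (a - s *\<^sub>R e))"
    then have "0 \<le> inner z ((a - s *\<^sub>R e) z)" using sign positiveD(3) by blast
    then have "0 \<le> (t - s) * (norm z)\<^sup>2" using zz[of s] by simp
    moreover have "0 < (s - t) * (norm z)\<^sup>2" using that n0 by (intro mult_pos_pos) auto
    ultimately show False by (simp add: algebra_simps)
  qed
  have epos: "0 \<le> inner x (e x)" for x using positiveD(3)[OF projectionD(4)[OF e(2)]] .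
  have ge: "t * inner x (e x) \<le> inner x (a x)" for x
  proof (rule le_of_smaller_multiples[OF _ epos])
    fix s assume "s < t"
    then show "s * inner x (e x) \<le> inner x (a x)"
      using positiveD(3)[OF lo, of s x] by (simp add: blinfun.bilinear_simps inner_diff_right)
  qed
  have le: "- t * inner x (e x) \<le> - inner x (a x)" for x
  proof (rule le_of_smaller_multiples[OF _ epos])
    fix s assume "s < - t"
    then have "t < - s" by simp
    then show "s * inner x (e x) \<le> - inner x (a x)"
      using positiveD(3)[OF hi, of "- s" x] by (simp add: blinfun.bilinear_simps inner_diff_right inner_add_right)
  qed
  have zero: "inner x ((a - t *\<^sub>R e) x) = 0" for x
    using ge[of x] le[of x] by (simp add: blinfun.bilinear_simps inner_diff_right)
  have "positive (a - t *\<^sub>R e)"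
    using a e es zero by (simp add: positive_iff)
  then have "norm (a - t *\<^sub>R e) \<le> 0" by (rule positive_norm_le) (simp_all add: zero)
  then show ?thesis by auto
qed

text \<open>If \<open>e\<close> were minimal in the masa, every \<open>exe\<close> would commute with the masa and hence lie in it,
  so that \<open>e\<close> would be an abelian projection.\<close>

lemma masa_diffuse:
  assumes e: "e \<in> A" "projection e" "e \<noteq> 0"
  shows "\<exists>f\<in>A. projection f \<and> e \<odot> f = f \<and> f \<noteq> 0 \<and> f \<noteq> e"
proof (rule ccontr)
  assume "\<not> ?thesis"
  then have min: "f = 0 \<or> f = e" if "f \<in> A" "projection f" "e \<odot> f = f" for f using that by blast
  note es = projectionD(2,3)[OF e(2)]
  have inA: "e \<odot> x \<odot> e \<in> A" if x: "x \<in> M" for x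
  proof (rule A_maximal)
    let ?y = "e \<odot> x \<odot> e"
    show "?y \<in> M" using x e by simp
    have sa: "a \<odot> ?y = ?y \<odot> a" if a: "a \<in> A" "a\<^sup>\<star> = a" for a
    proof -
      have ae: "a \<odot> e = e \<odot> a" using A_commute a e by blast
      have "\<exists>t. e \<odot> a = t *\<^sub>R e"
      proof (rule minimal_scalar[OF e min])
        show "(e \<odot> a)\<^sup>\<star> = e \<odot> a" using a e es ae by simp
        show "e \<odot> (e \<odot> a) = e \<odot> a" using es by (simp flip: comp_assoc)
      qed (use a e in auto)
      then obtain t where t: "e \<odot> a = t *\<^sub>R e" by blast
      have "a \<odot> ?y = (a \<odot> e) \<odot> x \<odot> e" by (simp only: comp_assoc)
      also have "\<dots> = t *\<^sub>R ?y" by (simp only: ae t comp_distribs)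
      also have "\<dots> = e \<odot> x \<odot> (e \<odot> a)" by (simp only: t comp_distribs)
      finally show ?thesis by (simp only: comp_assoc)
    qed
    fix a assume a: "a \<in> A"
    have aM: "a \<in> M" using a by simp
    have eq: "a = (1/2) *\<^sub>R (a + a\<^sup>\<star>) + \<i> *\<^sub>O ((- \<i> / 2) *\<^sub>O (a - a\<^sup>\<star>))" by (rule real_imag_parts(5)[OF aM])
    have h: "((1/2) *\<^sub>R (a + a\<^sup>\<star>)) \<odot> ?y = ?y \<odot> ((1/2) *\<^sub>R (a + a\<^sup>\<star>))"
      by (rule sa) (use real_imag_parts(3)[OF aM] a in auto)
    have k: "((- \<i> / 2) *\<^sub>O (a - a\<^sup>\<star>)) \<odot> ?y = ?y \<odot> ((- \<i> / 2) *\<^sub>O (a - a\<^sup>\<star>))"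
      by (rule sa) (use real_imag_parts(4)[OF aM] a in auto)
    have "(h + \<i> *\<^sub>O k) \<odot> ?y = ?y \<odot> (h + \<i> *\<^sub>O k)" if "h \<odot> ?y = ?y \<odot> h" "k \<odot> ?y = ?y \<odot> k" for h k
    proof -
      have "(h + \<i> *\<^sub>O k) \<odot> ?y = h \<odot> ?y + \<i> *\<^sub>O (k \<odot> ?y)" by (simp only: comp_distribs scale_op_comp)
      also have "\<dots> = ?y \<odot> (h + \<i> *\<^sub>O k)"
        using comp_scale_op[of ?y] x e that by (simp only: comp_distribs) simp
      finally show ?thesis .
    qed
    from this[OF h k] show "a \<odot> ?y = ?y \<odot> a" using eq by metis
  qed
  have "abelian_projection M e"
    unfolding abelian_projection_def using e inA A_commute by simp
  then show False using abelian_projection_zero e(3) by blast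
qed

lemma subprojection_compl:
  assumes "e \<in> A" "projection e" "f \<in> A" "projection f" "e \<odot> f = f"
  shows "projection (e - f)" "e \<odot> (e - f) = e - f"
proof -
  have fe: "f \<odot> e = f" using A_commute[of f e] assms by simp
  show "projection (e - f)" using assms fe by (simp add: projection_def comp_distribs)
  show "e \<odot> (e - f) = e - f" using assms by (simp add: projection_def comp_distribs)
qed

lemma small_projection:
  assumes e: "e \<in> A" "projection e" "e \<noteq> 0"
  shows "\<exists>f\<in>A. projection f \<and> e \<odot> f = f \<and> f \<noteq> 0 \<and> Re (tr f) \<le> (1/2) ^ n * Re (tr e)"
proof (induction n)
  case 0
  show ?case using e projectionD(3)[OF e(2)] by (intro bexI[of _ e]) auto
next
  case (Suc n)
  then obtain f where f: "f \<in> A" "projection f" "e \<odot> f = f" "f \<noteq> 0" "Re (tr f) \<le> (1/2) ^ n * Re (tr e)" by blast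
  obtain g where g: "g \<in> A" "projection g" "f \<odot> g = g" "g \<noteq> 0" "g \<noteq> f" using masa_diffuse[OF f(1,2,4)] by blast
  note k = subprojection_compl[OF f(1,2) g(1,2,3)]
  have sub: "e \<odot> h = h" if "f \<odot> h = h" for h using that f(3) by (metis comp_assoc)
  have "Re (tr g) + Re (tr (f - g)) = Re (tr f)" using f g by (simp add: tr_diff)
  then consider "Re (tr g) \<le> (1/2) ^ Suc n * Re (tr e)" | "Re (tr (f - g)) \<le> (1/2) ^ Suc n * Re (tr e)"
    using f(5) by fastforce
  then show ?case
  proof cases
    case 1 then show ?thesis using g sub by blast
  next
    case 2 then show ?thesis using k sub[OF k(2)] f(1) g(1,5) by (intro bexI[of _ "f - g"]) auto
  qed
qed

text \<open>A projection of the masa that is maximal among those of trace at most one half has trace one half,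
  as its complement contains projections of arbitrarily small trace.\<close>

lemma half_projection: "\<exists>f\<in>A. projection f \<and> Re (tr f) = 1/2"
proof -
  let ?S = "{f \<in> A. projection f \<and> Re (tr f) \<le> 1/2}"
  have pi: "partial_isometry f" if "projection f" for f :: "'h operator"
    using that by (simp add: partial_isometry_def projection_def)
  have "\<exists>m\<in>?S. \<forall>y\<in>?S. extends m y \<longrightarrow> Re (tr y) \<le> Re (tr m)"
  proof (rule greedy_maximal[where C = "1/2"])
    show "0 \<in> ?S" by (simp add: projection_def comp_distribs tr_zero)
    show "extends v v" if "v \<in> ?S" for v using that extends_refl pi by auto
    show "extends v z" if "v \<in> ?S" "w \<in> ?S" "z \<in> ?S" "extends v w" "extends w z" for v w z
      using that extends_trans[of v w z] pi by auto
    show "Re (tr v) \<le> Re (tr w)" if "v \<in> ?S" "w \<in> ?S" "extends v w" for v w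
    proof -
      have "(n2 (w - v))\<^sup>2 = (n2 w)\<^sup>2 - (n2 v)\<^sup>2" using that by (intro extends_n2 pi) auto
      then have "(n2 v)\<^sup>2 \<le> (n2 w)\<^sup>2" by (metis diff_ge_0_iff_ge zero_le_power2)
      then show ?thesis using that by (simp add: projection_tr)
    qed
    show "\<exists>b\<in>?S. \<forall>n. extends (f n) b" if f: "\<And>n. f n \<in> ?S" "\<And>n. extends (f n) (f (Suc n))" for f :: "nat \<Rightarrow> _"
    proof -
      have fA: "f n \<in> A" "projection (f n)" "Re (tr (f n)) \<le> 1/2" for n using f(1) by auto
      have fM: "f n \<in> M" for n using fA by simp
      obtain w where w: "w \<in> M" "partial_isometry w" "\<And>n. extends (f n) w" "(\<lambda>n. n2 (f n - w)) \<longlonglongrightarrow> 0"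
        by (rule extends_chain[of f, OF fM pi[OF fA(2)] f(2)]) (rule that)
      have "w \<in> A"
      proof (rule A_maximal[OF w(1)])
        fix a assume a: "a \<in> A"
        have aM: "a \<in> M" using a by simp
        have l1: "(\<lambda>n. n2 (a \<odot> f n - a \<odot> w)) \<longlonglongrightarrow> 0" by (rule n2_limit_comp_const(1)[OF fM w(1,4)]) (rule aM)
        have "(\<lambda>n. n2 (f n \<odot> a - w \<odot> a)) \<longlonglongrightarrow> 0" by (rule n2_limit_comp_const(2)[OF fM w(1,4)]) (rule aM)
        moreover have "f n \<odot> a = a \<odot> f n" for n using A_commute a fA by blast
        ultimately have l2: "(\<lambda>n. n2 (a \<odot> f n - w \<odot> a)) \<longlonglongrightarrow> 0" by simp
        show "a \<odot> w = w \<odot> a" by (rule n2_limit_unique[OF _ _ _ l1 l2]) (use aM fM w in auto)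
      qed
      moreover have "projection w"
      proof -
        have "(\<lambda>n. n2 ((f n)\<^sup>\<star> - w\<^sup>\<star>)) \<longlonglongrightarrow> 0" by (rule n2_limit_adj[OF fM w(1,4)])
        moreover have "(f n)\<^sup>\<star> = f n" for n by (rule projectionD[OF fA(2)])
        ultimately have l1: "(\<lambda>n. n2 (f n - w\<^sup>\<star>)) \<longlonglongrightarrow> 0" by simp
        have ws: "w\<^sup>\<star> = w" by (rule n2_limit_unique[OF fM _ w(1) l1 w(4)]) (simp add: w)
        have "(\<lambda>n. n2 (f n \<odot> f n - w \<odot> w)) \<longlonglongrightarrow> 0"
          by (rule n2_limit_comp[OF fM fM w(1) w(1) projection_norm[OF fA(2)] w(4) w(4)])
        moreover have "f n \<odot> f n = f n" for n by (rule projectionD[OF fA(2)])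
        ultimately have l2: "(\<lambda>n. n2 (f n - w \<odot> w)) \<longlonglongrightarrow> 0" by simp
        have "w \<odot> w = w" by (rule n2_limit_unique[OF fM _ w(1) l2 w(4)]) (simp add: w)
        then show ?thesis using ws w(1) by (simp add: projection_def)
      qed
      moreover have "Re (tr w) \<le> 1/2"
      proof -
        have "(\<lambda>n. Re (tr (f n))) \<longlonglongrightarrow> Re (tr w)" by (intro tendsto_Re tr_limit[OF fM w(1,4)])
        then show ?thesis by (rule LIMSEQ_le_const2) (use fA in blast)
      qed
      ultimately show ?thesis using w(3) by blast
    qed
  qed simp
  then obtain f where f: "f \<in> A" "projection f" "Re (tr f) \<le> 1/2"
    and max: "\<And>y. y \<in> ?S \<Longrightarrow> extends f y \<Longrightarrow> Re (tr y) \<le> Re (tr f)" by blast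
  note fs = projectionD(2,3)[OF f(2)]
  have "\<not> Re (tr f) < 1/2"
  proof
    assume lt: "Re (tr f) < 1/2"
    let ?e = "id_blinfun - f"
    have e: "?e \<in> A" "projection ?e" using f projection_compl by auto
    have tre: "Re (tr ?e) = 1 - Re (tr f)" using f by (simp add: tr_diff tr_id)
    have e0: "?e \<noteq> 0" using tre lt tr_zero by auto
    have f0: "0 \<le> Re (tr f)" using f by (simp add: projection_tr)
    obtain n where n: "(1/2::real) ^ n < 1/2 - Re (tr f)" using real_arch_pow_inv[of "1/2 - Re (tr f)" "1/2"] lt by auto
    obtain g where g: "g \<in> A" "projection g" "?e \<odot> g = g" "g \<noteq> 0" "Re (tr g) \<le> (1/2) ^ n * Re (tr ?e)"
      using small_projection[OF e e0, of n] by blast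
    have "(1/2::real) ^ n * Re (tr ?e) \<le> (1/2) ^ n * 1" using tre f0 by (intro mult_left_mono) auto
    then have trg: "Re (tr g) \<le> 1/2 - Re (tr f)" using g(5) n by linarith
    have fg: "f \<odot> g = 0"
    proof -
      have "f \<odot> g = f \<odot> (?e \<odot> g)" by (simp only: g(3))
      also have "\<dots> = (f \<odot> ?e) \<odot> g" by (simp only: comp_assoc)
      finally show ?thesis by (simp add: comp_distribs fs)
    qed
    have gf: "g \<odot> f = 0" using fg A_commute[OF f(1) g(1)] by simp
    have "f + g \<in> ?S"
      using f g trg fg gf projectionD(2,3)[OF g(2)] by (simp add: projection_def comp_distribs fs tr_add)
    moreover have "extends f (f + g)" by (simp add: extends_def fs comp_distribs fg gf comp_assoc)
    ultimately have "Re (tr (f + g)) \<le> Re (tr f)" by (rule max)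
    then show False using projection_tr_pos[of g] f g by (simp add: tr_add)
  qed
  then show ?thesis using f by (intro bexI[of _ f]) auto
qed

text \<open>Hence the family defining the invariant of Popa is not empty.\<close>

lemma popa_isometry_exists:
  "\<exists>v\<in>M. v \<noteq> 0 \<and> partial_isometry v \<and> v \<odot> v\<^sup>\<star> \<in> A \<and> v\<^sup>\<star> \<odot> v \<in> A \<and> (v \<odot> v\<^sup>\<star>) \<odot> (v\<^sup>\<star> \<odot> v) = 0"
proof -
  obtain f where f: "f \<in> A" "projection f" "Re (tr f) = 1/2" using half_projection by blast
  note fs = projectionD(2,3)[OF f(2)]
  let ?e = "id_blinfun - f"
  have im: "Im (tr f) = 0" using tr_square_nonneg[of f] f by (simp add: fs)
  have "tr f = tr ?e" using f im by (simp add: tr_diff tr_id complex_eq_iff)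
  then obtain v where v: "v \<in> M" "v\<^sup>\<star> \<odot> v = f" "v \<odot> v\<^sup>\<star> = ?e"
    using equivalent_projections[of f ?e] f projection_compl[OF f(2)] by auto
  have "v \<noteq> 0" using v f tr_zero by (auto simp: comp_distribs)
  moreover have "partial_isometry v"
  proof -
    let ?z = "v \<odot> ?e"
    have "?z\<^sup>\<star> \<odot> ?z = ?e \<odot> (v\<^sup>\<star> \<odot> v) \<odot> ?e" using v(1) f by (simp add: fs comp_assoc)
    also have "\<dots> = 0" by (simp add: v comp_distribs fs)
    finally have "?z = 0" using tr_faithful[of ?z] v(1) f tr_zero by simp
    then have "v \<odot> f = v" by (simp add: comp_distribs)
    then show ?thesis by (simp add: partial_isometry_def comp_assoc v(2))
  qed
  moreover have "(v \<odot> v\<^sup>\<star>) \<odot> (v\<^sup>\<star> \<odot> v) = 0" by (simp add: v comp_distribs fs)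
  ultimately show ?thesis using v f by (intro bexI[of _ v]) auto
qed


section \<open>The inequality between the invariants\<close>

text \<open>The greatest constant is the infimum of the ratios \<open>\<delta>(vAv\<^sup>\<star>, A) / \<parallel>v\<^sup>\<star>v\<parallel>\<^sub>2\<close>.\<close>

lemma popa_ineq_le_delta_inv:
  assumes c: "popa_ineq M tr A c" shows "c \<le> delta_inv M tr A"
proof -
  let ?V = "{v \<in> M. v \<noteq> 0 \<and> partial_isometry v \<and> v \<odot> v\<^sup>\<star> \<in> A \<and> v\<^sup>\<star> \<odot> v \<in> A \<and> (v \<odot> v\<^sup>\<star>) \<odot> (v\<^sup>\<star> \<odot> v) = 0}"
  let ?r = "\<lambda>v. delta_dist M tr (conj_set v A) A / n2 (v\<^sup>\<star> \<odot> v)"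
  define c0 where "c0 = (INF v\<in>?V. ?r v)"
  have ne: "?V \<noteq> {}" using popa_isometry_exists by blast
  have pos: "0 < n2 (v\<^sup>\<star> \<odot> v)" if v: "v \<in> ?V" for v
  proof -
    have "v\<^sup>\<star> \<odot> v \<noteq> 0" using tr_faithful[of v] v tr_zero by auto
    then have "n2 (v\<^sup>\<star> \<odot> v) \<noteq> 0" using n2_eq_0[of "v\<^sup>\<star> \<odot> v"] v by auto
    moreover have "0 \<le> n2 (v\<^sup>\<star> \<odot> v)" using v by (intro n2_nonneg) simp
    ultimately show ?thesis by linarith
  qed
  have popa_iff: "popa_ineq M tr A k \<longleftrightarrow> (\<forall>v\<in>?V. k \<le> ?r v)" for k
    unfolding popa_ineq_def using pos by (auto simp: pos_le_divide_eq)
  have "bdd_below (?r ` ?V)"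
    using delta_nonneg pos by (intro bdd_belowI[of _ 0]) (auto intro!: divide_nonneg_pos)
  then have "popa_ineq M tr A c0" unfolding popa_iff c0_def by (auto intro!: cINF_lower)
  moreover have "k \<le> c0" if "popa_ineq M tr A k" for k
    unfolding c0_def by (rule cINF_greatest[OF ne]) (use that popa_iff in blast)
  ultimately have "delta_inv M tr A = c0" unfolding delta_inv_def by (intro Greatest_equality)
  then show ?thesis using \<open>\<And>k. popa_ineq M tr A k \<Longrightarrow> k \<le> c0\<close>[OF c] by simp
qed

text \<open>The set of constants whose supremum is \<open>\<alpha>(A)\<close> is not empty.\<close>

lemma sing_ineq_zero: "sing_ineq M tr A 0"
  unfolding sing_ineq_def
proof (intro ballI impI)
  fix u assume u: "u \<in> M" "unitary u"
  interpret U: masa_in M tr "conj_set u A" by unfold_locales (rule masa_conj[OF u])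
  let ?d = "\<lambda>x. cond_exp M tr (conj_set u A) x - E x"
  have "n2 (?d x) \<le> 2" if "x \<in> M" "norm x \<le> 1" for x
  proof -
    have "n2 (?d x) \<le> n2 (cond_exp M tr (conj_set u A) x) + n2 (E x)" using that by (intro n2_triangle_diff) auto
    then show ?thesis using n2_E_le[OF that(1)] U.n2_E_le[OF that(1)] n2_le_norm[OF that(1)] that(2) by linarith
  qed
  then have "bdd_above ((\<lambda>x. n2 (?d x)) ` {x \<in> M. norm x \<le> 1})" by (auto intro!: bdd_aboveI[of _ 2])
  then have le: "n2 (?d 0) \<le> norm_inf_2 M tr ?d"
    unfolding norm_inf_2_def by (intro cSUP_upper) auto
  have "0 \<le> n2 (?d 0)" by simp
  then have "0 \<le> norm_inf_2 M tr ?d" using le by (rule order_trans)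
  then show "0 * n2 (u - E u) \<le> norm_inf_2 M tr ?d" by simp
qed

end

theorem theorem5p3:
  fixes M A :: "('h :: chilbert_space) operator set"
    and tr :: "'h operator \<Rightarrow> complex"
  assumes "type_II1_factor M" and "normalized_trace M tr" and "masa A M"
  shows "delta_inv M tr A \<ge> alpha_inv M tr A / sqrt 5 \<and>
    (strongly_singular M tr A \<longrightarrow> delta_inv M tr A \<ge> 1 / sqrt 5)"
proof -
  interpret masa_in_II1 M tr A
    by unfold_locales (use assms in \<open>simp_all add: type_II1_factor_def factor_def\<close>)
  have sing: "\<alpha> / sqrt 5 \<le> delta_inv M tr A" if "sing_ineq M tr A \<alpha>" for \<alpha>
    by (rule popa_ineq_le_delta_inv[OF popa_ineq_of_sing_ineq[OF that]])
  have "alpha_inv M tr A \<le> delta_inv M tr A * sqrt 5"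
    unfolding alpha_inv_def
  proof (rule cSup_least)
    show "{\<alpha>. sing_ineq M tr A \<alpha>} \<noteq> {}" using sing_ineq_zero by blast
    show "\<alpha> \<le> delta_inv M tr A * sqrt 5" if "\<alpha> \<in> {\<alpha>. sing_ineq M tr A \<alpha>}" for \<alpha>
      using sing[of \<alpha>] that by (simp add: field_simps)
  qed
  then have "alpha_inv M tr A / sqrt 5 \<le> delta_inv M tr A" by (simp add: field_simps)
  then show ?thesis using sing[of 1] by (simp add: strongly_singular_def)
qed

end
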